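(* Let $n\ge2$, $k\ge1$, let $\mathcal G$ be the set of distinguished Gaussian elimination isomorphisms for the braid $ft_n^k=(\sigma_1\sigma_2\cdots\sigma_{n-1})^k$, and let $G$ be the directed graph whose vertices are the elements of $\mathcal G$, with an edge from $\alpha:(s,\epsilon)\to(t,\delta)$ to a different element $\alpha':(s',\epsilon')\to(t',\delta')$ whenever the component of the differential of $\mathrm{CKh}(ft_n^k)$ from $(s,\epsilon)$ to $(t',\delta')$ is nonzero. Then $G$ is acyclic, i.e. it has no directed cycles.
   Context: **Kauffman states.** The braid word $ft_n^k=(\sigma_1\cdots\sigma_{n-1})^k$ has $N=k(n-1)$ crossings, read left to right, in positions $1,\dots,N$. The $0$-resolution of a crossing $\sigma_i$ is the identity on $n$ strands; the $1$-resolution is $e_i$ (cup-cap on strands $i,i+1$). A Kauffman state is a choice of resolution at every crossing; it is recorded by a barred word $w$, obtained from the braid word by replacing $\sigma_i$ by $i$ ($0$-resolution) or $\bar i$ ($1$-resolution). Subscripts such as $\bar i_j$ indicate the position $j$. "Barring" a letter means changing its resolution from $0$ to $1$. The resulting crossingless tangle $W$ (arcs and closed components) is the product of the $e_i$ over the barred letters $\bar i$, read left to right. An enhanced Kauffman state $(w,\epsilon)$ is a Kauffman state together with a marking $\epsilon$ of each closed component of $W$ by $+$ or $-$. All crossings are positive, so the homological degree of $(w,\epsilon)$ is the number of barred letters. For a closed component $C$ of $W$, $\ell(C)$ (resp. $r(C)$) is the barred crossing of smallest (resp. largest) position whose resolution $e_i$ borders $C$. **Khovanov complex.** $\mathrm{CKh}(ft_n^k)$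 is Bar-Natan's complex over dotted cobordisms (sphere $=0$, dotted sphere $=1$, two dots on one component $=0$, neck-cutting), with every closed circle delooped. In degree $h$ it is the direct sum over enhanced states of degree $h$ of the tangle $W$ with circles removed (with quantum shifts). A component of the differential $(s,\epsilon)\to(t,\delta)$ can be nonzero only if $t$ is obtained from $s$ by barring one letter and markings on circles not touching that crossing agree. Up to sign it is then: for two arcs, a saddle; for a circle merging into an arc, the identity if the circle is marked $+$ and the dotted identity if it is marked $-$; for an arc splitting off a circle, the identity if the new circle is marked $-$ and the dotted identity if marked $+$; for two circles merging, $+\,+\mapsto+$, $\;+\,-\mapsto-$, $\;-\,+\mapsto -$ and $-\,-\mapsto 0$; for a circle splitting, $+\mapsto (+-)+(-+)$, $\;-\mapsto(--)$. **Gaussian elimination (GE) isomorphisms.** A GE pair $(s,\epsilon),(t,\delta)$ is one of the following, with $j'-j=n-1$ and markings agreeing on all other closed components. G1: $s=u\,\bar i_j\,x\,i_{j'}\,z$ and $t=u\,\bar i_j\,x\,\bar i_{j'}\,z$, where the resolution of $t$ has a closed component $C$ with $\ell(C)=\bar i_j$, $r(C)=\bar i_{j'}$, marked $-$ by $\delta$. G2: $s=u\,\bar i_j\,x\,\bar i_{j'}\,z$ and $t=u\,\bar i_j\,x_L\,\overline{(i+1)}\,x_R\,\bar i_{j'}\,z$ (the letter $i+1$ between the two $i$'s is barred), where the resolution of $s$ has a closed component $C$ with $\ell(C)=\bar i_j$, $r(C)=\bar i_{j'}$, marked $+$ by $\epsilon$. In each case the component of the differential from $(s,\epsilon)$ (the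 source) to $(t,\delta)$ (the target) is an isomorphism, called a G1 (resp. G2) isomorphism, supported on the subword from position $j$ to position $j'$. **Distinguished isomorphisms.** The set $\mathcal G$ is built by processing the enhanced states $(w,\epsilon)$ in increasing order of homological degree. For each $(w,\epsilon)$, of degree $d$, subwords of $w$ are scanned: "start" runs over barred letters from left to right and, for each start, "stop" runs over the letters to its right from left to right. For each such subword in turn: (Step 1) if the subword exhibits $(w,\epsilon)$ as the target of a G1 or G2 isomorphism already placed in $\mathcal G$ (with source in degree $d-1$), no isomorphism with source $(w,\epsilon)$ is chosen, and one passes to the next state; (Step 2) otherwise, if the subword supports a G1 or G2 isomorphism with source $(w,\epsilon)$, that isomorphism is added to $\mathcal G$, and one passes to the next state; (Step 3) otherwise go on to the next subword. Elements of $\mathcal G$ are called distinguished. *)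

theory Defs
  imports Main "HOL-Library.Poly_Mapping"
begin

text \<open>
  The letter in position \<open>p\<close> (counted from 1) of the word
  \<open>ft_n^k = (1 2 \<dots> n-1)^k\<close>, and the number of crossings.
\<close>

definition crossings :: "nat \<Rightarrow> nat \<Rightarrow> nat" where
  "crossings n k = k * (n - 1)"

definition letter :: "nat \<Rightarrow> nat \<Rightarrow> nat" where
  "letter n p = (p - 1) mod (n - 1) + 1"

section \<open>Kauffman states and their resolutions\<close>

text \<open>
  A Kauffman state is the set of its barred positions. The point \<open>(l, m)\<close> is the \<open>m\<close>-th strand
  (\<open>1 \<le> m \<le> n\<close>) just after the first \<open>l\<close> crossings, so that the crossing in position \<open>p\<close> lies
  between the levels \<open>p - 1\<close> and \<open>p\<close>. A component of the resolution is represented by the set of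
  points on it.
\<close>

type_synonym kauffman_state = "nat set"
type_synonym point = "nat \<times> nat"

definition kauffman_states :: "nat \<Rightarrow> nat \<Rightarrow> kauffman_state set" where
  "kauffman_states n k = Pow {1..crossings n k}"

definition points :: "nat \<Rightarrow> nat \<Rightarrow> point set" where
  "points n k = {0..crossings n k} \<times> {1..n}"

text \<open>
  The segments of the resolution between the levels \<open>p - 1\<close> and \<open>p\<close>: the identity on all strands,
  or \<open>e\<^sub>i\<close>, which turns back strands \<open>i\<close> and \<open>i + 1\<close> on both sides.
\<close>

definition segments :: "nat \<Rightarrow> kauffman_state \<Rightarrow> nat \<Rightarrow> (point \<times> point) set" where
  "segments n w p = (let i = letter n p in
     if p \<in> w
     then {((p - 1, m), (p, m)) | m. m \<in> {1..n} - {i, Suc i}}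
          \<union> {((p - 1, i), (p - 1, Suc i)), ((p, i), (p, Suc i))}
     else {((p - 1, m), (p, m)) | m. m \<in> {1..n}})"

definition segment_graph :: "nat \<Rightarrow> nat \<Rightarrow> kauffman_state \<Rightarrow> (point \<times> point) set" where
  "segment_graph n k w = (\<Union>p\<in>{1..crossings n k}. segments n w p)"

definition tangle_component :: "nat \<Rightarrow> nat \<Rightarrow> kauffman_state \<Rightarrow> point \<Rightarrow> point set" where
  "tangle_component n k w x = ((segment_graph n k w \<union> (segment_graph n k w)\<inverse>)\<^sup>*) `` {x}"

text \<open>
  Every point strictly between the two ends is the endpoint of exactly two segments, so the closed
  components are those without a point on the left or right boundary; the others are arcs.
\<close>

definition closed_components :: "nat \<Rightarrow> nat \<Rightarrow> kauffman_state \<Rightarrow> point set set" where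
  "closed_components n k w =
     {C \<in> tangle_component n k w ` points n k. \<forall>(l, m) \<in> C. l \<noteq> 0 \<and> l \<noteq> crossings n k}"

definition borders :: "nat \<Rightarrow> kauffman_state \<Rightarrow> nat \<Rightarrow> point set \<Rightarrow> bool" where
  "borders n w p C \<longleftrightarrow> p \<in> w \<and> ((p - 1, letter n p) \<in> C \<or> (p, letter n p) \<in> C)"

definition first_crossing :: "nat \<Rightarrow> kauffman_state \<Rightarrow> point set \<Rightarrow> nat" where
  "first_crossing n w C = Min {p. borders n w p C}"

definition last_crossing :: "nat \<Rightarrow> kauffman_state \<Rightarrow> point set \<Rightarrow> nat" where
  "last_crossing n w C = Max {p. borders n w p C}"

section \<open>Enhanced Kauffman states\<close>

datatype mark = Plus | Minus

type_synonym marking = "point set \<rightharpoonup> mark"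
type_synonym enhanced_state = "kauffman_state \<times> marking"

definition enhanced_states :: "nat \<Rightarrow> nat \<Rightarrow> enhanced_state set" where
  "enhanced_states n k =
     {(w, \<epsilon>). w \<in> kauffman_states n k \<and> dom \<epsilon> = closed_components n k w}"

definition degree :: "enhanced_state \<Rightarrow> nat" where
  "degree S = card (fst S)"

section \<open>The differential of the delooped Khovanov complex\<close>

text \<open>
  The dotted cobordisms, between tangles without circles, that occur in the differential. For a fixed
  source and target they are linearly independent over the integers in the dotted cobordism category, so
  a component of the differential is an element of the free abelian group on them. A dot is recorded
  by the arc of the target carrying it.
\<close>

datatype dotted_cobordism = Identity | Dotted_Identity "point set" | Saddle

fun merge_marks :: "mark \<Rightarrow> mark \<Rightarrow> mark option" where
  "merge_marks Plus Plus = Some Plus"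
| "merge_marks Plus Minus = Some Minus"
| "merge_marks Minus Plus = Some Minus"
| "merge_marks Minus Minus = None"

text \<open>
  The cobordism (up to sign, \<open>None\<close> for zero) when two components with markings \<open>a\<close>, \<open>b\<close> meet at
  the crossing; the mark of an arc is \<open>None\<close>. If they merge, \<open>D\<close> is the resulting component and
  \<open>c\<close> its marking.
\<close>

definition merge_cobordism ::
  "mark option \<Rightarrow> mark option \<Rightarrow> mark option \<Rightarrow> point set \<Rightarrow> dotted_cobordism option" where
  "merge_cobordism a b c D = (case (a, b) of
       (None, None) \<Rightarrow> Some Saddle
     | (Some Plus, None) \<Rightarrow> Some Identity
     | (Some Minus, None) \<Rightarrow> Some (Dotted_Identity D)
     | (None, Some Plus) \<Rightarrow> Some Identity
     | (None, Some Minus) \<Rightarrow> Some (Dotted_Identity D)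
     | (Some a', Some b') \<Rightarrow>
         if c \<noteq> None \<and> c = merge_marks a' b' then Some Identity else None)"

text \<open>
  The same when one component with marking \<open>a\<close> splits into \<open>D\<^sub>1\<close>, \<open>D\<^sub>2\<close> with markings \<open>c\<^sub>1\<close>, \<open>c\<^sub>2\<close>.
  By planarity an arc splits into a circle and an arc, and a circle into two circles; the last
  case does not occur.
\<close>

definition split_cobordism ::
  "mark option \<Rightarrow> mark option \<Rightarrow> mark option \<Rightarrow> point set \<Rightarrow> point set
     \<Rightarrow> dotted_cobordism option" where
  "split_cobordism a c\<^sub>1 c\<^sub>2 D\<^sub>1 D\<^sub>2 = (case (a, c\<^sub>1, c\<^sub>2) of
       (None, Some Minus, None) \<Rightarrow> Some Identity
     | (None, Some Plus, None) \<Rightarrow> Some (Dotted_Identity D\<^sub>2)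
     | (None, None, Some Minus) \<Rightarrow> Some Identity
     | (None, None, Some Plus) \<Rightarrow> Some (Dotted_Identity D\<^sub>1)
     | (Some Plus, Some d\<^sub>1, Some d\<^sub>2) \<Rightarrow> if d\<^sub>1 \<noteq> d\<^sub>2 then Some Identity else None
     | (Some Minus, Some d\<^sub>1, Some d\<^sub>2) \<Rightarrow>
         if d\<^sub>1 = Minus \<and> d\<^sub>2 = Minus then Some Identity else None
     | _ \<Rightarrow> None)"

definition touches :: "nat \<Rightarrow> nat \<Rightarrow> point set \<Rightarrow> bool" where
  "touches n p C \<longleftrightarrow> (let i = letter n p in
     C \<inter> {(p - 1, i), (p - 1, Suc i), (p, i), (p, Suc i)} \<noteq> {})"

text \<open>
  The cobordism obtained from barring the letter in position \<open>p\<close>. Beforehand the crossing is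
  met by the components through the strands \<open>i\<close> and \<open>i + 1\<close> on its left, afterwards by the
  components turning back on its left and on its right.
\<close>

fun crossing_cobordism ::
  "nat \<Rightarrow> nat \<Rightarrow> nat \<Rightarrow> enhanced_state \<Rightarrow> enhanced_state \<Rightarrow> dotted_cobordism option" where
  "crossing_cobordism n k p (s, \<epsilon>) (t, \<delta>) =
     (let i = letter n p;
          A = tangle_component n k s (p - 1, i);
          B = tangle_component n k s (p - 1, Suc i);
          L = tangle_component n k t (p - 1, i);
          R = tangle_component n k t (p, i)
      in if A \<noteq> B then merge_cobordism (\<epsilon> A) (\<epsilon> B) (\<delta> L) L
         else split_cobordism (\<epsilon> A) (\<delta> L) (\<delta> R) L R)"

text \<open>
  The signs follow the usual convention for the cube of resolutions. Circles not touching the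
  crossing consist of the same points before and after.
\<close>

fun differential ::
  "nat \<Rightarrow> nat \<Rightarrow> enhanced_state \<Rightarrow> enhanced_state \<Rightarrow> (dotted_cobordism \<Rightarrow>\<^sub>0 int)" where
  "differential n k (s, \<epsilon>) (t, \<delta>) =
     (if (s, \<epsilon>) \<in> enhanced_states n k \<and> (t, \<delta>) \<in> enhanced_states n k
         \<and> (\<exists>p. p \<notin> s \<and> t = insert p s)
      then let p = the_elem (t - s) in
        if \<forall>C \<in> closed_components n k s \<union> closed_components n k t.
             \<not> touches n p C \<longrightarrow> \<epsilon> C = \<delta> C
        then (case crossing_cobordism n k p (s, \<epsilon>) (t, \<delta>) of
                None \<Rightarrow> 0
              | Some X \<Rightarrow> Poly_Mapping.single X ((- 1) ^ card {q \<in> s. q < p}))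
        else 0
      else 0)"

section \<open>Gaussian elimination isomorphisms\<close>

text \<open>
  Apart from the circle \<open>C\<close> of a Gaussian elimination pair, the closed components of source and
  target correspond bijectively, but the point set of the component that \<open>C\<close> splits off from or
  merges into changes by the points of \<open>C\<close>. Corresponding components are those that intersect.
\<close>

definition agree_apart_from ::
  "nat \<Rightarrow> nat \<Rightarrow> point set \<Rightarrow> enhanced_state \<Rightarrow> enhanced_state \<Rightarrow> bool" where
  "agree_apart_from n k C S T \<longleftrightarrow>
     (\<forall>D \<in> closed_components n k (fst S) - {C}. \<forall>E \<in> closed_components n k (fst T) - {C}.
        D \<inter> E \<noteq> {} \<longrightarrow> snd S D = snd T E)"

fun G1_pair :: "nat \<Rightarrow> nat \<Rightarrow> nat \<Rightarrow> nat \<Rightarrow> enhanced_state \<Rightarrow> enhanced_state \<Rightarrow> bool" where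
  "G1_pair n k j j' (s, \<epsilon>) (t, \<delta>) \<longleftrightarrow>
     (s, \<epsilon>) \<in> enhanced_states n k \<and> (t, \<delta>) \<in> enhanced_states n k \<and>
     j' = j + (n - 1) \<and> j \<in> s \<and> j' \<notin> s \<and> t = insert j' s \<and>
     (\<exists>C \<in> closed_components n k t.
        first_crossing n t C = j \<and> last_crossing n t C = j' \<and> \<delta> C = Some Minus \<and>
        agree_apart_from n k C (s, \<epsilon>) (t, \<delta>))"

fun G2_pair :: "nat \<Rightarrow> nat \<Rightarrow> nat \<Rightarrow> nat \<Rightarrow> enhanced_state \<Rightarrow> enhanced_state \<Rightarrow> bool" where
  "G2_pair n k j j' (s, \<epsilon>) (t, \<delta>) \<longleftrightarrow>
     (s, \<epsilon>) \<in> enhanced_states n k \<and> (t, \<delta>) \<in> enhanced_states n k \<and>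
     j' = j + (n - 1) \<and> j \<in> s \<and> j' \<in> s \<and>
     (\<exists>p. j < p \<and> p < j' \<and> letter n p = letter n j + 1 \<and> p \<notin> s \<and> t = insert p s) \<and>
     (\<exists>C \<in> closed_components n k s.
        first_crossing n s C = j \<and> last_crossing n s C = j' \<and> \<epsilon> C = Some Plus \<and>
        agree_apart_from n k C (s, \<epsilon>) (t, \<delta>))"

text \<open>An isomorphism is represented by its source and target.\<close>

type_synonym ge_iso = "enhanced_state \<times> enhanced_state"

definition supports :: "nat \<Rightarrow> nat \<Rightarrow> nat \<times> nat \<Rightarrow> ge_iso \<Rightarrow> bool" where
  "supports n k J \<alpha> \<longleftrightarrow>
     G1_pair n k (fst J) (snd J) (fst \<alpha>) (snd \<alpha>) \<or> G2_pair n k (fst J) (snd J) (fst \<alpha>) (snd \<alpha>)"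

section \<open>Distinguished isomorphisms\<close>

text \<open>The pairs (start, stop) in the order in which they are scanned.\<close>

definition subwords :: "nat \<Rightarrow> nat \<Rightarrow> kauffman_state \<Rightarrow> (nat \<times> nat) list" where
  "subwords n k w =
     [(a, b). a \<leftarrow> filter (\<lambda>p. p \<in> w) [1..<Suc (crossings n k)],
              b \<leftarrow> [Suc a..<Suc (crossings n k)]]"

text \<open>
  Scanning the subwords of one enhanced state \<open>S\<close>, where \<open>\<D>\<close> is the set of isomorphisms chosen
  so far; the result is what is added to it. A subword supports at most one isomorphism with a
  given source.
\<close>

fun scan :: "nat \<Rightarrow> nat \<Rightarrow> ge_iso set \<Rightarrow> enhanced_state \<Rightarrow> (nat \<times> nat) list \<Rightarrow> ge_iso set" where
  "scan n k \<D> S [] = {}"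
| "scan n k \<D> S (J # Js) =
     (if \<exists>R. (R, S) \<in> \<D> \<and> supports n k J (R, S) then {}
      else if \<exists>T. supports n k J (S, T) then {(S, T) | T. supports n k J (S, T)}
      else scan n k \<D> S Js)"

text \<open>
  \<open>distinguished_below n k d\<close> is the set after all states of degree less than \<open>d\<close> have been
  processed. States of equal degree do not influence each other, since the scan of a state
  only looks for isomorphisms whose source has smaller degree.
\<close>

fun distinguished_below :: "nat \<Rightarrow> nat \<Rightarrow> nat \<Rightarrow> ge_iso set" where
  "distinguished_below n k 0 = {}"
| "distinguished_below n k (Suc d) =
     distinguished_below n k d \<union>
     (\<Union>S \<in> {S \<in> enhanced_states n k. degree S = d}.
        scan n k (distinguished_below n k d) S (subwords n k (fst S)))"

definition distinguished :: "nat \<Rightarrow> nat \<Rightarrow> ge_iso set" where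
  "distinguished n k = distinguished_below n k (Suc (crossings n k))"

definition GE_graph :: "nat \<Rightarrow> nat \<Rightarrow> (ge_iso \<times> ge_iso) set" where
  "GE_graph n k =
     {(\<alpha>, \<alpha>'). \<alpha> \<in> distinguished n k \<and> \<alpha>' \<in> distinguished n k \<and> \<alpha> \<noteq> \<alpha>' \<and>
               differential n k (fst \<alpha>) (snd \<alpha>') \<noteq> 0}"

end

theory Submission
  imports Defs
begin

text \<open>
  Whether a state is matched, and in which window, is decided by bars and by marks of circles
  that are unions of rectangles: the first window in which \<open>phi\<close> holds is the one in which the state
  is matched, both for sources and for targets.

  Along a cycle, consider the matched windows of minimal height \<open>letter + 2 * row\<close>, and among them the
  one with the smallest letter \<open>i\<close>. The bars that decide about this window can be dropped only by
  isomorphisms of the window itself. This excludes G1, so the letter \<open>i + 1\<close> in the window is dropped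
  by G2, and it must be added again. When it is dropped, the window of the letter \<open>i + 2\<close> that it blocks
  would not be matched without the bar, but when it is added that window would be matched. Hence
  the status of the latter window changes in between. If this happens by bars, then it happens by G2
  isomorphisms in that window, which has the same height, and the argument is repeated with
  \<open>i + 2\<close>. Otherwise it happens by the mark of a circle that is not touched in the meantime, a
  contradiction.
\<close>

text \<open>Whether an isomorphism is distinguished depends on scans of states of lower degree,
  which cannot be followed along an edge; \<open>phi\<close> refers to one state only. The price is
  a recursion: dropping the letter i + 1 of a window by G2 unblocks the earlier window of the letter
  i + 2, which may then claim the state. The recursion can end at a circle of the largest letter,
  which has no letter above it for a G2 isomorphism; only there does the mark decide. Ties in height
  are broken by the smallest letter because the letter i - 1 of the minimal window could be dropped
  by G2 in a window of the same height and the letter i - 2. The remaining obstacle is that edges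
  merge circles and may thereby change marks. The merges that matter along the sequence of windows
  are with circles marked \<open>Plus\<close>. As \<open>Plus\<close> is the unit of the merge, the
  decisive mark survives even the step in which the dropped letter is added again.\<close>

locale braid =
  fixes n M k :: nat
  assumes n_eq: "n = Suc M" and M_ge_1 [simp]: "Suc 0 \<le> M"
begin

lemma M_pos [simp]: "0 < M" "M \<noteq> 0"
  using M_ge_1 by linarith+

lemma n_diff [simp]: "n - Suc 0 = M"
  by (simp add: n_eq)

abbreviation "N \<equiv> crossings n k"
abbreviation "lt \<equiv> letter n"

section \<open>Letters, rows and heights of positions\<close>

definition row :: "nat \<Rightarrow> nat" where
  "row p = (p - 1) div M"

text \<open>
  The weights 1 of the letter and 2 of the row are chosen so that a G1 isomorphism in a window drops a
  bar that is 2 higher than the window, a G2 isomorphism one that is 1 higher, and so that all windows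
  of a diagonal sequence (see \<open>nxt\<close> below) have the same height.
\<close>

definition height :: "nat \<Rightarrow> nat" where
  "height p = lt p + 2 * row p"

lemma letter_eq: "lt p = Suc ((p - 1) mod M)"
  by (simp add: letter_def)

lemma letter_pos [simp]: "0 < lt p" "Suc 0 \<le> lt p"
  by (auto simp: letter_eq)

lemma letter_le [simp]: "lt p \<le> M"
  by (simp add: letter_eq Suc_le_eq)

lemma letter_less [simp]: "lt p < n" "lt p \<le> n" "Suc (lt p) \<le> n"
  using letter_le[of p] by (auto simp: n_eq simp del: letter_le)

lemma letter_period: "a \<ge> 1 \<Longrightarrow> lt (a + M) = lt a"
  by (cases a) (auto simp: letter_eq)

lemma row_period: "a \<ge> 1 \<Longrightarrow> row (a + M) = row a + 1"
  by (cases a) (auto simp: row_def div_add_self2)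

lemma height_period: "a \<ge> 1 \<Longrightarrow> height (a + M) = height a + 2"
  using letter_period row_period by (simp add: height_def)

lemma letter_Suc: "a \<ge> 1 \<Longrightarrow> lt (Suc a) = (if lt a < M then Suc (lt a) else 1)"
  using mod_less_divisor[OF M_pos(1), of "a - 1"]
  by (cases a) (auto simp: letter_eq mod_Suc Suc_le_eq order_less_le simp del: mod_less_divisor)

lemma row_Suc: "a \<ge> 1 \<Longrightarrow> lt a < M \<Longrightarrow> row (Suc a) = row a"
  by (cases a) (auto simp: letter_eq row_def div_Suc mod_Suc)

lemma height_Suc: "a \<ge> 1 \<Longrightarrow> lt a < M \<Longrightarrow> height (Suc a) = Suc (height a)"
  by (simp add: height_def letter_Suc row_Suc)

lemma letter_plus:
  assumes "a \<ge> 1" "d \<le> M"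
  shows "lt (a + d) = (if lt a + d \<le> M then lt a + d else lt a + d - M)"
  using assms(2)
proof (induction d)
  case (Suc d)
  then show ?case using letter_Suc[of "a + d"] assms(1) letter_le[of a]
    by (auto simp: not_less split: if_splits simp del: letter_le)
qed simp

text \<open>The position just before \<open>a + M\<close> lies one letter, hence 1, below a position
  that is 2 higher than \<open>a\<close>.\<close>

lemma letter_before:
  assumes "a \<ge> 1" "lt a \<ge> 2"
  shows "lt (a + M - 1) = lt a - 1" "height (a + M - 1) = height a + 1"
proof -
  define x where "x = a + M - 1"
  have e: "a + M = Suc x" "x \<ge> 1" using assms M_pos by (auto simp: x_def simp del: M_pos)
  have l: "lt x < M" "lt (Suc x) = lt a"
    using letter_period[of a] letter_Suc[of x] e assms by (auto split: if_splits)
  show "lt (a + M - 1) = lt a - 1" "height (a + M - 1) = height a + 1"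
    using l letter_Suc[of x] height_Suc[of x] height_period[of a] e assms unfolding x_def[symmetric]
    by auto
qed

text \<open>Two letters up raise the height by 2 and one row back lowers it by 2.\<close>

lemma letter_diag:
  assumes "c \<ge> 1" "c + M = a + 2" "lt a + 2 \<le> M" "a \<ge> 1"
  shows "lt c = lt a + 2" "height c = height a"
proof -
  have 2: "lt (Suc (Suc a)) = lt a + 2" "height (Suc (Suc a)) = height a + 2"
    using letter_Suc[of a] height_Suc[of a] letter_Suc[of "Suc a"] height_Suc[of "Suc a"] assms by auto
  show "lt c = lt a + 2" "height c = height a"
    using 2 letter_period[of c] height_period[of c] assms by auto
qed

text \<open>The M - 1 positions strictly inside a window carry every letter other than
  \<open>lt a\<close> once. Only the neighbouring letters meet the strands of \<open>lt a\<close>,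
  and they can occur only at the two ends.\<close>

lemma letter_between:
  assumes "a \<ge> 1" "a < p" "p < a + M"
  shows "lt p \<noteq> lt a" "lt p = Suc (lt a) \<Longrightarrow> p = Suc a" "Suc (lt p) = lt a \<Longrightarrow> p = a + M - 1"
proof -
  define d where "d = p - a"
  have d: "p = a + d" "d < M" "d > 0" using assms by (auto simp: d_def)
  have e: "lt p = (if lt a + d \<le> M then lt a + d else lt a + d - M)"
    using letter_plus[OF assms(1), of d] d by simp
  show "lt p \<noteq> lt a" "lt p = Suc (lt a) \<Longrightarrow> p = Suc a" "Suc (lt p) = lt a \<Longrightarrow> p = a + M - 1"
    using e d letter_le[of a] by (auto split: if_splits simp del: letter_le)
qed

section \<open>Components\<close>

abbreviation G where "G \<equiv> segment_graph n k"
abbreviation comp where "comp \<equiv> tangle_component n k"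
abbreviation closed where "closed \<equiv> closed_components n k"
abbreviation ES where "ES \<equiv> enhanced_states n k"

lemma G_cases:
  assumes "(u, v) \<in> G w"
  obtains (straight) p m where "1 \<le> p" "p \<le> N" "1 \<le> m" "m \<le> n"
      "p \<in> w \<Longrightarrow> m \<noteq> lt p \<and> m \<noteq> Suc (lt p)" "u = (p - 1, m)" "v = (p, m)"
    | (left) p where "1 \<le> p" "p \<le> N" "p \<in> w" "u = (p - 1, lt p)" "v = (p - 1, Suc (lt p))"
    | (right) p where "1 \<le> p" "p \<le> N" "p \<in> w" "u = (p, lt p)" "v = (p, Suc (lt p))"
  using assms
proof -
  from assms obtain p where p: "1 \<le> p" "p \<le> N" "(u, v) \<in> segments n w p"
    by (auto simp: segment_graph_def)
  show thesis
  proof (cases "p \<in> w")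
    case True
    then consider m where "u = (p - 1, m)" "v = (p, m)" "m \<in> {1..n} - {lt p, Suc (lt p)}"
      | "u = (p - 1, lt p)" "v = (p - 1, Suc (lt p))" | "u = (p, lt p)" "v = (p, Suc (lt p))"
      using p(3) by (auto simp: segments_def Let_def)
    then show thesis using p True by cases (auto intro: that)
  next
    case False
    then obtain m where "u = (p - 1, m)" "v = (p, m)" "m \<in> {1..n}"
      using p(3) by (auto simp: segments_def Let_def)
    then show thesis using p False by (auto intro: that(1))
  qed
qed

lemma G_straight:
  "l < N \<Longrightarrow> 1 \<le> m \<Longrightarrow> m \<le> n \<Longrightarrow> (Suc l \<in> w \<Longrightarrow> m \<noteq> lt (Suc l) \<and> m \<noteq> Suc (lt (Suc l)))
    \<Longrightarrow> ((l, m), (Suc l, m)) \<in> G w"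
  by (force simp: segment_graph_def segments_def Let_def intro!: bexI[of _ "Suc l"])

lemma G_left: "1 \<le> p \<Longrightarrow> p \<le> N \<Longrightarrow> p \<in> w \<Longrightarrow> ((p - 1, lt p), (p - 1, Suc (lt p))) \<in> G w"
  and G_right: "1 \<le> p \<Longrightarrow> p \<le> N \<Longrightarrow> p \<in> w \<Longrightarrow> ((p, lt p), (p, Suc (lt p))) \<in> G w"
  by (force simp: segment_graph_def segments_def Let_def intro!: bexI[of _ "p"])+

lemma comp_refl [simp]: "u \<in> comp w u"
  by (simp add: tangle_component_def)

lemma comp_eqI: "v \<in> comp w u \<Longrightarrow> comp w v = comp w u"
proof -
  assume v: "v \<in> comp w u"
  let ?R = "(G w \<union> (G w)\<inverse>)\<^sup>*"
  have s: "sym ?R" by (intro sym_rtrancl) (auto simp: sym_def)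
  from v have uv: "(u, v) \<in> ?R" by (simp add: tangle_component_def)
  then have vu: "(v, u) \<in> ?R" using s by (rule symD[rotated])
  show ?thesis
    using uv vu by (auto simp: tangle_component_def intro: rtrancl_trans)
qed

lemma comp_sym: "v \<in> comp w u \<Longrightarrow> u \<in> comp w v"
  using comp_eqI comp_refl by metis

lemma comp_eq_iff: "comp w u = comp w v \<longleftrightarrow> v \<in> comp w u"
  using comp_eqI comp_refl by metis

lemma comp_trans: "v \<in> comp w u \<Longrightarrow> x \<in> comp w v \<Longrightarrow> x \<in> comp w u"
  using comp_eqI by simp

lemma comp_edge: "(u, v) \<in> G w \<Longrightarrow> v \<in> comp w u"
  by (auto simp: tangle_component_def)

lemma comp_edge': "(u, v) \<in> G w \<Longrightarrow> u \<in> comp w v"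
  by (auto simp: tangle_component_def)

lemma comp_subset:
  assumes "u \<in> X" "\<And>x y. (x, y) \<in> G w \<Longrightarrow> x \<in> X \<longleftrightarrow> y \<in> X"
  shows "comp w u \<subseteq> X"
proof
  fix v assume "v \<in> comp w u"
  then have "(u, v) \<in> (G w \<union> (G w)\<inverse>)\<^sup>*" by (simp add: tangle_component_def)
  then show "v \<in> X" by (induction rule: rtrancl_induct) (use assms in auto)
qed

lemma comp_mono:
  assumes "\<And>x y. (x, y) \<in> G w \<Longrightarrow> y \<in> comp w' x"
  shows "comp w u \<subseteq> comp w' u"
proof (rule comp_subset)
  fix x y assume "(x, y) \<in> G w"
  then have "y \<in> comp w' x" "x \<in> comp w' y" using assms comp_sym by auto
  then show "x \<in> comp w' u \<longleftrightarrow> y \<in> comp w' u" by (auto intro: comp_trans)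
qed simp

lemma comp_closed_edge: "(x, y) \<in> G w \<Longrightarrow> x \<in> comp w u \<longleftrightarrow> y \<in> comp w u"
  by (meson comp_edge comp_edge' comp_trans)

lemma comp_points: "u \<in> points n k \<Longrightarrow> comp w u \<subseteq> points n k"
  by (rule comp_subset, assumption) (auto simp: points_def Suc_le_eq elim!: G_cases)

lemma closed_comp_iff:
  "u \<in> points n k \<Longrightarrow> comp w u \<in> closed w \<longleftrightarrow> (\<forall>(l, m) \<in> comp w u. l \<noteq> 0 \<and> l \<noteq> N)"
  by (auto simp: closed_components_def)

lemma closedE:
  assumes "D \<in> closed w"
  obtains u where "u \<in> points n k" "D = comp w u"
  using assms by (auto simp: closed_components_def)

lemma closed_mem: "D \<in> closed w \<Longrightarrow> u \<in> D \<Longrightarrow> D = comp w u \<and> u \<in> points n k"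
  by (metis closedE comp_eqI comp_points subsetD)

lemma closed_nonempty: "D \<in> closed w \<Longrightarrow> D \<noteq> {}"
  by (metis closedE comp_refl empty_iff)

lemma comp_strand:
  assumes "l \<le> l'" "l' \<le> N" "1 \<le> m" "m \<le> n"
    and "\<And>p. l < p \<Longrightarrow> p \<le> l' \<Longrightarrow> p \<in> w \<Longrightarrow> m \<noteq> lt p \<and> m \<noteq> Suc (lt p)"
  shows "(l', m) \<in> comp w (l, m)"
  using assms
proof (induction "l' - l" arbitrary: l')
  case 0
  then show ?case by simp
next
  case (Suc d)
  define r where "r = l' - 1"
  have r: "l' = Suc r" "l \<le> r" using Suc.hyps(2) by (auto simp: r_def)
  have "(r, m) \<in> comp w (l, m)" using Suc.prems r Suc.hyps by (intro Suc.hyps(1)) auto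
  moreover have "(l', m) \<in> comp w (r, m)"
    using Suc.prems r by (auto intro!: comp_edge G_straight) (metis order_refl less_Suc_eq_le)+
  ultimately show ?case by (rule comp_trans)
qed

section \<open>Rectangular circles\<close>

abbreviation word :: "nat set \<Rightarrow> bool" where
  "word w \<equiv> w \<subseteq> {1..N}"

text \<open>
  A circle with first crossing \<open>a\<close> and last crossing \<open>a + M\<close> cannot leave the window between them, so
  it is a rectangle; \<open>circ\<close> expresses its presence by the bars at \<open>a\<close>, \<open>a + M\<close> (the same letter \<open>i\<close>),
  \<open>a + M - 1\<close> (the letter \<open>i - 1\<close>) and \<open>Suc a\<close> (the letter \<open>i + 1\<close>).
\<close>

definition rect :: "nat \<Rightarrow> point set" where
  "rect a = {a..<a + M} \<times> {lt a, Suc (lt a)}"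

definition free :: "nat set \<Rightarrow> nat \<Rightarrow> bool" where
  "free w a \<longleftrightarrow> a \<in> w \<and> (2 \<le> lt a \<longrightarrow> a + M - 1 \<notin> w)"

definition circ :: "nat set \<Rightarrow> nat \<Rightarrow> bool" where
  "circ w a \<longleftrightarrow> free w a \<and> a + M \<in> w \<and> (lt a < M \<longrightarrow> Suc a \<notin> w)"

lemma wordD: "word w \<Longrightarrow> p \<in> w \<Longrightarrow> 1 \<le> p \<and> p \<le> N"
  by auto

lemma low_strand:
  assumes "free w a" "a \<ge> 1" "a < p" "p < a + M" "p \<in> w"
  shows "lt a \<noteq> lt p \<and> lt a \<noteq> Suc (lt p)"
  using letter_between[OF assms(2-4)] assms by (auto simp: free_def)

lemma high_strand:
  assumes "lt a < M \<Longrightarrow> Suc a \<notin> w" "a \<ge> 1" "a < p" "p < a + M" "p \<in> w"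
  shows "Suc (lt a) \<noteq> lt p \<and> Suc (lt a) \<noteq> Suc (lt p)"
  using letter_between[OF assms(2-4)] assms letter_le[of p] by (auto simp del: letter_le)

lemma low_strand_comp:
  assumes "free w a" "a \<ge> 1" "a + M \<le> Suc N" "a \<le> l" "l < a + M"
  shows "(l, lt a) \<in> comp w (a, lt a)"
  using assms by (intro comp_strand) (auto dest: low_strand)

lemma high_strand_comp:
  assumes "a \<ge> 1" "a + M \<le> Suc N" "Suc a \<le> l" "l < a + M"
  shows "(l, Suc (lt a)) \<in> comp w (Suc a, Suc (lt a))"
proof (intro comp_strand)
  \<comment> \<open>Deleting \<open>Suc a\<close> from the word gives an unblocked strand; the
    deleted bar lies before the stretch considered.\<close>
  fix p assume p: "Suc a < p" "p \<le> l" "p \<in> w"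
  then show "Suc (lt a) \<noteq> lt p \<and> Suc (lt a) \<noteq> Suc (lt p)"
    using high_strand[of a "w - {Suc a}" p] assms by auto
qed (use assms in auto)

lemma high_strand_comp':
  assumes "a \<ge> 1" "a + M \<le> Suc N" "a \<le> l" "l < a + M" "lt a < M \<Longrightarrow> Suc a \<notin> w"
  shows "(l, Suc (lt a)) \<in> comp w (a, Suc (lt a))"
proof (intro comp_strand)
  fix p assume p: "a < p" "p \<le> l" "p \<in> w"
  then show "Suc (lt a) \<noteq> lt p \<and> Suc (lt a) \<noteq> Suc (lt p)"
    using high_strand[of a w p] assms by auto
qed (use assms in auto)

lemma comp_left: "1 \<le> p \<Longrightarrow> p \<le> N \<Longrightarrow> p \<in> w \<Longrightarrow> (p - 1, Suc (lt p)) \<in> comp w (p - 1, lt p)"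
  by (rule comp_edge[OF G_left])

lemma comp_right: "1 \<le> p \<Longrightarrow> p \<le> N \<Longrightarrow> p \<in> w \<Longrightarrow> (p, Suc (lt p)) \<in> comp w (p, lt p)"
  by (rule comp_edge[OF G_right])

lemma rect_subset_comp:
  assumes "circ w a" "word w"
  shows "rect a \<subseteq> comp w (a, lt a)"
proof -
  have a: "1 \<le> a" "a + M \<le> N" "a \<in> w" "free w a" "lt a < M \<Longrightarrow> Suc a \<notin> w"
    using assms by (auto simp: circ_def free_def)
  have "(l, lt a) \<in> comp w (a, lt a) \<and> (l, Suc (lt a)) \<in> comp w (a, lt a)" if "a \<le> l" "l < a + M" for l
    using low_strand_comp[of w a l] high_strand_comp'[of a l w] comp_right[of a w] a that
    by (auto intro: comp_trans)
  then show ?thesis by (auto simp: rect_def)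
qed

text \<open>No segment joins the rectangle to its complement: on its two strands the bars at
  \<open>a\<close> and \<open>a + M\<close> turn back, and the bars strictly between them meet
  neither strand.\<close>

lemma comp_rect:
  assumes "circ w a" "word w"
  shows "comp w (a, lt a) = rect a"
proof
  have a: "1 \<le> a" "a + M \<le> N" "a \<in> w" "a + M \<in> w" "free w a" "lt a < M \<Longrightarrow> Suc a \<notin> w"
    using assms by (auto simp: circ_def free_def)
  show "comp w (a, lt a) \<subseteq> rect a"
  proof (rule comp_subset)
    show "(a, lt a) \<in> rect a" by (simp add: rect_def)
  next
    fix x y assume "(x, y) \<in> G w"
    then show "x \<in> rect a \<longleftrightarrow> y \<in> rect a"
    proof (cases rule: G_cases)
      case (straight p m)
      have "p \<noteq> a \<and> p \<noteq> a + M" if "m = lt a \<or> m = Suc (lt a)"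
        using straight a letter_period[of a] that by auto
      moreover have "a \<le> p - 1 \<and> p - 1 < a + M \<longleftrightarrow> a \<le> p \<and> p < a + M" if "p \<noteq> a \<and> p \<noteq> a + M"
        using that straight(1) a(1) by linarith
      ultimately show ?thesis using straight by (auto simp: rect_def)
    next
      case (left p)
      consider "p = a + M" | "a < p" "p < a + M" | "\<not> (a \<le> p - 1 \<and> p - 1 < a + M)"
        using left(1) a(1) by linarith
      then show ?thesis
      proof cases
        case 1
        then show ?thesis using left letter_period[of a] a M_ge_1
          by (simp add: rect_def Suc_le_eq del: M_ge_1)
      next
        case 2
        then show ?thesis
          using low_strand[OF a(5,1) 2 left(3)] high_strand[OF a(6,1) 2 left(3)] left
          by (auto simp: rect_def)
      qed (auto simp: left rect_def)
    next
      case (right p)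
      consider "p = a" | "a < p" "p < a + M" | "\<not> (a \<le> p \<and> p < a + M)"
        using a(1) by linarith
      then show ?thesis
      proof cases
        case 2
        then show ?thesis
          using low_strand[OF a(5,1) 2 right(3)] high_strand[OF a(6,1) 2 right(3)] right
          by (auto simp: rect_def)
      qed (auto simp: right rect_def)
    qed
  qed
qed (rule rect_subset_comp[OF assms])

lemma comp_rect_mem: "circ w a \<Longrightarrow> word w \<Longrightarrow> u \<in> rect a \<Longrightarrow> comp w u = rect a"
  using comp_rect comp_eqI by metis

lemma corner_in_rect [simp]: "(a, lt a) \<in> rect a" "(a, Suc (lt a)) \<in> rect a"
  by (auto simp: rect_def)

lemma corner_point: "a \<in> w \<Longrightarrow> word w \<Longrightarrow> (a, lt a) \<in> points n k"
  by (auto simp: points_def Suc_le_eq)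

lemma rect_closed:
  assumes "circ w a" "word w"
  shows "rect a \<in> closed w"
proof -
  have a: "1 \<le> a" "a + M \<le> N" "a \<in> w" using assms by (auto simp: circ_def free_def)
  have "comp w (a, lt a) \<in> closed w"
    using a assms by (subst closed_comp_iff) (auto simp: comp_rect corner_point rect_def)
  then show ?thesis using assms by (simp add: comp_rect)
qed

text \<open>Without a bar to the right the strand would run into the right boundary; the first such
  bar is where the circle turns back.\<close>

lemma closed_right:
  assumes D: "D \<in> closed w" and lm: "(l, m) \<in> D"
  obtains p where "l < p" "p \<le> N" "p \<in> w" "m = lt p \<or> m = Suc (lt p)" "(p - 1, m) \<in> D"
proof -
  from closed_mem[OF D lm] have D': "D = comp w (l, m)" and pt: "(l, m) \<in> points n k" by auto
  have lN: "l \<le> N" "1 \<le> m" "m \<le> n" using pt by (auto simp: points_def)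
  let ?P = "\<lambda>p. l < p \<and> p \<le> N \<and> p \<in> w \<and> (m = lt p \<or> m = Suc (lt p))"
  have "\<exists>p. ?P p"
  proof (rule ccontr)
    assume "\<not> ?thesis"
    then have "(N, m) \<in> D" unfolding D' using lN by (intro comp_strand) auto
    then show False using D pt unfolding D' by (auto simp: closed_comp_iff)
  qed
  define p where "p = (LEAST p. ?P p)"
  have p: "?P p" unfolding p_def using \<open>\<exists>p. ?P p\<close> by (rule LeastI_ex)
  have "\<not> ?P p'" if "p' < p" for p' using that not_less_Least unfolding p_def by blast
  then have min: "m \<noteq> lt p' \<and> m \<noteq> Suc (lt p')" if "l < p'" "p' < p" "p' \<in> w" for p'
    using that p by auto
  have "(p - 1, m) \<in> D" unfolding D'
  proof (intro comp_strand)
    fix p' assume "l < p'" "p' \<le> p - 1" "p' \<in> w"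
    then show "m \<noteq> lt p' \<and> m \<noteq> Suc (lt p')" using min[of p'] by auto
  qed (use p lN in auto)
  then show thesis using p that by auto
qed

lemma closed_left:
  assumes D: "D \<in> closed w" and lm: "(l, m) \<in> D"
  obtains p where "1 \<le> p" "p \<le> l" "p \<in> w" "m = lt p \<or> m = Suc (lt p)" "(p, m) \<in> D"
proof -
  from closed_mem[OF D lm] have D': "D = comp w (l, m)" and pt: "(l, m) \<in> points n k" by auto
  have lN: "l \<le> N" "1 \<le> m" "m \<le> n" using pt by (auto simp: points_def)
  let ?P = "\<lambda>p. 1 \<le> p \<and> p \<le> l \<and> p \<in> w \<and> (m = lt p \<or> m = Suc (lt p))"
  have b: "p \<le> l" if "?P p" for p using that by simp
  have "\<exists>p. ?P p"
  proof (rule ccontr)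
    assume "\<not> ?thesis"
    then have "(l, m) \<in> comp w (0, m)" using lN by (intro comp_strand) auto
    then have "(0, m) \<in> D" unfolding D' by (rule comp_sym)
    then show False using D pt unfolding D' by (auto simp: closed_comp_iff)
  qed
  define p where "p = (GREATEST p. ?P p)"
  have p: "?P p" unfolding p_def using \<open>\<exists>p. ?P p\<close> b by (rule GreatestI_ex_nat)
  have max: "p' \<le> p" if "?P p'" for p' unfolding p_def using that b by (rule Greatest_le_nat)
  have "(l, m) \<in> comp w (p, m)"
  proof (intro comp_strand)
    fix p' assume "p < p'" "p' \<le> l" "p' \<in> w"
    then show "m \<noteq> lt p' \<and> m \<noteq> Suc (lt p')" using max[of p'] by auto
  qed (use p lN in auto)
  then have "(p, m) \<in> D" unfolding D' by (rule comp_sym)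
  then show thesis using p that by auto
qed

lemma closed_cup:
  assumes D: "D \<in> closed w" and p: "1 \<le> p" "p \<le> N" "p \<in> w"
  shows "(p - 1, lt p) \<in> D \<longleftrightarrow> (p - 1, Suc (lt p)) \<in> D" "(p, lt p) \<in> D \<longleftrightarrow> (p, Suc (lt p)) \<in> D"
proof -
  obtain u where D': "D = comp w u" using D by (rule closedE)
  show "(p - 1, lt p) \<in> D \<longleftrightarrow> (p - 1, Suc (lt p)) \<in> D" "(p, lt p) \<in> D \<longleftrightarrow> (p, Suc (lt p)) \<in> D"
    unfolding D' using comp_closed_edge G_left[OF p] G_right[OF p] by blast+
qed

lemma circ_if_first_last:
  assumes D: "D \<in> closed w" and w: "word w"
    and first: "first_crossing n w D = j" and last: "last_crossing n w D = j + M"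
  shows "circ w j \<and> D = rect j"
proof -
  let ?B = "{p. borders n w p D}"
  have fin: "finite ?B" using w by (rule_tac finite_subset[of _ "{1..N}"]) (auto simp: borders_def)
  have bordR: "borders n w p D" if "p \<in> w" "(p - 1, m) \<in> D" "m = lt p \<or> m = Suc (lt p)" for p m
    using that closed_cup(1)[OF D, of p] w by (auto simp: borders_def)
  have bordL: "borders n w p D" if "p \<in> w" "(p, m) \<in> D" "m = lt p \<or> m = Suc (lt p)" for p m
    using that closed_cup(2)[OF D, of p] w by (auto simp: borders_def)
  obtain l m where lm: "(l, m) \<in> D" using closed_nonempty[OF D] by auto
  obtain p0 where "p0 \<in> w" "m = lt p0 \<or> m = Suc (lt p0)" "(p0 - 1, m) \<in> D"
    by (rule closed_right[OF D lm])
  then have "p0 \<in> ?B" using bordR by auto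
  then have "?B \<noteq> {}" by auto
  then have jB: "j \<in> ?B" "j + M \<in> ?B" and lower: "\<And>p. borders n w p D \<Longrightarrow> j \<le> p"
    and upper: "\<And>p. borders n w p D \<Longrightarrow> p \<le> j + M"
    using Min_in[OF fin] Max_in[OF fin] Min_le[OF fin] Max_ge[OF fin] first last
    by (auto simp: first_crossing_def last_crossing_def)
  have jw: "j \<in> w" "j + M \<in> w" using jB by (auto simp: borders_def)
  have j1: "1 \<le> j" "j \<le> N" "j + M \<le> N" using jw w by auto
  have notleft: "(l, m) \<notin> D" if "l < j" for l m
  proof
    assume lm: "(l, m) \<in> D"
    obtain p where "1 \<le> p" "p \<le> l" "p \<in> w" "m = lt p \<or> m = Suc (lt p)" "(p, m) \<in> D"
      by (rule closed_left[OF D lm])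
    then have "j \<le> p" using bordL lower by blast
    then show False using \<open>p \<le> l\<close> that by simp
  qed
  have notright: "(l, m) \<notin> D" if "j + M \<le> l" for l m
  proof
    assume lm: "(l, m) \<in> D"
    obtain p where "l < p" "p \<in> w" "m = lt p \<or> m = Suc (lt p)" "(p - 1, m) \<in> D"
      by (rule closed_right[OF D lm])
    then have "p \<le> j + M" using bordR upper by blast
    then show False using \<open>l < p\<close> that by simp
  qed
  have jl: "(j, lt j) \<in> D" "(j, Suc (lt j)) \<in> D"
    using jB(1) notleft[of "j - 1"] closed_cup(2)[OF D, of j] j1 jw by (auto simp: borders_def)
  have jr: "(j + M - 1, lt j) \<in> D" "(j + M - 1, Suc (lt j)) \<in> D"
    using jB(2) notright[of "j + M"] closed_cup(1)[OF D, of "j + M"] j1 jw letter_period[of j]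
    by (auto simp: borders_def)
  \<comment> \<open>Otherwise the circle reaches the strand \<open>lt j + 2\<close> at level
    \<open>j\<close>. Followed to the left it turns back at a bar, which can only be the first
    crossing \<open>j\<close>, but \<open>j\<close> does not meet that strand. The argument for
    \<open>x\<close> is the mirror image.\<close>
  have z: "Suc j \<notin> w" if "lt j < M"
  proof
    assume zw: "Suc j \<in> w"
    have lz: "lt (Suc j) = Suc (lt j)" using letter_Suc[of j] that j1 by simp
    have mem: "(j, Suc (Suc (lt j))) \<in> D"
      using closed_cup(1)[OF D, of "Suc j"] zw jl w lz by auto
    obtain p where p: "1 \<le> p" "p \<le> j" "p \<in> w"
        "Suc (Suc (lt j)) = lt p \<or> Suc (Suc (lt j)) = Suc (lt p)" "(p, Suc (Suc (lt j))) \<in> D"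
      by (rule closed_left[OF D mem])
    then have "p = j" using bordL[OF p(3,5,4)] lower[of p] by simp
    then show False using p by simp
  qed
  have x: "j + M - 1 \<notin> w" if "2 \<le> lt j"
  proof
    assume xw: "j + M - 1 \<in> w"
    have lx: "Suc (lt (j + M - 1)) = lt j" using letter_before[of j] that j1 by simp
    have mem: "(j + M - 1, lt (j + M - 1)) \<in> D"
      using closed_cup(2)[OF D, of "j + M - 1"] xw jr w lx by auto
    obtain p where p: "j + M - 1 < p" "p \<in> w"
        "lt (j + M - 1) = lt p \<or> lt (j + M - 1) = Suc (lt p)" "(p - 1, lt (j + M - 1)) \<in> D"
      by (rule closed_right[OF D mem])
    then have "p = j + M" using bordR[OF p(2,4,3)] upper[of p] by simp
    then show False using p lx letter_period[of j] j1 by auto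
  qed
  have c: "circ w j" using jw z x by (auto simp: circ_def free_def)
  then show ?thesis using closed_mem[OF D jl(1)] comp_rect[OF c w] by simp
qed

lemma first_last_rect:
  assumes "circ w a" "word w"
  shows "first_crossing n w (rect a) = a" "last_crossing n w (rect a) = a + M"
proof -
  have a: "1 \<le> a" "a + M \<le> N" "a \<in> w" "a + M \<in> w" "free w a" "lt a < M \<Longrightarrow> Suc a \<notin> w"
    using assms by (auto simp: circ_def free_def)
  have "borders n w p (rect a) \<longleftrightarrow> p = a \<or> p = a + M" for p
  proof
    assume b: "borders n w p (rect a)"
    then have p: "p \<in> w" "a \<le> p" "p \<le> a + M" "lt p = lt a \<or> lt p = Suc (lt a)"
      by (auto simp: borders_def rect_def)
    then show "p = a \<or> p = a + M"
      using low_strand[of w a p] high_strand[of a w p] a by (cases "a < p \<and> p < a + M") auto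
  next
    assume "p = a \<or> p = a + M"
    then show "borders n w p (rect a)"
      using a letter_period[of a] M_pos(1) by (elim disjE) (auto simp: borders_def rect_def Suc_le_eq simp del: M_pos)
  qed
  then have "{p. borders n w p (rect a)} = {a, a + M}" by auto
  then show "first_crossing n w (rect a) = a" "last_crossing n w (rect a) = a + M"
    by (auto simp: first_crossing_def last_crossing_def)
qed

lemma touches_iff:
  "touches n p C \<longleftrightarrow> (p - 1, lt p) \<in> C \<or> (p - 1, Suc (lt p)) \<in> C \<or> (p, lt p) \<in> C \<or> (p, Suc (lt p)) \<in> C"
  by (auto simp: touches_def Let_def)

lemma touches_rect:
  assumes "touches n p (rect a)" "1 \<le> a" "1 \<le> p"
  shows "p = a \<or> p = a + M \<or> (lt a < M \<and> p = Suc a) \<or> (2 \<le> lt a \<and> p = a + M - 1)"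
proof -
  have "a \<le> p" "p \<le> a + M" "lt p = lt a \<or> lt p = Suc (lt a) \<or> Suc (lt p) = lt a"
    using assms by (auto simp: touches_iff rect_def)
  moreover have "2 \<le> lt a" if "Suc (lt p) = lt a" using letter_pos[of p] that by linarith
  moreover have "lt a < M" if "lt p = Suc (lt a)" using letter_le[of p] that by linarith
  ultimately show ?thesis using letter_between[of a p] assms by (cases "a < p \<and> p < a + M") auto
qed

lemma corner_in_rect_iff:
  assumes "circ w a" "word w" "(b, lt b) \<in> rect a" "b \<in> w"
  shows "b = a"
proof (rule ccontr)
  assume "b \<noteq> a"
  have a: "1 \<le> a" "free w a" "lt a < M \<Longrightarrow> Suc a \<notin> w"
    using assms by (auto simp: circ_def free_def)
  have "a < b" "b < a + M" "lt b = lt a \<or> lt b = Suc (lt a)"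
    using \<open>b \<noteq> a\<close> assms(3) by (auto simp: rect_def)
  then show False using low_strand[of w a b] high_strand[of a w b] a assms(4) by auto
qed

section \<open>Toggling a crossing that borders a rectangular circle\<close>

lemma comp_insert_untouched:
  assumes "p \<notin> w" "\<not> touches n p (comp w u)"
  shows "comp (insert p w) u = comp w u"
proof -
  have 1: "comp (insert p w) u \<subseteq> comp w u"
  proof (rule comp_subset)
    fix x y assume "(x, y) \<in> G (insert p w)"
    then show "x \<in> comp w u \<longleftrightarrow> y \<in> comp w u"
    proof (cases rule: G_cases)
      case (straight p' m)
      then have "((p' - 1, m), (p', m)) \<in> G w" using G_straight[of "p' - 1" m w] by auto
      then show ?thesis using comp_closed_edge straight by blast
    next
      case (left p')
      then have "p' = p \<or> p' \<in> w" by auto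
      then show ?thesis
        using assms(2) left comp_closed_edge[OF G_left[of p' w], of u] by (auto simp: touches_iff)
    next
      case (right p')
      then have "p' = p \<or> p' \<in> w" by auto
      then show ?thesis
        using assms(2) right comp_closed_edge[OF G_right[of p' w], of u] by (auto simp: touches_iff)
    qed
  qed simp
  have "comp w u \<subseteq> comp (insert p w) u"
  proof (rule comp_subset)
    fix x y assume "(x, y) \<in> G w"
    then show "x \<in> comp (insert p w) u \<longleftrightarrow> y \<in> comp (insert p w) u"
    proof (cases rule: G_cases)
      case (straight p' m)
      show ?thesis
      proof (cases "p' = p \<and> (m = lt p \<or> m = Suc (lt p))")
        case True
        then show ?thesis using assms(2) 1 straight by (auto simp: touches_iff)
      next
        case False
        have "((p' - 1, m), (Suc (p' - 1), m)) \<in> G (insert p w)"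
          by (rule G_straight) (use straight False in auto)
        then have "((p' - 1, m), (p', m)) \<in> G (insert p w)" using straight by simp
        then show ?thesis using comp_closed_edge straight by blast
      qed
    next
      case (left p')
      then show ?thesis using comp_closed_edge[OF G_left[of p' "insert p w"], of u] by auto
    next
      case (right p')
      then show ?thesis using comp_closed_edge[OF G_right[of p' "insert p w"], of u] by auto
    qed
  qed simp
  then show ?thesis using 1 by auto
qed

lemma window_arith [simp]:
  "a \<le> a + M - Suc 0" "a + M - Suc 0 < a + M" "Suc (a + M - Suc 0) = a + M"
  using M_pos(1) by linarith+

lemma circD:
  assumes "circ w a" "word w"
  shows "1 \<le> a" "a \<le> N" "a + M \<le> N" "a \<in> w" "a + M \<in> w" "free w a" "lt a < M \<Longrightarrow> Suc a \<notin> w"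
    "2 \<le> lt a \<Longrightarrow> a + M - 1 \<notin> w"
  using assms wordD[of w a] wordD[of w "a + M"] unfolding circ_def free_def by blast+

lemma two_above_letter [simp]: "lt a < M \<Longrightarrow> Suc (Suc (lt a)) \<le> n"
  by (simp add: n_eq)

text \<open>
  Both G1 and G2 pairs consist of a fine word \<open>w\<close> with a rectangular circle and a coarse word \<open>w'\<close> in
  which this circle is joined to the component through \<open>u\<^sub>0\<close>; all other components agree. For G1 the
  source is the coarse word, for G2 it is the fine one.
\<close>

definition clasp :: "nat set \<Rightarrow> nat \<Rightarrow> nat set \<Rightarrow> point \<Rightarrow> bool" where
  "clasp w a w' u\<^sub>0 \<longleftrightarrow> circ w a \<and> word w \<and> word w' \<and>
     (w' = w - {a + M} \<and> u\<^sub>0 = (a + M, lt a) \<or>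
      lt a < M \<and> w' = insert (Suc a) w \<and> u\<^sub>0 = (Suc a, Suc (Suc (lt a))))"

text \<open>If \<open>a + M\<close> is removed, the lower strand passes it straight to
  \<open>u\<^sub>0\<close>. If \<open>Suc a\<close> is added, the way leads along the lower strand
  to the bar at \<open>a + M\<close>, back along the upper strand to \<open>Suc a\<close>, and there
  over the right arc of the new bar.\<close>

lemma clasp_link:
  assumes "clasp w a w' u\<^sub>0"
  shows "rect a \<subseteq> comp w' (a, lt a)" "u\<^sub>0 \<in> comp w' (a, lt a)"
proof -
  let ?l = "lt a"
  have a: "1 \<le> a" "a \<le> N" "a + M \<le> N" "a \<in> w" "a + M \<in> w" "free w a" "?l < M \<Longrightarrow> Suc a \<notin> w"
    and w: "word w" "word w'"
    using assms circD[of w a] unfolding clasp_def by blast+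
  have "rect a \<subseteq> comp w' (a, ?l) \<and> u\<^sub>0 \<in> comp w' (a, ?l)"
    using assms unfolding clasp_def
  proof (elim conjE disjE)
    assume w': "w' = w - {a + M}" and u0: "u\<^sub>0 = (a + M, ?l)"
    have f: "free w' a" using a(6) w' M_pos(1) by (auto simp: free_def)
    have aw: "a \<in> w'" "?l < M \<Longrightarrow> Suc a \<notin> w'" using a w' by auto
    have 1: "(l, ?l) \<in> comp w' (a, ?l)" "(l, Suc ?l) \<in> comp w' (a, ?l)" if "a \<le> l" "l < a + M" for l
    proof -
      show "(l, ?l) \<in> comp w' (a, ?l)"
        using low_strand_comp[OF f, of l] a that by simp
      show "(l, Suc ?l) \<in> comp w' (a, ?l)"
        by (rule comp_trans[OF comp_right high_strand_comp']) (use a aw that in auto)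
    qed
    have "((a + M - 1, ?l), (Suc (a + M - 1), ?l)) \<in> G w'"
      by (rule G_straight) (use a w' M_pos(1) in auto)
    then have "(a + M, ?l) \<in> comp w' (a + M - 1, ?l)" using M_pos(1) a by (auto dest: comp_edge)
    moreover have "(a + M - 1, ?l) \<in> comp w' (a, ?l)" using 1(1)[of "a + M - 1"] by simp
    ultimately have "(a + M, ?l) \<in> comp w' (a, ?l)" by (rule comp_trans[rotated])
    then show ?thesis using 1 u0 by (auto simp: rect_def)
  next
    assume lM: "?l < M" and w': "w' = insert (Suc a) w" and u0: "u\<^sub>0 = (Suc a, Suc (Suc ?l))"
    have M2: "2 \<le> M" using lM letter_pos[of a] by linarith
    have "a + M - 1 \<noteq> Suc a" if "2 \<le> ?l" using that lM by linarith
    then have f: "free w' a" using a(6) unfolding w' free_def by blast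
    have lz: "lt (Suc a) = Suc ?l" using letter_Suc[of a] a lM by simp
    have 1: "(l, ?l) \<in> comp w' (a, ?l)" if "a \<le> l" "l < a + M" for l
      using low_strand_comp[OF f, of l] a that by auto
    have 2: "(l, Suc ?l) \<in> comp w' (Suc a, Suc ?l)" if "Suc a \<le> l" "l < a + M" for l
      using high_strand_comp[of a l w'] a that by auto
    define y where "y = a + M - 1"
    have y: "a \<le> y" "Suc a \<le> y" "y < a + M" "y = a + M - 1" using M2 by (auto simp: y_def)
    have "(a + M - 1, Suc (lt (a + M))) \<in> comp w' (a + M - 1, lt (a + M))"
      by (rule comp_left) (use a w' in auto)
    then have "(y, Suc ?l) \<in> comp w' (y, ?l)"
      unfolding y_def[symmetric] using letter_period[of a] a by simp
    then have "(y, Suc ?l) \<in> comp w' (a, ?l)" by (rule comp_trans[OF 1[OF y(1,3)]])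
    then have 3: "(Suc a, Suc ?l) \<in> comp w' (a, ?l)"
      by (rule comp_trans[OF _ comp_sym[OF 2[OF y(2,3)]]])
    have 4: "(a, Suc ?l) \<in> comp w' (a, ?l)" using comp_right[of a w'] a w' by auto
    have "(l, Suc ?l) \<in> comp w' (a, ?l)" if "a \<le> l" "l < a + M" for l
    proof (cases "l = a")
      case False
      then show ?thesis using that by (intro comp_trans[OF 3 2]) auto
    qed (use 4 in simp)
    moreover have "u\<^sub>0 \<in> comp w' (a, ?l)"
    proof (rule comp_trans[OF 3])
      show "u\<^sub>0 \<in> comp w' (Suc a, Suc ?l)"
        using comp_right[of "Suc a" w'] w' w u0 lz by auto
    qed
    ultimately show ?thesis using 1 by (auto simp: rect_def)
  qed
  then show "rect a \<subseteq> comp w' (a, lt a)" "u\<^sub>0 \<in> comp w' (a, lt a)" by auto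
qed

lemma clasp_base:
  assumes "clasp w a w' u\<^sub>0"
  shows "u\<^sub>0 \<notin> rect a" "u\<^sub>0 \<in> points n k" "1 \<le> a" "a + M \<le> N"
proof -
  have c: "circ w a" "word w" using assms by (auto simp: clasp_def)
  note a = circD[OF c]
  show "1 \<le> a" "a + M \<le> N" by (fact a(1), fact a(3))
  have "u\<^sub>0 = (a + M, lt a) \<or> lt a < M \<and> u\<^sub>0 = (Suc a, Suc (Suc (lt a)))"
    using assms unfolding clasp_def by blast
  then show "u\<^sub>0 \<notin> rect a" "u\<^sub>0 \<in> points n k"
    using a(1,3) M_pos(1) two_above_letter[of a]
    by (auto simp: rect_def points_def simp del: M_pos two_above_letter)
qed

lemma clasp_edge:
  assumes "clasp w a w' u\<^sub>0" "(x, y) \<in> G w"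
  shows "y \<in> comp w' x"
proof -
  let ?l = "lt a"
  have w: "word w" "word w'" and a1: "1 \<le> a" "a + M \<le> N" "a + M \<in> w"
    using assms circD[of w a] unfolding clasp_def by blast+
  have rr: "v \<in> comp w' u" if "u \<in> rect a" "v \<in> rect a" for u v
    using comp_eqI[OF subsetD[OF clasp_link(1)[OF assms(1)] that(1)]]
      subsetD[OF clasp_link(1)[OF assms(1)] that(2)] by simp
  have c: "w' = w - {a + M} \<or> ?l < M \<and> w' = insert (Suc a) w \<and> Suc a \<notin> w"
    using assms by (auto simp: clasp_def circ_def)
  from assms(2) show ?thesis
  proof (cases rule: G_cases)
    case (straight p m)
    show ?thesis
    proof (cases "p \<in> w' \<and> (m = lt p \<or> m = Suc (lt p))")
      case False
      have "((p - 1, m), (Suc (p - 1), m)) \<in> G w'" by (rule G_straight) (use straight False in auto)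
      then show ?thesis using straight by (auto dest: comp_edge)
    next
      case True
      \<comment> \<open>The new bar interrupts this strand; its two ends stay connected by going
        round the rectangle.\<close>
      then have p: "p = Suc a" "?l < M" "w' = insert (Suc a) w" using c straight by auto
      then have lz: "lt p = Suc ?l" using letter_Suc[of a] a1 by simp
      have "(a, Suc ?l) \<in> rect a" "(Suc a, Suc ?l) \<in> rect a"
        using p letter_pos[of a] by (auto simp: rect_def simp del: letter_pos)
      then have r: "(Suc a, Suc ?l) \<in> comp w' (a, Suc ?l)" by (rule rr)
      have "(a, Suc (Suc ?l)) \<in> comp w' (a, Suc ?l)" "(Suc a, Suc (Suc ?l)) \<in> comp w' (Suc a, Suc ?l)"
        using comp_left[of p w'] comp_right[of p w'] straight p lz by auto
      then have "(Suc a, Suc (Suc ?l)) \<in> comp w' (a, Suc (Suc ?l))"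
        using r by (simp flip: comp_eq_iff)
      then show ?thesis using True r straight lz p by auto
    qed
  next
    case (left p)
    show ?thesis
    proof (cases "p \<in> w'")
      case True
      then show ?thesis using comp_left[of p w'] left by auto
    next
      case False
      then have "p = a + M" using c left by auto
      then show ?thesis using left letter_period[of a] a1 M_pos(1) rr
        by (auto simp: rect_def simp del: M_pos)
    qed
  next
    case (right p)
    show ?thesis
    proof (cases "p \<in> w'")
      case True
      then show ?thesis using comp_right[of p w'] right by auto
    next
      case False
      then have p: "p = a + M" "lt p = ?l" using c right letter_period[of a] a1 by auto
      have e: "(a + M, m) \<in> comp w' (a + M - 1, m)" if "m = ?l \<or> m = Suc ?l" for m
      proof -
        have "((a + M - 1, m), (Suc (a + M - 1), m)) \<in> G w'"
          by (rule G_straight) (use a1 False p that in auto)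
        then show ?thesis using a1 by (auto dest: comp_edge)
      qed
      have "(a + M - 1, ?l) \<in> rect a" "(a + M - 1, Suc ?l) \<in> rect a"
        using a1 M_pos(1) by (auto simp: rect_def simp del: M_pos)
      then have r: "(a + M - 1, Suc ?l) \<in> comp w' (a + M - 1, ?l)" by (rule rr)
      have "(a + M, Suc ?l) \<in> comp w' (a + M, ?l)"
        using e[of ?l] e[of "Suc ?l"] r by (simp flip: comp_eq_iff)
      then show ?thesis using right p by simp
    qed
  qed
qed

lemma clasp_edge':
  assumes "clasp w a w' u\<^sub>0" "(x, y) \<in> G w'"
  shows "(x, y) \<in> G w \<or> x \<in> rect a \<union> comp w u\<^sub>0 \<and> y \<in> rect a \<union> comp w u\<^sub>0"
proof -
  let ?l = "lt a"
  have w: "word w" "word w'" and a1: "1 \<le> a" "a + M \<le> N" "a + M \<in> w"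
    using assms circD[of w a] unfolding clasp_def by blast+
  have c: "w' = w - {a + M} \<and> u\<^sub>0 = (a + M, ?l) \<or>
      ?l < M \<and> w' = insert (Suc a) w \<and> Suc a \<notin> w \<and> u\<^sub>0 = (Suc a, Suc (Suc ?l))"
    using assms by (auto simp: clasp_def circ_def)
  from assms(2) show ?thesis
  proof (cases rule: G_cases)
    case (straight p m)
    show ?thesis
    proof (cases "p \<in> w \<and> (m = lt p \<or> m = Suc (lt p))")
      case False
      have "((p - 1, m), (Suc (p - 1), m)) \<in> G w" by (rule G_straight) (use straight False in auto)
      then show ?thesis using straight by auto
    next
      case True
      then have p: "p = a + M" "u\<^sub>0 = (a + M, ?l)" "lt p = ?l"
        using c straight letter_period[of a] a1 by auto
      have "(a + M - 1, m) \<in> rect a" using True p a1 M_pos(1) by (auto simp: rect_def simp del: M_pos)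
      moreover have "(a + M, m) \<in> comp w u\<^sub>0"
        using comp_right[of "a + M" w] a1 p True by auto
      ultimately show ?thesis using straight p by auto
    qed
  next
    case (left p)
    show ?thesis
    proof (cases "p \<in> w")
      case True
      then show ?thesis using G_left left by auto
    next
      case False
      then have p: "p = Suc a" "u\<^sub>0 = (Suc a, Suc (Suc ?l))" "?l < M" "Suc a \<notin> w" using c left by auto
      then have lz: "lt p = Suc ?l" using letter_Suc[of a] a1 by simp
      have "((a, Suc (Suc ?l)), (Suc a, Suc (Suc ?l))) \<in> G w"
        by (rule G_straight) (use p left lz in auto)
      then have "(a, Suc (Suc ?l)) \<in> comp w u\<^sub>0" using p comp_edge' by auto
      then show ?thesis using left p lz by auto
    qed
  next
    case (right p)
    show ?thesis
    proof (cases "p \<in> w")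
      case True
      then show ?thesis using G_right right by auto
    next
      case False
      then have p: "p = Suc a" "u\<^sub>0 = (Suc a, Suc (Suc ?l))" "?l < M" "Suc a \<notin> w" using c right by auto
      then have lz: "lt p = Suc ?l" using letter_Suc[of a] a1 by simp
      have "(Suc a, Suc ?l) \<in> rect a"
        using p letter_pos[of a] by (auto simp: rect_def simp del: letter_pos)
      then show ?thesis using right p lz by auto
    qed
  qed
qed

text \<open>Every segment of the fine word remains a path in the coarse one, and the segments that
  are new in the coarse word stay inside the union of the rectangle and the component of
  \<open>u\<^sub>0\<close>.\<close>

lemma comp_clasp:
  assumes "clasp w a w' u\<^sub>0"
  shows "u \<in> rect a \<union> comp w u\<^sub>0 \<Longrightarrow> comp w' u = rect a \<union> comp w u\<^sub>0"
    and "u \<notin> rect a \<union> comp w u\<^sub>0 \<Longrightarrow> comp w' u = comp w u"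
proof -
  let ?X = "rect a \<union> comp w u\<^sub>0"
  have cw: "circ w a" "word w" using assms by (auto simp: clasp_def)
  have sub: "comp w v \<subseteq> comp w' v" for v
    by (rule comp_mono) (rule clasp_edge[OF assms])
  have Xclosed: "x \<in> ?X \<longleftrightarrow> y \<in> ?X" if "(x, y) \<in> G w" for x y
    using comp_closed_edge[OF that] comp_rect[OF cw] by (metis Un_iff)
  have "rect a \<subseteq> comp w' (a, lt a)" "comp w u\<^sub>0 \<subseteq> comp w' (a, lt a)"
    using clasp_link[OF assms] sub[of u\<^sub>0] comp_eqI by auto
  then have "?X \<subseteq> comp w' (a, lt a)" by blast
  moreover have X2: "comp w' (a, lt a) \<subseteq> ?X"
  proof (rule comp_subset)
    fix x y assume "(x, y) \<in> G w'"
    then show "x \<in> ?X \<longleftrightarrow> y \<in> ?X" using clasp_edge'[OF assms, of x y] Xclosed[of x y] by blast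
  qed simp
  ultimately have X: "comp w' (a, lt a) = ?X" by (rule subset_antisym[rotated])
  show "comp w' u = ?X" if "u \<in> ?X" using that X comp_eqI by metis
  show "comp w' u = comp w u" if "u \<notin> ?X"
  proof
    have "comp w u \<inter> ?X = {}"
    proof (rule ccontr)
      assume "comp w u \<inter> ?X \<noteq> {}"
      then obtain v where "v \<in> comp w u" "v \<in> ?X" by auto
      then have "u \<in> rect a \<union> comp w u\<^sub>0"
        using comp_sym[of v w u] comp_rect_mem[OF cw, of v] comp_trans by blast
      then show False using that by simp
    qed
    then have d: "v \<notin> comp w u" if "v \<in> ?X" for v using that by blast
    show "comp w' u \<subseteq> comp w u"
    proof (rule comp_subset)
      fix x y assume "(x, y) \<in> G w'"
      then show "x \<in> comp w u \<longleftrightarrow> y \<in> comp w u"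
        using clasp_edge'[OF assms, of x y] comp_closed_edge[of x y w u] d by blast
    qed simp
  qed (rule sub)
qed

section \<open>Markings\<close>

definition mk :: "enhanced_state \<Rightarrow> point \<Rightarrow> mark option" where
  "mk S u = snd S (comp (fst S) u)"

text \<open>Comparing marks at points off the rectangle needs no bijection between the components of
  two resolutions, and it also compares arcs, whose mark is \<open>None\<close>.\<close>

definition agree_off :: "nat \<Rightarrow> enhanced_state \<Rightarrow> enhanced_state \<Rightarrow> bool" where
  "agree_off a S T \<longleftrightarrow> (\<forall>u \<in> points n k. u \<notin> rect a \<longrightarrow> mk S u = mk T u)"

lemma ES_iff: "S \<in> ES \<longleftrightarrow> word (fst S) \<and> dom (snd S) = closed (fst S)"
  by (cases S) (simp add: enhanced_states_def kauffman_states_def)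

lemma mk_None: "S \<in> ES \<Longrightarrow> u \<in> points n k \<Longrightarrow> mk S u = None \<longleftrightarrow> comp (fst S) u \<notin> closed (fst S)"
  by (auto simp: ES_iff mk_def)

lemma clasp_closed:
  assumes c: "clasp w a w' u\<^sub>0" and u: "u \<in> points n k" "u \<notin> rect a"
  shows "comp w' u \<in> closed w' \<longleftrightarrow> comp w u \<in> closed w"
proof (cases "u \<in> comp w u\<^sub>0")
  case True
  then have "comp w u = comp w u\<^sub>0" "comp w' u = rect a \<union> comp w u\<^sub>0"
    using comp_eqI comp_clasp(1)[OF c] by auto
  moreover have "\<forall>(l, m) \<in> rect a. l \<noteq> 0 \<and> l \<noteq> N"
    using clasp_base(3,4)[OF c] by (auto simp: rect_def)
  ultimately show ?thesis using closed_comp_iff[OF u(1), of w] closed_comp_iff[OF u(1), of w']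
    by (simp add: ball_Un)
next
  case False
  then have "comp w' u = comp w u" using u by (intro comp_clasp(2)[OF c]) auto
  then show ?thesis using closed_comp_iff[OF u(1), of w] closed_comp_iff[OF u(1), of w'] by simp
qed

text \<open>Absorbing a circle into one component identifies no two other components, so marks can
  be transported between the two words through any point off the rectangle.\<close>

lemma clasp_comp_eq:
  assumes c: "clasp w a w' u\<^sub>0" and "u \<notin> rect a" "v \<notin> rect a"
  shows "comp w' u = comp w' v \<longleftrightarrow> comp w u = comp w v"
proof (cases "u \<in> comp w u\<^sub>0 \<or> v \<in> comp w u\<^sub>0")
  case True
  then show ?thesis
    using assms comp_clasp[OF c, of u] comp_clasp[OF c, of v]
    by (metis Un_iff comp_eq_iff comp_refl comp_eqI)
next
  case False
  then show ?thesis using assms comp_clasp(2)[OF c, of u] comp_clasp(2)[OF c, of v] by auto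
qed

lemma agree_apart_iff:
  assumes c: "clasp (fst F) a (fst C) u\<^sub>0" and FC: "F \<in> ES" "C \<in> ES"
  shows "agree_apart_from n k (rect a) F C \<longleftrightarrow> agree_off a F C"
    and "agree_apart_from n k (rect a) C F \<longleftrightarrow> agree_off a F C"
proof -
  have cw: "circ (fst F) a" "word (fst F)" using c by (auto simp: clasp_def)
  show 1: "agree_apart_from n k (rect a) F C \<longleftrightarrow> agree_off a F C"
  proof
    assume ag: "agree_apart_from n k (rect a) F C"
    show "agree_off a F C" unfolding agree_off_def
    proof (intro ballI impI)
      fix u assume u: "u \<in> points n k" "u \<notin> rect a"
      show "mk F u = mk C u"
      proof (cases "comp (fst F) u \<in> closed (fst F)")
        case True
        then have "comp (fst C) u \<in> closed (fst C)" using clasp_closed[OF c u] by simp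
        moreover have "comp (fst F) u \<noteq> rect a" using u comp_refl by metis
        moreover have "comp (fst C) u \<noteq> rect a" using u comp_refl by metis
        ultimately show ?thesis
          using ag True comp_refl unfolding agree_apart_from_def mk_def by blast
      next
        case False
        then show ?thesis using clasp_closed[OF c u] mk_None[OF FC(1) u(1)] mk_None[OF FC(2) u(1)]
          by simp
      qed
    qed
  next
    assume ag: "agree_off a F C"
    show "agree_apart_from n k (rect a) F C"
      unfolding agree_apart_from_def
    proof (intro ballI impI)
      fix D E assume D: "D \<in> closed (fst F) - {rect a}" and E: "E \<in> closed (fst C) - {rect a}"
        and "D \<inter> E \<noteq> {}"
      then obtain u where u: "u \<in> D" "u \<in> E" by auto
      have "D = comp (fst F) u" "E = comp (fst C) u" "u \<in> points n k"
        using D E closed_mem[of D "fst F" u] closed_mem[of E "fst C" u] u by auto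
      moreover from this have "u \<notin> rect a" using comp_rect_mem[OF cw, of u] D by blast
      ultimately show "snd F D = snd C E" using ag by (auto simp: agree_off_def mk_def)
    qed
  qed
  have "agree_apart_from n k (rect a) C F \<longleftrightarrow> agree_apart_from n k (rect a) F C"
    unfolding agree_apart_from_def by (metis Int_commute)
  then show "agree_apart_from n k (rect a) C F \<longleftrightarrow> agree_off a F C" using 1 by simp
qed

lemma fine_exists:
  assumes c: "clasp w a (fst C) u\<^sub>0" and C: "C \<in> ES"
  obtains \<epsilon> where "(w, \<epsilon>) \<in> ES" "\<epsilon> (rect a) = Some x" "agree_off a (w, \<epsilon>) C"
proof -
  have cw: "circ w a" "word w" using c by (auto simp: clasp_def)
  \<comment> \<open>The mark \<open>x\<close> of the rectangle is free; any other circle takes its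
    mark from an arbitrary one of its points, and \<open>clasp_comp_eq\<close> makes this choice
    harmless.\<close>
  define \<epsilon> where "\<epsilon> D = (if D \<in> closed w then
      if D = rect a then Some x else mk C (SOME u. u \<in> D) else None)" for D
  have pick: "(SOME u. u \<in> D) \<in> D" if "D \<in> closed w" for D
    using closed_nonempty[OF that] by (simp add: some_in_eq)
  have nr: "u \<notin> rect a" if "D \<in> closed w" "D \<noteq> rect a" "u \<in> D" for u D
    using that closed_mem comp_rect_mem[OF cw] by metis
  have m: "mk (w, \<epsilon>) u = mk C u" if u: "u \<in> points n k" "u \<notin> rect a" for u
  proof (cases "comp w u \<in> closed w")
    case True
    let ?v = "SOME v. v \<in> comp w u"
    have v: "?v \<in> comp w u" using pick[OF True] .
    have ne: "comp w u \<noteq> rect a" using u comp_refl by metis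
    have "comp (fst C) ?v = comp (fst C) u"
      using clasp_comp_eq[OF c nr[OF True ne v] u(2)] comp_eqI[OF v] by simp
    then show ?thesis using True ne by (simp add: mk_def \<epsilon>_def)
  next
    case False
    then show ?thesis using clasp_closed[OF c u] mk_None[OF C u(1)] by (simp add: mk_def \<epsilon>_def)
  qed
  have "dom \<epsilon> = closed w"
  proof (intro set_eqI iffI)
    fix D assume D: "D \<in> closed w"
    show "D \<in> dom \<epsilon>"
    proof (cases "D = rect a")
      case False
      let ?v = "SOME v. v \<in> D"
      have v: "?v \<in> D" using pick[OF D] .
      have "mk C ?v \<noteq> None"
        using mk_None[OF C] clasp_closed[OF c _ nr[OF D False v]] closed_mem[OF D v] D by auto
      then show ?thesis using D False by (auto simp: \<epsilon>_def)
    qed (use D in \<open>auto simp: \<epsilon>_def\<close>)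
  qed (auto simp: \<epsilon>_def split: if_splits)
  then have "(w, \<epsilon>) \<in> ES" using cw by (simp add: ES_iff)
  moreover have "\<epsilon> (rect a) = Some x" using rect_closed[OF cw] by (simp add: \<epsilon>_def)
  moreover have "agree_off a (w, \<epsilon>) C" using m by (simp add: agree_off_def)
  ultimately show thesis by (rule that)
qed

lemma clasp_off_rect:
  assumes c: "clasp w a w' u\<^sub>0" and D: "D \<in> closed w'"
  obtains u where "u \<in> D" "u \<notin> rect a"
proof -
  obtain v where v: "v \<in> D" using closed_nonempty[OF D] by auto
  show thesis
  proof (cases "v \<in> rect a")
    case True
    then have "D = rect a \<union> comp w u\<^sub>0" using closed_mem[OF D v] comp_clasp(1)[OF c, of v] by auto
    then show thesis using that[of u\<^sub>0] clasp_base(1)[OF c] by auto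
  qed (use v that in auto)
qed

lemma coarse_exists:
  assumes c: "clasp (fst F) a w' u\<^sub>0" and F: "F \<in> ES"
  obtains \<epsilon> where "(w', \<epsilon>) \<in> ES" "agree_off a F (w', \<epsilon>)"
proof -
  \<comment> \<open>The point has to avoid the rectangle, because the joined circle inherits the
    mark of the other component and not that of the rectangle.\<close>
  define \<epsilon> where "\<epsilon> D = (if D \<in> closed w' then mk F (SOME u. u \<in> D \<and> u \<notin> rect a) else None)" for D
  have pick: "(SOME u. u \<in> D \<and> u \<notin> rect a) \<in> D" "(SOME u. u \<in> D \<and> u \<notin> rect a) \<notin> rect a"
    if "D \<in> closed w'" for D
  proof -
    obtain u where "u \<in> D \<and> u \<notin> rect a"
      by (rule clasp_off_rect[OF c \<open>D \<in> closed w'\<close>]) blast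
    from someI[of "\<lambda>u. u \<in> D \<and> u \<notin> rect a", OF this]
    show "(SOME u. u \<in> D \<and> u \<notin> rect a) \<in> D" "(SOME u. u \<in> D \<and> u \<notin> rect a) \<notin> rect a" by auto
  qed
  have m: "mk F u = mk (w', \<epsilon>) u" if u: "u \<in> points n k" "u \<notin> rect a" for u
  proof (cases "comp w' u \<in> closed w'")
    case True
    let ?v = "SOME v. v \<in> comp w' u \<and> v \<notin> rect a"
    have v: "?v \<in> comp w' u" "?v \<notin> rect a" using pick[OF True] .
    have "comp (fst F) ?v = comp (fst F) u"
      using clasp_comp_eq[OF c v(2) u(2)] comp_eqI[OF v(1)] by simp
    then show ?thesis using True by (simp add: mk_def \<epsilon>_def)
  next
    case False
    then show ?thesis using clasp_closed[OF c u] mk_None[OF F u(1)] by (simp add: mk_def \<epsilon>_def)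
  qed
  have "dom \<epsilon> = closed w'"
  proof (intro set_eqI iffI)
    fix D assume D: "D \<in> closed w'"
    let ?v = "SOME v. v \<in> D \<and> v \<notin> rect a"
    have v: "?v \<in> D" "?v \<notin> rect a" using pick[OF D] .
    have "mk F ?v \<noteq> None"
      using mk_None[OF F] clasp_closed[OF c _ v(2)] closed_mem[OF D v(1)] D by auto
    then show "D \<in> dom \<epsilon>" using D by (auto simp: \<epsilon>_def)
  qed (auto simp: \<epsilon>_def split: if_splits)
  then have "(w', \<epsilon>) \<in> ES" using c by (simp add: ES_iff clasp_def)
  moreover have "agree_off a F (w', \<epsilon>)" using m by (simp add: agree_off_def)
  ultimately show thesis by (rule that)
qed

lemma fine_unique:
  assumes c: "clasp w a w' u\<^sub>0" and S: "S \<in> ES" "fst S = w" "S' \<in> ES" "fst S' = w"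
    and m: "snd S (rect a) = snd S' (rect a)" and ag: "agree_off a S C" "agree_off a S' C"
  shows "S = S'"
proof -
  have cw: "circ w a" "word w" using c by (auto simp: clasp_def)
  have "snd S D = snd S' D" for D
  proof (cases "D \<in> closed w \<and> D \<noteq> rect a")
    case True
    then obtain u where u: "u \<in> points n k" "D = comp w u" using closedE by metis
    then have "u \<notin> rect a" using True comp_rect_mem[OF cw] by metis
    then have "mk S u = mk S' u" using ag u by (simp add: agree_off_def)
    then show ?thesis using u S by (simp add: mk_def)
  next
    case False
    note nD = False
    show ?thesis
    proof (cases "D = rect a")
      case False
      then have "D \<notin> dom (snd S)" "D \<notin> dom (snd S')" using nD S by (auto simp: ES_iff)
      then show ?thesis by (auto simp: domIff)
    qed (use m in simp)
  qed
  then show ?thesis using S by (auto simp: prod_eq_iff)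
qed

lemma coarse_unique:
  assumes c: "clasp w a w' u\<^sub>0" and S: "S \<in> ES" "fst S = w'" "S' \<in> ES" "fst S' = w'"
    and ag: "agree_off a F S" "agree_off a F S'"
  shows "S = S'"
proof -
  have "snd S D = snd S' D" for D
  proof (cases "D \<in> closed w'")
    case True
    then obtain u where u: "u \<in> D" "u \<notin> rect a" using clasp_off_rect[OF c] by metis
    then have "D = comp w' u" "u \<in> points n k" using True closed_mem by auto
    moreover have "mk S u = mk S' u" using ag u calculation by (simp add: agree_off_def)
    ultimately show ?thesis using S by (simp add: mk_def)
  next
    case False
    then have "D \<notin> dom (snd S)" "D \<notin> dom (snd S')" using S by (auto simp: ES_iff)
    then show ?thesis by (auto simp: domIff)
  qed
  then show ?thesis using S by (auto simp: prod_eq_iff)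
qed

section \<open>Gaussian elimination pairs\<close>

definition pairA :: "nat \<Rightarrow> enhanced_state \<Rightarrow> enhanced_state \<Rightarrow> bool" where
  "pairA a S T \<longleftrightarrow> S \<in> ES \<and> T \<in> ES \<and> circ (fst T) a \<and> fst S = fst T - {a + M} \<and>
     snd T (rect a) = Some Minus \<and> agree_off a T S"

definition pairB :: "nat \<Rightarrow> enhanced_state \<Rightarrow> enhanced_state \<Rightarrow> bool" where
  "pairB a S T \<longleftrightarrow> S \<in> ES \<and> T \<in> ES \<and> circ (fst S) a \<and> lt a < M \<and> fst T = insert (Suc a) (fst S) \<and>
     snd S (rect a) = Some Plus \<and> agree_off a S T"

definition pair :: "nat \<Rightarrow> enhanced_state \<Rightarrow> enhanced_state \<Rightarrow> bool" where
  "pair a S T \<longleftrightarrow> pairA a S T \<or> pairB a S T"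

lemma ES_word: "S \<in> ES \<Longrightarrow> word (fst S)"
  by (simp add: ES_iff)

lemma pairA_clasp: "pairA a S T \<Longrightarrow> clasp (fst T) a (fst S) (a + M, lt a)"
  unfolding pairA_def clasp_def using ES_word by blast

lemma pairB_clasp: "pairB a S T \<Longrightarrow> clasp (fst S) a (fst T) (Suc a, Suc (Suc (lt a)))"
  unfolding pairB_def clasp_def using ES_word by blast

lemma G1_unfold:
  "G1_pair n k j j' S T \<longleftrightarrow> S \<in> ES \<and> T \<in> ES \<and> j' = j + M \<and> j \<in> fst S \<and> j' \<notin> fst S \<and>
     fst T = insert j' (fst S) \<and> (\<exists>C \<in> closed (fst T). first_crossing n (fst T) C = j \<and>
       last_crossing n (fst T) C = j' \<and> snd T C = Some Minus \<and> agree_apart_from n k C S T)"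
  using G1_pair.simps[of n k j j' "fst S" "snd S" "fst T" "snd T"]
  unfolding prod.collapse One_nat_def n_diff .

lemma G2_unfold:
  "G2_pair n k j j' S T \<longleftrightarrow> S \<in> ES \<and> T \<in> ES \<and> j' = j + M \<and> j \<in> fst S \<and> j' \<in> fst S \<and>
     (\<exists>p. j < p \<and> p < j' \<and> lt p = lt j + 1 \<and> p \<notin> fst S \<and> fst T = insert p (fst S)) \<and>
     (\<exists>C \<in> closed (fst S). first_crossing n (fst S) C = j \<and>
       last_crossing n (fst S) C = j' \<and> snd S C = Some Plus \<and> agree_apart_from n k C S T)"
  using G2_pair.simps[of n k j j' "fst S" "snd S" "fst T" "snd T"]
  unfolding prod.collapse One_nat_def n_diff .

lemma G1_iff: "G1_pair n k j j' S T \<longleftrightarrow> j' = j + M \<and> pairA j S T"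
proof
  assume "G1_pair n k j j' S T"
  then have *: "S \<in> ES" "T \<in> ES" "j' = j + M" "j \<in> fst S" "j' \<notin> fst S" "fst T = insert j' (fst S)"
    and "\<exists>C \<in> closed (fst T). first_crossing n (fst T) C = j \<and> last_crossing n (fst T) C = j' \<and>
        snd T C = Some Minus \<and> agree_apart_from n k C S T"
    unfolding G1_unfold by blast+
  then obtain C where C: "C \<in> closed (fst T)" "first_crossing n (fst T) C = j"
      "last_crossing n (fst T) C = j + M" "snd T C = Some Minus" "agree_apart_from n k C S T" by auto
  have w: "word (fst S)" "word (fst T)" by (rule ES_word[OF *(1)], rule ES_word[OF *(2)])
  from circ_if_first_last[OF C(1) w(2) C(2,3)] have c: "circ (fst T) j" "C = rect j" by auto
  have s: "fst S = fst T - {j + M}" using *(3,5,6) by auto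
  have cl: "clasp (fst T) j (fst S) (j + M, lt j)" using c w s unfolding clasp_def by blast
  have "agree_off j T S" using C(5) agree_apart_iff(2)[OF cl *(2,1)] c by simp
  then show "j' = j + M \<and> pairA j S T" using *(1,2,3) c C(4) s unfolding pairA_def by simp
next
  assume "j' = j + M \<and> pairA j S T"
  then have j': "j' = j + M" and p: "pairA j S T" by auto
  then have *: "S \<in> ES" "T \<in> ES" "circ (fst T) j" "fst S = fst T - {j + M}"
      "snd T (rect j) = Some Minus" "agree_off j T S" by (auto simp: pairA_def)
  have w: "word (fst T)" by (rule ES_word[OF *(2)])
  have "agree_apart_from n k (rect j) S T" using agree_apart_iff(2)[OF pairA_clasp[OF p] *(2,1)] *(6) by simp
  moreover have "j \<in> fst S" "j' \<notin> fst S" "fst T = insert j' (fst S)"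
    using circD(4,5)[OF *(3) w] *(4) j' by auto
  ultimately show "G1_pair n k j j' S T"
    using *(1,2,5) j' first_last_rect[OF *(3) w] rect_closed[OF *(3) w] unfolding G1_unfold by blast
qed

lemma G2_iff: "G2_pair n k j j' S T \<longleftrightarrow> j' = j + M \<and> pairB j S T"
proof
  assume "G2_pair n k j j' S T"
  then have *: "S \<in> ES" "T \<in> ES" "j' = j + M" "j \<in> fst S"
      and p: "\<exists>p. j < p \<and> p < j' \<and> lt p = lt j + 1 \<and> p \<notin> fst S \<and> fst T = insert p (fst S)"
    and "\<exists>C \<in> closed (fst S). first_crossing n (fst S) C = j \<and> last_crossing n (fst S) C = j' \<and>
        snd S C = Some Plus \<and> agree_apart_from n k C S T"
    unfolding G2_unfold by blast+
  then obtain C where C: "C \<in> closed (fst S)" "first_crossing n (fst S) C = j"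
      "last_crossing n (fst S) C = j + M" "snd S C = Some Plus" "agree_apart_from n k C S T" by auto
  have w: "word (fst S)" "word (fst T)" by (rule ES_word[OF *(1)], rule ES_word[OF *(2)])
  from circ_if_first_last[OF C(1) w(1) C(2,3)] have c: "circ (fst S) j" "C = rect j" by auto
  obtain p where p: "j < p" "p < j + M" "lt p = Suc (lt j)" "fst T = insert p (fst S)" using p *(3) by auto
  have "p = Suc j" by (rule letter_between(2)[OF circD(1)[OF c(1) w(1)] p(1-3)])
  moreover have "lt j < M" using p(3) letter_le[of p] by linarith
  ultimately have cl: "clasp (fst S) j (fst T) (Suc j, Suc (Suc (lt j)))"
    using c w p(4) unfolding clasp_def by blast
  have "agree_off j S T" using C(5) agree_apart_iff(1)[OF cl *(1,2)] c by simp
  then show "j' = j + M \<and> pairB j S T"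
    using *(1,2,3) c C(4) p(4) \<open>p = Suc j\<close> \<open>lt j < M\<close> unfolding pairB_def by simp
next
  assume "j' = j + M \<and> pairB j S T"
  then have j': "j' = j + M" and p: "pairB j S T" by auto
  then have *: "S \<in> ES" "T \<in> ES" "circ (fst S) j" "fst T = insert (Suc j) (fst S)" "lt j < M"
      "snd S (rect j) = Some Plus" "agree_off j S T" by (auto simp: pairB_def)
  have w: "word (fst S)" by (rule ES_word[OF *(1)])
  have "agree_apart_from n k (rect j) S T" using agree_apart_iff(1)[OF pairB_clasp[OF p] *(1,2)] *(7) by simp
  moreover have "j \<in> fst S" "j' \<in> fst S" "Suc j \<notin> fst S" "1 \<le> j"
    using circD(1,4,5,7)[OF *(3) w] *(5) j' by auto
  moreover have "j < Suc j \<and> Suc j < j + M \<and> lt (Suc j) = lt j + 1"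
  proof -
    have "1 < M" using *(5) letter_pos(1)[of j] by linarith
    then show ?thesis using letter_Suc[of j] \<open>1 \<le> j\<close> *(5) by simp
  qed
  ultimately show "G2_pair n k j j' S T"
    using *(1,2,4,6) j' first_last_rect[OF *(3) w] rect_closed[OF *(3) w] unfolding G2_unfold by blast
qed

lemma supports_iff: "supports n k J (S, T) \<longleftrightarrow> snd J = fst J + M \<and> pair (fst J) S T"
  by (auto simp: supports_def G1_iff G2_iff pair_def)

lemma pairA_D:
  assumes "pairA a S T"
  shows "S \<in> ES" "T \<in> ES" "circ (fst T) a" "word (fst T)" "word (fst S)" "fst S = fst T - {a + M}"
    "fst T = insert (a + M) (fst S)" "mk T (a, lt a) = Some Minus" "1 \<le> a" "a + M \<le> N" "free (fst S) a"
    "a \<in> fst S" "a + M \<notin> fst S" "lt a < M \<Longrightarrow> Suc a \<notin> fst S"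
proof -
  show 1: "S \<in> ES" "T \<in> ES" "circ (fst T) a" and w: "word (fst T)" "word (fst S)"
    and s: "fst S = fst T - {a + M}"
    using assms ES_word unfolding pairA_def by blast+
  note c = circD[OF 1(3) w(1)]
  show "fst T = insert (a + M) (fst S)" "a + M \<notin> fst S" using s c by auto
  show "mk T (a, lt a) = Some Minus"
    using assms comp_rect[OF 1(3) w(1)] by (simp add: pairA_def mk_def)
  show "1 \<le> a" "a + M \<le> N" "a \<in> fst S" using c s by auto
  then show "free (fst S) a" using c(8) s by (auto simp: free_def)
  show "Suc a \<notin> fst S" if "lt a < M" using c(7) that s by auto
qed

lemma pairB_D:
  assumes "pairB a S T"
  shows "S \<in> ES" "T \<in> ES" "circ (fst S) a" "word (fst T)" "word (fst S)" "fst T = insert (Suc a) (fst S)"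
    "fst S = fst T - {Suc a}" "lt a < M" "mk S (a, lt a) = Some Plus" "1 \<le> a" "a + M \<le> N"
    "free (fst S) a" "free (fst T) a"
    "a \<in> fst S" "a + M \<in> fst S" "Suc a \<notin> fst S"
proof -
  show 1: "S \<in> ES" "T \<in> ES" "circ (fst S) a" and w: "word (fst T)" "word (fst S)"
    and t: "fst T = insert (Suc a) (fst S)" and l: "lt a < M"
    using assms ES_word unfolding pairB_def by blast+
  note c = circD[OF 1(3) w(2)]
  show "fst S = fst T - {Suc a}" "Suc a \<notin> fst S" using t c(7)[OF l] by auto
  show "mk S (a, lt a) = Some Plus"
    using assms comp_rect[OF 1(3) w(2)] by (simp add: pairB_def mk_def)
  show "1 \<le> a" "a + M \<le> N" "a \<in> fst S" "a + M \<in> fst S" "free (fst S) a" by (fact c)+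
  have "a + M - 1 \<noteq> Suc a" if "2 \<le> lt a" using that l by linarith
  then show "free (fst T) a" using c(6) unfolding t free_def by blast
qed

lemma pair_D:
  assumes "pair a S T"
  shows "S \<in> ES" "T \<in> ES" "word (fst T)" "word (fst S)" "1 \<le> a" "a + M \<le> N" "free (fst S) a" "a \<in> fst S"
    "card (fst T) = Suc (card (fst S))"
proof -
  consider "pairA a S T" | "pairB a S T" using assms unfolding pair_def by blast
  then have "S \<in> ES \<and> T \<in> ES \<and> word (fst T) \<and> word (fst S) \<and> 1 \<le> a \<and> a + M \<le> N \<and>
      free (fst S) a \<and> a \<in> fst S \<and> card (fst T) = Suc (card (fst S))"
  proof cases
    case 1
    note D = pairA_D[OF 1]
    have "finite (fst S)" using D(5) by (rule finite_subset) simp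
    then have "card (fst T) = Suc (card (fst S))" unfolding D(7) by (rule card_insert_disjoint[OF _ D(13)])
    then show ?thesis using D(1,2,4,5,9-12) by blast
  next
    case 2
    note D = pairB_D[OF 2]
    have "finite (fst S)" using D(5) by (rule finite_subset) simp
    then have "card (fst T) = Suc (card (fst S))" unfolding D(6) by (rule card_insert_disjoint[OF _ D(16)])
    then show ?thesis using D(1,2,4,5,10-12,14) by blast
  qed
  then show "S \<in> ES" "T \<in> ES" "word (fst T)" "word (fst S)" "1 \<le> a" "a + M \<le> N" "free (fst S) a"
    "a \<in> fst S" "card (fst T) = Suc (card (fst S))" by blast+
qed

lemma pair_mk:
  assumes "pair a S T" "u \<in> points n k" "u \<notin> rect a"
  shows "mk S u = mk T u"
  using assms by (auto simp: pair_def pairA_def pairB_def agree_off_def)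

lemma pairA_unique: "pairA a S T \<Longrightarrow> pairA a S' T \<Longrightarrow> S = S'"
  by (rule coarse_unique[OF pairA_clasp, of a S T S S' T]) (simp_all add: pairA_def)

lemma pairB_unique:
  assumes "pairB a S T" "pairB a S' T"
  shows "S = S'"
proof (rule fine_unique[OF pairB_clasp[OF assms(1)], of S S' T])
  show "fst S' = fst S" using pairB_D(7)[OF assms(1)] pairB_D(7)[OF assms(2)] by simp
qed (use assms in \<open>simp_all add: pairB_def\<close>)

text \<open>Within one type the toggled bar determines the window. Mixed types would require
  \<open>a + M = Suc b\<close>, so that \<open>b = a + M - 1\<close> is barred inside the circle of
  a G1 target.\<close>

lemma pair_window_unique:
  assumes "pair a S T" "pair b S T"
  shows "a = b"
proof -
  have AB: False if "pairA a S T" "pairB b S T" for a b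
  proof -
    note A = pairA_D[OF that(1)] and B = pairB_D[OF that(2)]
    have e: "a + M = Suc b" using A(7,13) B(6,16) by auto
    have l: "lt (Suc b) = Suc (lt b)" using letter_Suc[of b] B(8,10) by auto
    have "lt a = Suc (lt b)" using letter_period[of a] A(9) e l by simp
    then have "2 \<le> lt a" "b = a + M - 1" using e letter_pos[of b] by linarith+
    then have "b \<notin> fst T" using circD(8)[OF A(3,4)] by simp
    then show False using B(6,14) by simp
  qed
  from assms consider "pairA a S T" "pairA b S T" | "pairB a S T" "pairB b S T"
    using AB[of a b] AB[of b a] unfolding pair_def by blast
  then show ?thesis
  proof cases
    case 1
    have "b + M \<in> insert (a + M) (fst S)" using pairA_D(7)[OF 1(1)] pairA_D(7)[OF 1(2)] by auto
    then show ?thesis using pairA_D(13)[OF 1(2)] by auto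
  next
    case 2
    have "Suc b \<in> insert (Suc a) (fst S)" using pairB_D(6)[OF 2(1)] pairB_D(6)[OF 2(2)] by auto
    then show ?thesis using pairB_D(16)[OF 2(2)] by auto
  qed
qed

section \<open>Distinguished isomorphisms\<close>

abbreviation "\<G> \<equiv> distinguished n k"

definition source_at :: "nat \<Rightarrow> enhanced_state \<Rightarrow> bool" where
  "source_at a S \<longleftrightarrow> (\<exists>T. pair a S T)"

definition target_at :: "nat \<Rightarrow> enhanced_state \<Rightarrow> bool" where
  "target_at a S \<longleftrightarrow> (\<exists>R. (R, S) \<in> \<G> \<and> pair a R S)"

lemma scan_iff:
  "(S', T) \<in> scan n k \<D> S Js \<longleftrightarrow> S' = S \<and> (\<exists>xs J ys. Js = xs @ J # ys \<and> supports n k J (S, T) \<and>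
      (\<forall>J' \<in> insert J (set xs). \<nexists>R. (R, S) \<in> \<D> \<and> supports n k J' (R, S)) \<and>
      (\<forall>J' \<in> set xs. \<nexists>T. supports n k J' (S, T)))"
proof (induction Js)
  case (Cons J Js)
  let ?t = "\<lambda>J. \<exists>R. (R, S) \<in> \<D> \<and> supports n k J (R, S)"
  let ?s = "\<lambda>J. \<exists>T. supports n k J (S, T)"
  let ?Q = "\<lambda>Js. \<exists>xs J ys. Js = xs @ J # ys \<and> supports n k J (S, T) \<and>
      (\<forall>J' \<in> insert J (set xs). \<not> ?t J') \<and> (\<forall>J' \<in> set xs. \<not> ?s J')"
  have *: "?Q (J # Js) \<longleftrightarrow> \<not> ?t J \<and> (supports n k J (S, T) \<or> \<not> ?s J \<and> ?Q Js)"
    (is "_ \<longleftrightarrow> ?R")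
  proof
    assume "?Q (J # Js)"
    then obtain xs J' ys where x: "J # Js = xs @ J' # ys" "supports n k J' (S, T)"
      "\<forall>J'' \<in> insert J' (set xs). \<not> ?t J''" "\<forall>J'' \<in> set xs. \<not> ?s J''" by blast
    show ?R
    proof (cases xs)
      case Nil
      then show ?thesis using x by auto
    next
      case (Cons z zs)
      then have "?Q Js" using x by (intro exI[of _ zs] exI[of _ J'] exI[of _ ys]) auto
      then show ?thesis using x Cons by auto
    qed
  next
    assume R: ?R
    show "?Q (J # Js)"
    proof (cases "supports n k J (S, T)")
      case True
      then show ?thesis using R by (intro exI[of _ "[]"] exI[of _ J] exI[of _ Js]) auto
    next
      case False
      then obtain xs J' ys where x: "Js = xs @ J' # ys" "supports n k J' (S, T)"
        "\<forall>J'' \<in> insert J' (set xs). \<not> ?t J''" "\<forall>J'' \<in> set xs. \<not> ?s J''" using R by blast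
      then show ?thesis using R False
        by (intro exI[of _ "J # xs"] exI[of _ J'] exI[of _ ys]) auto
    qed
  qed
  have "(S', T) \<in> scan n k \<D> S (J # Js) \<longleftrightarrow>
      S' = S \<and> \<not> ?t J \<and> (supports n k J (S, T) \<or> \<not> ?s J \<and> ?Q Js)"
  proof (cases "?t J")
    case False
    then show ?thesis
      by (cases "?s J") (simp_all only: scan.simps Cons.IH if_True if_False mem_Collect_eq prod.inject, blast+)
  qed (simp only: scan.simps if_True, blast)
  then show ?case unfolding * by blast
qed simp

abbreviation scan_order :: "nat \<times> nat \<Rightarrow> nat \<times> nat \<Rightarrow> bool" where
  "scan_order x y \<equiv> fst x < fst y \<or> fst x = fst y \<and> snd x < snd y"

lemma subwords_sorted: "sorted_wrt scan_order (subwords n k w)"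
proof -
  have "sorted_wrt scan_order (concat (map (\<lambda>a. map (Pair a) [Suc a..<K]) xs))"
    if "sorted_wrt (<) xs" for xs K
    using that by (induction xs) (auto simp: sorted_wrt_append sorted_wrt_map)
  then show ?thesis
    unfolding subwords_def by (simp add: sorted_wrt_filter del: upt_Suc)
qed

lemma subwords_set: "J \<in> set (subwords n k w) \<longleftrightarrow> fst J \<in> w \<and> 1 \<le> fst J \<and> fst J < snd J \<and> snd J \<le> N"
  by (cases J) (auto simp: subwords_def image_iff Suc_le_eq simp del: upt_Suc)

text \<open>Only subwords from \<open>b\<close> to \<open>b + M\<close> support anything, so the
  lexicographic scan is a search by start alone. Targets are excluded for \<open>b = a\<close> as
  well, because Step 1 precedes Step 2 on the same subword.\<close>

lemma scan_subwords_iff: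
  "(S', T) \<in> scan n k \<D> S (subwords n k (fst S)) \<longleftrightarrow> S' = S \<and>
     (\<exists>a. pair a S T \<and> (\<forall>b\<le>a. \<nexists>R. (R, S) \<in> \<D> \<and> pair b R S) \<and> (\<forall>b<a. \<not> source_at b S))"
  (is "_ \<longleftrightarrow> S' = S \<and> ?A")
proof -
  let ?L = "subwords n k (fst S)"
  let ?t = "\<lambda>J. \<exists>R. (R, S) \<in> \<D> \<and> supports n k J (R, S)"
  let ?s = "\<lambda>J. \<exists>T. supports n k J (S, T)"
  have inL: "(b, b + M) \<in> set ?L" if "source_at b S \<or> pair b R S" for b R
  proof -
    have "b \<in> fst S \<and> 1 \<le> b \<and> b + M \<le> N"
    proof (cases "source_at b S")
      case True
      then obtain T where "pair b S T" by (auto simp: source_at_def)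
      then show ?thesis using pair_D(5,6,8) by blast
    next
      case False
      then have "pair b R S" using that by simp
      then have "b \<in> fst S" "1 \<le> b \<and> b + M \<le> N"
        using pairA_D(7,12)[of b R S] pairB_D(6,14)[of b R S] pair_D(5,6)[of b R S]
        by (auto simp: pair_def)
      then show ?thesis by blast
    qed
    then show ?thesis by (simp add: subwords_set)
  qed
  have "(\<exists>xs J ys. ?L = xs @ J # ys \<and> supports n k J (S, T) \<and>
      (\<forall>J' \<in> insert J (set xs). \<not> ?t J') \<and> (\<forall>J' \<in> set xs. \<not> ?s J')) \<longleftrightarrow> ?A" (is "?B \<longleftrightarrow> _")
  proof
    assume ?B
    then obtain xs J ys where L: "?L = xs @ J # ys" and J: "supports n k J (S, T)"
      and no: "\<forall>J' \<in> insert J (set xs). \<not> ?t J'" "\<forall>J' \<in> set xs. \<not> ?s J'" by blast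
    define a where "a = fst J"
    have a: "J = (a, a + M)" "pair a S T" using J by (auto simp: supports_iff a_def prod_eq_iff)
    have so: "sorted_wrt scan_order (xs @ J # ys)" using subwords_sorted[of "fst S"] L by simp
    have xs: "(b, b + M) \<in> set xs" if "(b, b + M) \<in> set ?L" "b < a" for b
    proof -
      have "(b, b + M) \<notin> set (J # ys)" using so that(2) a(1) by (fastforce simp: sorted_wrt_append)
      then show ?thesis using that(1) L by auto
    qed
    have "\<not> ((R, S) \<in> \<D> \<and> pair b R S)" if "b \<le> a" for b R
    proof
      assume r: "(R, S) \<in> \<D> \<and> pair b R S"
      then have "(b, b + M) \<in> insert J (set xs)"
        using xs[OF inL[of b R]] a that by (cases "b = a") auto
      then have "\<not> ?t (b, b + M)" using no(1) by (rule bspec[rotated])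
      then show False using r unfolding supports_iff fst_conv snd_conv by blast
    qed
    moreover have "\<not> source_at b S" if "b < a" for b
    proof
      assume r: "source_at b S"
      then have "(b, b + M) \<in> set xs" using xs[OF inL] that by auto
      then have "\<not> ?s (b, b + M)" using no(2) by (rule bspec[rotated])
      then show False using r unfolding supports_iff fst_conv snd_conv source_at_def by blast
    qed
    ultimately show ?A using a(2) by blast
  next
    assume ?A
    then obtain a where a: "pair a S T" "\<And>b R. b \<le> a \<Longrightarrow> \<not> ((R, S) \<in> \<D> \<and> pair b R S)"
      "\<And>b. b < a \<Longrightarrow> \<not> source_at b S" by blast
    have "(a, a + M) \<in> set ?L" using inL[of a] a(1) unfolding source_at_def by blast
    then obtain xs ys where L: "?L = xs @ (a, a + M) # ys" by (auto dest: split_list)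
    have so: "sorted_wrt scan_order (xs @ (a, a + M) # ys)" using subwords_sorted[of "fst S"] L by simp
    have xs: "b < a" if "(b, b + M) \<in> set xs" for b
      using so that by (fastforce simp: sorted_wrt_append)
    have "\<not> ?t J'" if "J' \<in> insert (a, a + M) (set xs)" for J'
    proof
      assume t: "?t J'"
      then have J': "J' = (fst J', fst J' + M)" unfolding supports_iff by (metis prod.collapse)
      have "fst J' \<le> a"
      proof (cases "J' = (a, a + M)")
        case False
        then have "(fst J', fst J' + M) \<in> set xs" using that J' by simp
        then show ?thesis using xs[of "fst J'"] by simp
      qed simp
      then show False using a(2)[of "fst J'"] t unfolding supports_iff by blast
    qed
    moreover have "\<not> ?s J'" if "J' \<in> set xs" for J'
    proof
      assume t: "?s J'"
      then have "J' = (fst J', fst J' + M)" unfolding supports_iff by (metis prod.collapse)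
      then have "fst J' < a" using that xs[of "fst J'"] by metis
      then show False using a(3)[of "fst J'"] t unfolding supports_iff source_at_def by blast
    qed
    moreover have "supports n k (a, a + M) (S, T)" using a(1) by (simp add: supports_iff)
    ultimately show ?B using L by blast
  qed
  then show ?thesis by (simp only: scan_iff)
qed

text \<open>The decision about a source is made at the stage of its degree and never
  revised.\<close>

lemma distinguished_below_iff:
  "(S, T) \<in> distinguished_below n k d \<longleftrightarrow> degree S < d \<and> S \<in> ES \<and>
     (S, T) \<in> scan n k (distinguished_below n k (degree S)) S (subwords n k (fst S))"
proof (induction d)
  case (Suc d)
  have *: "(S, T) \<in> (\<Union>S' \<in> {S' \<in> ES. degree S' = d}. scan n k \<D> S' (subwords n k (fst S'))) \<longleftrightarrow>
      S \<in> ES \<and> degree S = d \<and> (S, T) \<in> scan n k \<D> S (subwords n k (fst S))" for \<D>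
    using scan_iff[of S T \<D>] by auto
  show ?case unfolding distinguished_below.simps Un_iff * Suc.IH less_Suc_eq by blast
qed simp

text \<open>The stages disappear: an isomorphism with target \<open>S\<close> has a source of
  smaller degree, so testing against the set built so far is the same as testing against the final
  set.\<close>

lemma distinguished_iff:
  "(S, T) \<in> \<G> \<longleftrightarrow> (\<exists>a. pair a S T \<and> \<not> target_at a S \<and> (\<forall>b<a. \<not> source_at b S \<and> \<not> target_at b S))"
proof -
  have deg: "degree S < Suc N" if "S \<in> ES" for S
    using card_mono[OF _ ES_word[OF that]] by (simp add: degree_def)
  have "(R, S) \<in> distinguished_below n k (degree S) \<longleftrightarrow> (R, S) \<in> \<G>" if "pair b R S" for b R S
    unfolding distinguished_def distinguished_below_iff[of R S]
    using pair_D(9)[OF that] deg[OF pair_D(1)[OF that]] by (simp add: degree_def)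
  then have *: "(\<exists>R. (R, S) \<in> distinguished_below n k (degree S) \<and> pair b R S) \<longleftrightarrow> target_at b S" for b
    unfolding target_at_def by blast
  have "(S, T) \<in> \<G> \<longleftrightarrow> degree S < Suc N \<and> S \<in> ES \<and>
     (\<exists>a. pair a S T \<and> (\<forall>b\<le>a. \<not> target_at b S) \<and> (\<forall>b<a. \<not> source_at b S))"
    unfolding distinguished_def distinguished_below_iff[of S T] scan_subwords_iff * by blast
  also have "\<dots> \<longleftrightarrow> (\<exists>a. pair a S T \<and> (\<forall>b\<le>a. \<not> target_at b S) \<and> (\<forall>b<a. \<not> source_at b S))"
    using pair_D(1) deg by blast
  finally show ?thesis by (auto simp: le_less)
qed

section \<open>Existence of partners in a window\<close>

lemma pairA_source_exists:
  assumes S: "S \<in> ES" and a: "free (fst S) a" "a + M \<notin> fst S" "a + M \<le> N" "lt a < M \<Longrightarrow> Suc a \<notin> fst S"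
  shows "\<exists>T. pairA a S T"
proof -
  let ?w = "insert (a + M) (fst S)"
  have w: "word (fst S)" by (rule ES_word[OF S])
  have "1 \<le> a + M" using M_pos(1) by linarith
  then have w': "word ?w" using w a(3) by simp
  have "a + M - 1 \<noteq> a + M" using M_pos(1) by linarith
  then have "free ?w a" using a(1) unfolding free_def by blast
  moreover have "Suc a \<notin> ?w" if "lt a < M"
  proof -
    have "1 < M" using that letter_pos(1)[of a] by linarith
    then show ?thesis using a(4)[OF that] by simp
  qed
  ultimately have c: "circ ?w a" unfolding circ_def by blast
  have s: "fst S = ?w - {a + M}" using a(2) by blast
  have cl: "clasp ?w a (fst S) (a + M, lt a)" unfolding clasp_def using c w w' s by blast
  obtain \<epsilon> where "(?w, \<epsilon>) \<in> ES" "\<epsilon> (rect a) = Some Minus" "agree_off a (?w, \<epsilon>) S"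
    by (rule fine_exists[OF cl S])
  then have "pairA a S (?w, \<epsilon>)" using S c s unfolding pairA_def by simp
  then show ?thesis by blast
qed

lemma pairA_target_exists:
  assumes T: "T \<in> ES" and c: "circ (fst T) a" and m: "mk T (a, lt a) = Some Minus"
  shows "\<exists>S. pairA a S T"
proof -
  let ?w = "fst T - {a + M}"
  have w: "word (fst T)" by (rule ES_word[OF T])
  then have w': "word ?w" by blast
  have cl: "clasp (fst T) a ?w (a + M, lt a)" unfolding clasp_def using c w w' by blast
  obtain \<epsilon> where "(?w, \<epsilon>) \<in> ES" "agree_off a T (?w, \<epsilon>)" by (rule coarse_exists[OF cl T])
  then have "pairA a (?w, \<epsilon>) T" using T c m comp_rect[OF c w] unfolding pairA_def mk_def by simp
  then show ?thesis by blast
qed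

lemma pairB_source_exists:
  assumes S: "S \<in> ES" and c: "circ (fst S) a" and l: "lt a < M" and m: "mk S (a, lt a) = Some Plus"
  shows "\<exists>T. pairB a S T"
proof -
  let ?w = "insert (Suc a) (fst S)"
  have w: "word (fst S)" by (rule ES_word[OF S])
  have "Suc a \<le> N" using circD(3)[OF c w] M_pos(1) by linarith
  then have w': "word ?w" using w by simp
  have cl: "clasp (fst S) a ?w (Suc a, Suc (Suc (lt a)))" unfolding clasp_def using c w w' l by blast
  obtain \<epsilon> where "(?w, \<epsilon>) \<in> ES" "agree_off a S (?w, \<epsilon>)" by (rule coarse_exists[OF cl S])
  then have "pairB a S (?w, \<epsilon>)" using S c m l comp_rect[OF c w] unfolding pairB_def mk_def by simp
  then show ?thesis by blast
qed

text \<open>Dropping \<open>Suc a\<close> creates the circle, so its mark is still free and can be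
  chosen \<open>Plus\<close>; the bars alone decide.\<close>

lemma pairB_target_exists:
  assumes T: "T \<in> ES" and f: "free (fst T) a" and y: "a + M \<in> fst T" and z: "Suc a \<in> fst T"
    and l: "lt a < M"
  shows "\<exists>S. pairB a S T"
proof -
  let ?w = "fst T - {Suc a}"
  have w: "word (fst T)" by (rule ES_word[OF T])
  then have w': "word ?w" by blast
  have "1 < M" using l letter_pos(1)[of a] by linarith
  then have c: "circ ?w a" using f y unfolding circ_def free_def by simp
  have t: "fst T = insert (Suc a) ?w" using z by blast
  have cl: "clasp ?w a (fst T) (Suc a, Suc (Suc (lt a)))" unfolding clasp_def using c w w' l t by blast
  obtain \<epsilon> where "(?w, \<epsilon>) \<in> ES" "\<epsilon> (rect a) = Some Plus" "agree_off a (?w, \<epsilon>) T"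
    by (rule fine_exists[OF cl T])
  then have "pairB a (?w, \<epsilon>) T" using T c t l unfolding pairB_def by simp
  then show ?thesis by blast
qed

section \<open>A local criterion for being matched at a window\<close>

text \<open>
  The position \<open>nxt c\<close> is the letter \<open>i + 2\<close> preceding a letter \<open>i\<close> at \<open>c\<close>, so that the letter \<open>i + 1\<close>
  at \<open>Suc c\<close>, which the G2 isomorphism in the window at \<open>c\<close> toggles, blocks the window at \<open>nxt c\<close>. A
  G2 target in the window at \<open>c\<close> is hence distinguished iff its source is not matched at \<open>nxt c\<close>,
  which explains the recursion in \<open>psi\<close>. Truncation in \<open>nxt\<close> is excluded by \<open>has_nxt\<close>.
\<close>

definition nxt :: "nat \<Rightarrow> nat" where
  "nxt c = c + 2 - M"

definition has_nxt :: "nat \<Rightarrow> bool" where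
  "has_nxt c \<longleftrightarrow> lt c + 2 \<le> M \<and> M \<le> Suc c"

lemma nxt:
  assumes "has_nxt c" "1 \<le> c"
  shows "nxt c + M = c + 2" "1 \<le> nxt c" "nxt c < c" "lt (nxt c) = lt c + 2" "height (nxt c) = height c"
    "3 \<le> M" "lt c < M" "nxt c + M - 1 = Suc c" "2 \<le> lt (nxt c)"
proof -
  have h: "lt c + 2 \<le> M" "M \<le> Suc c" using assms(1) by (auto simp: has_nxt_def)
  show 3: "3 \<le> M" "lt c < M" using h(1) letter_pos(1)[of c] by linarith+
  show 1: "nxt c + M = c + 2" "1 \<le> nxt c" "nxt c < c" "nxt c + M - 1 = Suc c"
    using h 3(1) unfolding nxt_def by linarith+
  show "lt (nxt c) = lt c + 2" "height (nxt c) = height c"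
    by (rule letter_diag[OF 1(2,1) h(1) assms(2)])+
  then show "2 \<le> lt (nxt c)" by simp
qed

text \<open>Without the bar at \<open>c + M\<close> the state can only be a G1 source. With it and
  without \<open>Suc c\<close> there is a circle, matched in either case: \<open>Minus\<close> makes
  a G1 target, \<open>Plus\<close> a G2 source. The letter \<open>M\<close> admits no G2, so a
  \<open>Plus\<close> circle is unmatched. In a blocked window the component may be an arc, with
  mark \<open>None\<close>; there the value matters only through the recursion.\<close>

function psi :: "enhanced_state \<Rightarrow> nat \<Rightarrow> bool" where
  "psi W c = (if c + M \<notin> fst W then lt c < M \<longrightarrow> Suc c \<notin> fst W
     else if lt c = M then mk W (c, lt c) \<noteq> Some Plus
     else if Suc c \<notin> fst W then True
     else if has_nxt c \<and> nxt c \<in> fst W then \<not> psi W (nxt c) else True)"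
  by auto
termination
proof (relation "measure snd", goal_cases)
  case (2 W c)
  then have h: "lt c + 2 \<le> M" "M \<le> Suc c" by (auto simp: has_nxt_def)
  then have "nxt c < c" using letter_pos(1)[of c] unfolding nxt_def by linarith
  then show ?case by simp
qed simp

declare psi.simps [simp del]

definition phi :: "enhanced_state \<Rightarrow> nat \<Rightarrow> bool" where
  "phi W c \<longleftrightarrow> free (fst W) c \<and> c + M \<le> N \<and> psi W c"

lemma psi_0: "c + M \<notin> fst W \<Longrightarrow> psi W c \<longleftrightarrow> (lt c < M \<longrightarrow> Suc c \<notin> fst W)"
  and psi_last: "c + M \<in> fst W \<Longrightarrow> lt c = M \<Longrightarrow> psi W c \<longleftrightarrow> mk W (c, lt c) \<noteq> Some Plus"
  and psi_10: "Suc c \<notin> fst W \<Longrightarrow> lt c < M \<Longrightarrow> psi W c"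
  and psi_11: "c + M \<in> fst W \<Longrightarrow> Suc c \<in> fst W \<Longrightarrow> lt c < M \<Longrightarrow>
    psi W c \<longleftrightarrow> \<not> (has_nxt c \<and> nxt c \<in> fst W \<and> psi W (nxt c))"
  by (subst psi.simps; auto)+

section \<open>Diagonal sequences of windows, and what the criterion reads along them\<close>

inductive diag :: "nat \<Rightarrow> nat \<Rightarrow> bool" where
  diag_refl: "diag c c"
| diag_step: "has_nxt c \<Longrightarrow> diag (nxt c) d \<Longrightarrow> diag c d"

lemma diag_pos:
  assumes "diag c d" "1 \<le> c"
  shows "1 \<le> d \<and> height d = height c \<and>
    (d = c \<or> d < c \<and> has_nxt c \<and> lt c + 2 \<le> lt d \<and> (d = nxt c \<or> d + M < c))"
  using assms
proof (induction rule: diag.induct)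
  case (diag_step c d)
  note n = nxt[OF diag_step.hyps(1) diag_step.prems]
  from diag_step.IH[OF n(2)] have IH: "1 \<le> d" "height d = height c"
      "d = nxt c \<or> d < nxt c \<and> has_nxt (nxt c) \<and> lt (nxt c) + 2 \<le> lt d \<and> (d = nxt (nxt c) \<or> d + M < nxt c)"
    using n(5) by auto
  have "d + M < c" if "d \<noteq> nxt c"
  proof -
    have d: "has_nxt (nxt c)" "d = nxt (nxt c) \<or> d + M < nxt c" using IH(3) that by blast+
    \<comment> \<open>The letter of \<open>nxt c\<close> is at least 3 and has a successor two
      letters up. This makes two diagonal steps go back by more than \<open>M\<close>.\<close>
    have "5 \<le> M" using d(1) n(4) letter_pos(1)[of c] unfolding has_nxt_def by linarith
    then show ?thesis using d(2) n(1,3) nxt(1)[OF d(1) n(2)] by linarith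
  qed
  moreover have "d \<le> nxt c" "lt c + 2 \<le> lt d" using IH(3) n(4) by auto
  ultimately show ?case using IH diag_step.hyps(1) n(3) by auto
qed auto

definition same_at :: "nat set \<Rightarrow> nat set \<Rightarrow> nat \<Rightarrow> bool" where
  "same_at w w' e \<longleftrightarrow> (e \<in> w \<longleftrightarrow> e \<in> w') \<and> (e + M \<in> w \<longleftrightarrow> e + M \<in> w') \<and>
     (lt e < M \<longrightarrow> (Suc e \<in> w \<longleftrightarrow> Suc e \<in> w'))"

text \<open>
  A chain is a sequence of rectangles in which neighbours are joined by the bar at \<open>Suc c\<close>. If the
  first one is not blocked, then their union is a single circle.
\<close>

inductive chain :: "nat set \<Rightarrow> nat \<Rightarrow> nat \<Rightarrow> bool" for w where
  chain_end: "c \<in> w \<Longrightarrow> c + M \<in> w \<Longrightarrow> (lt c < M \<Longrightarrow> Suc c \<notin> w) \<Longrightarrow> chain w c c"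
| chain_step: "c \<in> w \<Longrightarrow> c + M \<in> w \<Longrightarrow> Suc c \<in> w \<Longrightarrow> has_nxt c \<Longrightarrow> chain w (nxt c) d \<Longrightarrow> chain w c d"

lemma chain_diag: "chain w c d \<Longrightarrow> diag c d"
  by (induction rule: chain.induct) (auto intro: diag.intros)

lemma chain_last: "chain w c d \<Longrightarrow> c \<in> w \<and> d \<in> w \<and> d + M \<in> w \<and> (lt d < M \<longrightarrow> Suc d \<notin> w)"
  by (induction rule: chain.induct) auto

lemma chain_cong:
  assumes "chain w c d" "\<And>e. diag c e \<Longrightarrow> same_at w w' e"
  shows "chain w' c d"
  using assms
proof (induction rule: chain.induct)
  case (chain_end c)
  then have "same_at w w' c" by (blast intro: diag_refl)
  then show ?case using chain_end by (auto intro!: chain.chain_end simp: same_at_def)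
next
  case (chain_step c d)
  then have "same_at w w' c" by (blast intro: diag_refl)
  moreover have "lt c < M" using chain_step.hyps(4) by (simp add: has_nxt_def)
  moreover have "chain w' (nxt c) d"
    using chain_step.IH chain_step.prems diag_step[OF chain_step.hyps(4)] by blast
  ultimately show ?case using chain_step.hyps by (auto intro!: chain.chain_step simp: same_at_def)
qed

text \<open>In contrast to \<open>chain\<close>, nothing is required at the last window. Starting
  from a barred \<open>c\<close>, these are the windows at which the recursion of \<open>psi\<close>
  inspects bars.\<close>

inductive pchain :: "nat set \<Rightarrow> nat \<Rightarrow> nat \<Rightarrow> bool" for w where
  pchain_refl: "pchain w c c"
| pchain_step: "c \<in> w \<Longrightarrow> c + M \<in> w \<Longrightarrow> Suc c \<in> w \<Longrightarrow> has_nxt c \<Longrightarrow> pchain w (nxt c) d \<Longrightarrow> pchain w c d"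

lemma pchain_diag: "pchain w c d \<Longrightarrow> diag c d"
  by (induction rule: pchain.induct) (auto intro: diag.intros)

text \<open>The recursion looks at a mark only when it arrives at the letter \<open>M\<close>; the
  windows passed on the way then form a chain.\<close>

lemma psi_cong_pchain:
  assumes "1 \<le> c" "c \<in> fst W" "\<And>e. pchain (fst W) c e \<Longrightarrow> same_at (fst W) (fst W') e"
    and "\<And>d. chain (fst W) c d \<Longrightarrow> lt d = M \<Longrightarrow> mk W (d, lt d) = Some Plus \<longleftrightarrow> mk W' (d, lt d) = Some Plus"
  shows "psi W c \<longleftrightarrow> psi W' c"
  using assms
proof (induction c rule: less_induct)
  case (less c)
  have s: "same_at (fst W) (fst W') c" using less.prems(3) pchain_refl by blast
  have l: "lt c < M \<or> lt c = M" using letter_le[of c] by linarith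
  consider "c + M \<notin> fst W" | "c + M \<in> fst W" "lt c = M" | "lt c < M" "Suc c \<notin> fst W"
    | "c + M \<in> fst W" "lt c < M" "Suc c \<in> fst W" using l by blast
  then show ?case
  proof cases
    case 1
    then show ?thesis using psi_0[of c W] psi_0[of c W'] s unfolding same_at_def by blast
  next
    case 2
    then have "chain (fst W) c c" using less.prems(2) by (intro chain_end) auto
    then show ?thesis
      using less.prems(4)[OF _ 2(2)] psi_last[of c W] psi_last[of c W'] s 2 unfolding same_at_def by blast
  next
    case 3
    then show ?thesis using psi_10[of c W] psi_10[of c W'] s unfolding same_at_def by blast
  next
    case 4
    have "psi W (nxt c) \<longleftrightarrow> psi W' (nxt c)" if h: "has_nxt c" "nxt c \<in> fst W"
    proof (rule less.IH)
      show "nxt c < c" "1 \<le> nxt c" by (rule nxt[OF h(1) less.prems(1)])+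
      show "same_at (fst W) (fst W') e" if "pchain (fst W) (nxt c) e" for e
        using less.prems(3) pchain_step[OF less.prems(2) 4(1,3) h(1) that] by blast
      show "mk W (d, lt d) = Some Plus \<longleftrightarrow> mk W' (d, lt d) = Some Plus"
        if "chain (fst W) (nxt c) d" "lt d = M" for d
        using less.prems(4)[OF chain_step[OF less.prems(2) 4(1,3) h(1) that(1)] that(2)] .
    qed (rule h(2))
    moreover have "nxt c \<in> fst W \<longleftrightarrow> nxt c \<in> fst W'" if "has_nxt c"
      using less.prems(3)[OF pchain_step[OF less.prems(2) 4(1,3) that pchain_refl]] unfolding same_at_def by blast
    ultimately show ?thesis using psi_11[of c W] psi_11[of c W'] s 4 unfolding same_at_def by blast
  qed
qed

lemma psi_cong:
  assumes "1 \<le> c" "c \<in> fst W" "\<And>e. diag c e \<Longrightarrow> same_at (fst W) (fst W') e"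
    and "\<And>d. chain (fst W) c d \<Longrightarrow> lt d = M \<Longrightarrow> mk W (d, lt d) = Some Plus \<longleftrightarrow> mk W' (d, lt d) = Some Plus"
  shows "psi W c \<longleftrightarrow> psi W' c"
  using assms pchain_diag psi_cong_pchain by blast

section \<open>How a pair affects the criterion in earlier windows\<close>

lemma corner_not_in_rect: "b < a \<Longrightarrow> (b, x) \<notin> rect a"
  by (simp add: rect_def)

text \<open>The toggled bar \<open>a + M\<close> lies beyond everything that is read from a window
  before \<open>a\<close>, and the marks read there belong to points to the left of the
  rectangle.\<close>

lemma phi_pairA_below:
  assumes p: "pairA a S T" and b: "b < a"
  shows "phi S b \<longleftrightarrow> phi T b"
proof -
  note P = pairA_D[OF p]
  have mem: "e \<in> fst S \<longleftrightarrow> e \<in> fst T" if "e \<noteq> a + M" for e using P(6) that by blast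
  have "psi S b \<longleftrightarrow> psi T b" if bS: "b \<in> fst S"
  proof (rule psi_cong[OF _ bS])
    show b1: "1 \<le> b" using wordD[OF P(5) bS] by blast
    fix e assume "diag b e"
    from diag_pos[OF this b1] have "e \<le> b" "e + M < a + M"
      using b nxt(1,6)[of b] b1 by (auto simp: le_less)
    then show "same_at (fst S) (fst T) e" using b M_pos(1) unfolding same_at_def
      by (intro conjI impI mem) linarith+
  next
    fix d assume d: "chain (fst S) b d"
    have "1 \<le> b" using wordD[OF P(5) bS] by blast
    then have "d < a" using diag_pos[OF chain_diag[OF d]] b by auto
    moreover have "(d, lt d) \<in> points n k" using chain_last[OF d] corner_point[OF _ P(5)] by blast
    ultimately show "mk S (d, lt d) = Some Plus \<longleftrightarrow> mk T (d, lt d) = Some Plus"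
      using pair_mk[of a S T "(d, lt d)"] corner_not_in_rect p unfolding pair_def by metis
  qed
  moreover have "free (fst S) b \<longleftrightarrow> free (fst T) b"
    unfolding free_def using mem[of b] mem[of "b + M - 1"] b by auto
  ultimately show ?thesis unfolding phi_def free_def by blast
qed

lemma diag_nxt_avoid:
  assumes "has_nxt a" "1 \<le> a" "diag (nxt a) e"
  shows "e < a" "e + M \<noteq> Suc a"
proof -
  note n = nxt[OF assms(1,2)]
  from diag_pos[OF assms(3) n(2)]
  have e: "e \<le> nxt a" "e = nxt a \<or> has_nxt (nxt a) \<and> (e = nxt (nxt a) \<or> e + M < nxt a)"
    by auto
  show "e < a" using e(1) n(3) by simp
  show "e + M \<noteq> Suc a"
  proof (cases "e = nxt (nxt a) \<and> has_nxt (nxt a)")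
    case True
    then have "lt a + 4 \<le> M" using n(4) unfolding has_nxt_def by linarith
    then show ?thesis using True nxt(1)[of "nxt a"] n(1,2,3) letter_pos(1)[of a] by linarith
  next
    case False
    then show ?thesis using e(2) n(1,3) by auto
  qed
qed

lemma psi_pairB_nxt:
  assumes p: "pairB a S T" and h: "has_nxt a" "nxt a \<in> fst S"
  shows "psi S (nxt a) \<longleftrightarrow> psi T (nxt a)"
proof (rule psi_cong[OF _ h(2)])
  note P = pairB_D[OF p]
  note n = nxt[OF h(1) P(10)]
  show b1: "1 \<le> nxt a" by (rule n(2))
  have mem: "e \<in> fst S \<longleftrightarrow> e \<in> fst T" if "e \<noteq> Suc a" for e using P(6) that by blast
  fix e assume "diag (nxt a) e"
  from diag_nxt_avoid[OF h(1) P(10) this]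
  show "same_at (fst S) (fst T) e" unfolding same_at_def
    by (intro conjI impI mem) auto
next
  note P = pairB_D[OF p]
  note n = nxt[OF h(1) P(10)]
  fix d assume d: "chain (fst S) (nxt a) d"
  have "d < a" using diag_pos[OF chain_diag[OF d] n(2)] n(3) by auto
  moreover have "(d, lt d) \<in> points n k" using chain_last[OF d] corner_point[OF _ P(5)] by blast
  ultimately show "mk S (d, lt d) = Some Plus \<longleftrightarrow> mk T (d, lt d) = Some Plus"
    using pair_mk[of a S T "(d, lt d)"] corner_not_in_rect p unfolding pair_def by metis
qed

text \<open>The toggled bar \<open>Suc a\<close> could be read at an earlier window \<open>b\<close>
  as its end, as its blocking bar, or deeper in the recursion. Each case other than the blocking of
  \<open>nxt a\<close> is ruled out by a letter or by a bar that is present.\<close>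

lemma phi_pairB_below:
  assumes p: "pairB a S T" and b: "b < a" "\<not> (has_nxt a \<and> b = nxt a)"
  shows "phi S b \<longleftrightarrow> phi T b"
proof -
  note P = pairB_D[OF p]
  have mem: "e \<in> fst S \<longleftrightarrow> e \<in> fst T" if "e \<noteq> Suc a" for e using P(6) that by blast
  have bmem: "b \<in> fst S \<longleftrightarrow> b \<in> fst T" using mem b by simp
  have lz: "lt (Suc a) = Suc (lt a)" using letter_Suc[of a] P(8,10) by simp
  show ?thesis
  proof (cases "b \<in> fst S")
    case False
    then show ?thesis using bmem unfolding phi_def free_def by blast
  next
    case bS: True
    have b1: "1 \<le> b" using wordD[OF P(5) bS] by blast
    consider (y) "b + M = Suc a" | (ya) "b + M \<noteq> Suc a" "Suc b = a" | (x) "Suc b \<noteq> a" "b + M - 1 = Suc a"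
      | (other) "b + M \<noteq> Suc a" "Suc b \<noteq> a" "b + M - 1 \<noteq> Suc a" by blast
    then show ?thesis
    proof cases
      \<comment> \<open>Here \<open>a\<close> itself is the bar that blocks the window at
        \<open>b\<close>, before and after.\<close>
      case y
      then have "lt b = Suc (lt a)" using letter_period[OF b1] lz by simp
      then have "2 \<le> lt b" using letter_pos(1)[of a] by linarith
      moreover have "b + M - 1 = a" using y by simp
      ultimately show ?thesis using P(6,14) unfolding phi_def free_def by auto
    next
      \<comment> \<open>The recursion from \<open>b\<close> would lead to \<open>nxt b\<close>,
        whose end \<open>nxt b + M\<close> is the toggled bar. It is not taken: \<open>b + M\<close>
        is the position kept unbarred by the freeness of \<open>a\<close>, or \<open>b\<close> has
        the letter \<open>M\<close>.\<close>
      case ya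
      have yS: "b + M \<notin> fst S \<and> b + M \<notin> fst T" if "2 \<le> lt a"
      proof -
        have "b + M = a + M - 1" using ya by simp
        then show ?thesis using P(12,13) that unfolding free_def by simp
      qed
      have "psi S b \<longleftrightarrow> psi T b"
      proof (cases "2 \<le> lt a")
        case True
        then show ?thesis using psi_0[of b S] psi_0[of b T] yS mem[of "Suc b"] ya by simp
      next
        case False
        have "lt b = M"
        proof (rule ccontr)
          assume "lt b \<noteq> M"
          then have "lt b < M" using letter_le[of b] by linarith
          then have "lt a = Suc (lt b)" using letter_Suc[OF b1] ya by simp
          then show False using False letter_pos(1)[of b] by linarith
        qed
        then show ?thesis
        proof (cases "b + M \<in> fst S")
          case True
          have "mk S (b, lt b) = mk T (b, lt b)"
            using pair_mk[of a S T] corner_not_in_rect[OF b(1)] corner_point[OF bS P(5)] p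
            unfolding pair_def by blast
          then show ?thesis using psi_last[of b S] psi_last[of b T] True mem[OF ya(1)] \<open>lt b = M\<close> by simp
        next
          case False
          then show ?thesis using psi_0[of b S] psi_0[of b T] mem[OF ya(1)] \<open>lt b = M\<close> by simp
        qed
      qed
      moreover have "free (fst S) b \<longleftrightarrow> free (fst T) b"
      proof (cases "2 \<le> lt b \<and> b + M - 1 = Suc a")
        case True
        \<comment> \<open>Only for this width does the toggled bar also block \<open>b\<close>. The
          letter 3 at \<open>b\<close> gives \<open>b = nxt a\<close>, which is excluded; the letter
          2 gives \<open>lt a = M\<close>.\<close>
        then have "M = 3" using ya by linarith
        moreover have "lt b \<noteq> M"
        proof
          assume "lt b = M"
          then have "lt a = 1" using letter_Suc[OF b1] ya by simp
          then have "has_nxt a" unfolding has_nxt_def using \<open>M = 3\<close> b1 ya by simp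
          moreover from this have "nxt a + M = a + 2" using nxt(1) P(10) by blast
          then have "nxt a = b" using \<open>M = 3\<close> ya by linarith
          ultimately show False using b(2) by blast
        qed
        then have "lt b < M" using letter_le[of b] by linarith
        then have "lt a = Suc (lt b)" using letter_Suc[OF b1] ya by simp
        then have "lt a = M" using True \<open>M = 3\<close> letter_le[of a] by linarith
        then show ?thesis using P(8) by simp
      next
        case False
        then show ?thesis unfolding free_def using bmem mem[of "b + M - 1"] by blast
      qed
      ultimately show ?thesis unfolding phi_def by blast
    next
      \<comment> \<open>The toggled bar is in blocking position, so \<open>b\<close> is
        \<open>nxt a\<close> unless its letter is 1, and the letter 1 has no blocking bar.\<close>
      case x
      have e: "b + M = a + 2" using x(2) by linarith
      have nf: "\<not> 2 \<le> lt b"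
      proof
        assume l2: "2 \<le> lt b"
        have "lt a + 2 \<le> M"
        proof (rule ccontr)
          assume "\<not> ?thesis"
          then have "lt (Suc a) = M" using lz P(8) by linarith
          then have "lt (Suc (Suc a)) = 1" using letter_Suc[of "Suc a"] by simp
          then have "lt b = 1" using letter_period[OF b1] e by simp
          then show False using l2 by simp
        qed
        moreover have "M \<le> Suc a" using e b1 by linarith
        ultimately show False using b(2) e unfolding has_nxt_def nxt_def by linarith
      qed
      have "psi S b \<longleftrightarrow> psi T b"
      proof (rule psi_cong[OF b1 bS])
        fix d assume "diag b d"
        from diag_pos[OF this b1] have d: "d = b \<or> d < b \<and> has_nxt b \<and> (d = nxt b \<or> d + M < b)" by auto
        have "d + M \<noteq> Suc a" using d nxt(1)[OF _ b1] b(1) e x(1) by auto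
        moreover have "d \<le> b" using d by auto
        ultimately show "same_at (fst S) (fst T) d" using b(1) unfolding same_at_def
          by (intro conjI impI mem) linarith+
      next
        fix d assume d: "chain (fst S) b d"
        have "d < a" using diag_pos[OF chain_diag[OF d] b1] b(1) by auto
        moreover have "(d, lt d) \<in> points n k" using chain_last[OF d] corner_point[OF _ P(5)] by blast
        ultimately show "mk S (d, lt d) = Some Plus \<longleftrightarrow> mk T (d, lt d) = Some Plus"
          using pair_mk[of a S T "(d, lt d)"] corner_not_in_rect p unfolding pair_def by metis
      qed
      then show ?thesis using nf bmem unfolding phi_def free_def by blast
    next
      case other
      have "psi S b \<longleftrightarrow> psi T b"
      proof (rule psi_cong[OF b1 bS])
        fix d assume "diag b d"
        from diag_pos[OF this b1] have d: "d = b \<or> d < b \<and> has_nxt b \<and> (d = nxt b \<or> d + M < b)" by auto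
        have "d + M \<noteq> Suc a" using d nxt(1)[OF _ b1] b(1) other(1,2) by auto
        moreover have "d \<le> b" using d by auto
        ultimately show "same_at (fst S) (fst T) d" using b(1) unfolding same_at_def
          by (intro conjI impI mem) linarith+
      next
        fix d assume d: "chain (fst S) b d"
        have "d < a" using diag_pos[OF chain_diag[OF d] b1] b(1) by auto
        moreover have "(d, lt d) \<in> points n k" using chain_last[OF d] corner_point[OF _ P(5)] by blast
        ultimately show "mk S (d, lt d) = Some Plus \<longleftrightarrow> mk T (d, lt d) = Some Plus"
          using pair_mk[of a S T "(d, lt d)"] corner_not_in_rect p unfolding pair_def by metis
      qed
      then show ?thesis using bmem mem[OF other(3)] unfolding phi_def free_def by blast
    qed
  qed
qed

text \<open>\<open>Suc a\<close> is the position \<open>nxt a + M - 1\<close> that must be unbarred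
  for \<open>nxt a\<close> to be free. Thus the target is blocked there, while for the source only
  \<open>psi\<close> remains, which does not see the bar.\<close>

lemma phi_pairB_nxt:
  assumes p: "pairB a S T" and h: "has_nxt a"
  shows "\<not> phi T (nxt a)" "phi S (nxt a) \<longleftrightarrow> nxt a \<in> fst S \<and> psi T (nxt a)" "nxt a \<in> fst S \<longleftrightarrow> nxt a \<in> fst T"
proof -
  note P = pairB_D[OF p]
  note n = nxt[OF h P(10)]
  show "\<not> phi T (nxt a)" using n(8,9) P(6) unfolding phi_def free_def by auto
  show "nxt a \<in> fst S \<longleftrightarrow> nxt a \<in> fst T" using P(6) n(3) by auto
  have "nxt a + M \<le> N" using n(1,6) P(11) by linarith
  then show "phi S (nxt a) \<longleftrightarrow> nxt a \<in> fst S \<and> psi T (nxt a)"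
    using psi_pairB_nxt[OF p h] n(8,9) P(16) unfolding phi_def free_def by auto
qed

lemma phi_pair_below:
  assumes "pair a S T" "\<forall>b<a. \<not> phi S b"
  shows "\<forall>b<a. \<not> phi T b"
  using assms phi_pairA_below[of a S T] phi_pairB_below[of a S T] phi_pairB_nxt(1)[of a S T]
  unfolding pair_def by metis

lemma phi_source:
  assumes "pair a S T"
  shows "phi S a"
proof -
  consider "pairA a S T" | "pairB a S T" using assms unfolding pair_def by blast
  then show ?thesis
  proof cases
    case 1
    note P = pairA_D[OF 1]
    have "psi S a" unfolding psi_0[OF P(13)] using P(14) by blast
    then show ?thesis using P(10,11) unfolding phi_def by blast
  next
    case 2
    note P = pairB_D[OF 2]
    show ?thesis using psi_10[OF P(16,8)] P(11,12) unfolding phi_def by blast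
  qed
qed

lemma phi_circ_Minus:
  assumes "circ (fst T) a" "word (fst T)" "mk T (a, lt a) = Some Minus"
  shows "phi T a"
proof -
  note c = circD[OF assms(1,2)]
  have "psi T a"
  proof (cases "lt a < M")
    case True
    then show ?thesis using psi_10 c(7) by blast
  next
    case False
    then have "lt a = M" using letter_le[of a] by linarith
    then show ?thesis using psi_last[OF c(5)] assms(3) by simp
  qed
  then show ?thesis using c unfolding phi_def by blast
qed

text \<open>For G2 the negation in the recursion is used: the source is unmatched at
  \<open>nxt a\<close>, so \<open>psi\<close> fails there also for the target.\<close>

lemma phi_target:
  assumes "pair a S T" "\<forall>b<a. \<not> phi S b"
  shows "phi T a"
proof -
  consider "pairA a S T" | "pairB a S T" using assms unfolding pair_def by blast
  then show ?thesis
  proof cases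
    case 1
    then show ?thesis using phi_circ_Minus pairA_D(3,4,8) by blast
  next
    case 2
    note P = pairB_D[OF 2]
    have y: "a + M \<in> fst T" "Suc a \<in> fst T" using P(6,15) by auto
    have "\<not> (has_nxt a \<and> nxt a \<in> fst T \<and> psi T (nxt a))"
      using phi_pairB_nxt(2,3)[OF 2] nxt(3)[OF _ P(10)] assms(2) by blast
    then have "psi T a" using psi_11[OF y P(8)] by blast
    then show ?thesis using P(11,13) unfolding phi_def by blast
  qed
qed

text \<open>Strong induction over windows. Where \<open>phi\<close> holds and the state is not a
  source, its partner \<open>R\<close> in the window is constructed; since \<open>phi\<close> agrees
  in the earlier windows, the induction hypothesis shows that \<open>R\<close> is matched in none of
  them, so its scan reaches this window.\<close>

lemma matched_iff_phi:
  assumes "W \<in> ES" "\<forall>b<c. \<not> phi W b"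
  shows "source_at c W \<or> target_at c W \<longleftrightarrow> phi W c"
  using assms
proof (induction c arbitrary: W rule: less_induct)
  case (less c W)
  note IH = less.IH
  have IH1: "\<forall>b<c. \<not> source_at b R \<and> \<not> target_at b R" if "R \<in> ES" "\<forall>b<c. \<not> phi R b" for R
    using less.IH[OF _ that(1)] that(2) by (meson less_trans)
  have IH2: "\<forall>b<c. \<not> phi R b" if R: "R \<in> ES" "\<forall>b<c. \<not> source_at b R \<and> \<not> target_at b R" for R
  proof (intro allI impI)
    fix b assume "b < c"
    then show "\<not> phi R b"
    proof (induction b rule: less_induct)
      case (less b)
      then have "\<forall>b'<b. \<not> phi R b'" by simp
      then show ?case using IH[OF less.prems R(1)] R(2) less.prems by blast
    qed
  qed
  show ?case
  proof
    assume "source_at c W \<or> target_at c W"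
    then show "phi W c"
    proof
      assume "source_at c W"
      then show ?thesis using phi_source unfolding source_at_def by blast
    next
      assume "target_at c W"
      then obtain R where R: "(R, W) \<in> \<G>" "pair c R W" unfolding target_at_def by blast
      then obtain a where a: "pair a R W" "\<forall>b<a. \<not> source_at b R \<and> \<not> target_at b R"
        using distinguished_iff by blast
      have "a = c" by (rule pair_window_unique[OF a(1) R(2)])
      then show ?thesis using phi_target[OF R(2)] IH2[of R] a pair_D(1)[OF R(2)] by blast
    qed
  next
    assume ph: "phi W c"
    then have f: "free (fst W) c" "c + M \<le> N" "psi W c" unfolding phi_def by blast+
    have w: "word (fst W)" by (rule ES_word[OF less.prems(1)])
    have minus: "source_at c W \<or> target_at c W" if c: "circ (fst W) c" and m: "mk W (c, lt c) = Some Minus"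
    proof -
      obtain R where R: "pairA c R W" using pairA_target_exists[OF less.prems(1) c m] by blast
      note P = pairA_D[OF R]
      have "\<forall>b<c. \<not> phi R b" using phi_pairA_below[OF R] less.prems(2) by blast
      then have "\<forall>b<c. \<not> source_at b R \<and> \<not> target_at b R" by (rule IH1[OF P(1)])
      moreover have "\<not> target_at c R"
      proof
        assume "target_at c R"
        then obtain Q where "pair c Q R" unfolding target_at_def by blast
        then have "c + M \<in> fst R"
          using pairA_D(7)[of c Q R] pairB_D(6,15)[of c Q R] unfolding pair_def by auto
        then show False using P(13) by blast
      qed
      ultimately have "(R, W) \<in> \<G>" using R unfolding distinguished_iff pair_def by blast
      then show ?thesis using R unfolding target_at_def pair_def by blast
    qed
    have closed: "mk W (c, lt c) \<noteq> None" if c: "circ (fst W) c"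
      using mk_None[OF less.prems(1) corner_point[OF circD(4)[OF c w] w]] rect_closed[OF c w]
        comp_rect[OF c w] by simp
    have mm: "mk W (c, lt c) = Some Plus \<or> mk W (c, lt c) = Some Minus" if "circ (fst W) c"
      using closed[OF that] by (metis mark.exhaust option.exhaust)
    have l: "lt c < M \<or> lt c = M" using letter_le[of c] by linarith
    consider "c + M \<notin> fst W" | "c + M \<in> fst W" "lt c = M"
      | "c + M \<in> fst W" "lt c < M" "Suc c \<notin> fst W" | "c + M \<in> fst W" "lt c < M" "Suc c \<in> fst W"
      using l by blast
    then show "source_at c W \<or> target_at c W"
    proof cases
      case 1
      then show ?thesis using pairA_source_exists[OF less.prems(1) f(1) 1 f(2)] f(3) psi_0[OF 1]
        unfolding source_at_def pair_def by blast
    next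
      case 2
      then have c: "circ (fst W) c" using f(1) unfolding circ_def by simp
      then show ?thesis using minus mm psi_last[OF 2] f(3) by blast
    next
      case 3
      then have c: "circ (fst W) c" using f(1) unfolding circ_def by simp
      show ?thesis
      proof (cases "mk W (c, lt c) = Some Minus")
        case False
        then have "mk W (c, lt c) = Some Plus" using mm[OF c] by blast
        then show ?thesis using pairB_source_exists[OF less.prems(1) c 3(2)]
          unfolding source_at_def pair_def by blast
      qed (rule minus[OF c])
    next
      case 4
      obtain R where R: "pairB c R W"
        using pairB_target_exists[OF less.prems(1) f(1) 4(1,3,2)] by blast
      note P = pairB_D[OF R]
      have "\<not> (has_nxt c \<and> nxt c \<in> fst W \<and> psi W (nxt c))" using psi_11[OF 4(1,3,2)] f(3) by blast
      then have "\<forall>b<c. \<not> phi R b"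
        using phi_pairB_below[OF R] phi_pairB_nxt(2,3)[OF R] less.prems(2) by blast
      then have "\<forall>b<c. \<not> source_at b R \<and> \<not> target_at b R" by (rule IH1[OF P(1)])
      \<comment> \<open>In \<open>R\<close> the circle is marked \<open>Plus\<close> and
        \<open>Suc c\<close> is unbarred, whereas a G1 target has a \<open>Minus\<close> circle and
        a G2 target has the bar.\<close>
      moreover have "\<not> target_at c R"
      proof
        assume "target_at c R"
        then obtain Q where "pair c Q R" unfolding target_at_def by blast
        then have "mk R (c, lt c) = Some Minus \<or> Suc c \<in> fst R"
          using pairA_D(8)[of c Q R] pairB_D(6)[of c Q R] unfolding pair_def by auto
        then show False using P(9,16) by auto
      qed
      ultimately have "(R, W) \<in> \<G>" using R unfolding distinguished_iff pair_def by blast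
      then show ?thesis using R unfolding target_at_def pair_def by blast
    qed
  qed
qed

lemma distinguished_phi:
  assumes "(S, T) \<in> \<G>"
  obtains a where "pair a S T" "\<forall>b<a. \<not> phi S b" "phi S a" "\<forall>b<a. \<not> phi T b" "phi T a"
proof -
  obtain a where a: "pair a S T" "\<forall>b<a. \<not> source_at b S \<and> \<not> target_at b S"
    using assms distinguished_iff by blast
  have "\<not> phi S b" if "b < a" for b
    using that
  proof (induction b rule: less_induct)
    case (less b)
    then have "\<forall>b'<b. \<not> phi S b'" by simp
    then show ?case using matched_iff_phi[OF pair_D(1)[OF a(1)]] a(2) less.prems by blast
  qed
  then show thesis using that[OF a(1)] phi_source phi_target phi_pair_below a(1) by blast
qed

section \<open>Chains of rectangles\<close>

lemma diag_nxt_same_at: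
  assumes "has_nxt c" "1 \<le> c" "diag (nxt c) e"
  shows "same_at w (w - {Suc c}) e" "same_at w (insert (Suc c) w) e"
  using diag_nxt_avoid[OF assms] unfolding same_at_def by auto

text \<open>After \<open>nxt c\<close> the lower strand of its rectangle is first met by the
  crossing at \<open>Suc c\<close>, so it is straight up to level \<open>c\<close>.\<close>

lemma nxt_strand:
  assumes "has_nxt c" "1 \<le> c" "c \<le> N"
  shows "(c, lt c + 2) \<in> comp w (nxt c, lt (nxt c))"
proof -
  note n = nxt[OF assms(1,2)]
  have "(c, lt (nxt c)) \<in> comp w (nxt c, lt (nxt c))"
  proof (rule comp_strand)
    fix p assume p: "nxt c < p" "p \<le> c" "p \<in> w"
    have "p < nxt c + M" "p \<noteq> nxt c + M - 1" using p(2) n(1,8) by linarith+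
    then show "lt (nxt c) \<noteq> lt p \<and> lt (nxt c) \<noteq> Suc (lt p)"
      using letter_between[OF n(2) p(1)] by auto
  qed (use n assms letter_pos[of "nxt c"] in auto)
  then show ?thesis using n(4) by simp
qed

lemma chain_conn: "chain w c d \<Longrightarrow> word w \<Longrightarrow> (d, lt d) \<in> comp w (c, lt c)"
proof (induction rule: chain.induct)
  case (chain_step c d)
  have c: "1 \<le> c" "c \<le> N" "Suc c \<le> N"
    using wordD[OF chain_step.prems chain_step.hyps(1)] wordD[OF chain_step.prems chain_step.hyps(3)] by auto
  have lz: "lt (Suc c) = Suc (lt c)" using letter_Suc[OF c(1)] nxt(7)[OF chain_step.hyps(4) c(1)] by simp
  have 1: "(c, Suc (lt c)) \<in> comp w (c, lt c)" by (rule comp_right[OF c(1,2) chain_step.hyps(1)])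
  have 2: "(c, lt c + 2) \<in> comp w (c, Suc (lt c))"
    using comp_left[of "Suc c" w] c(3) chain_step.hyps(3) lz by simp
  have 3: "(nxt c, lt (nxt c)) \<in> comp w (c, lt c + 2)"
    by (rule comp_sym[OF nxt_strand[OF chain_step.hyps(4) c(1,2)]])
  show ?case
    by (rule comp_trans[OF comp_trans[OF comp_trans[OF 1 2] 3] chain_step.IH[OF chain_step.prems]])
qed simp

text \<open>The letter \<open>M\<close> has no letter above it, so further bars cannot destroy the
  condition at the end.\<close>

lemma chain_mono:
  "chain w c d \<Longrightarrow> lt d = M \<Longrightarrow> w \<subseteq> w' \<Longrightarrow> chain w' c d"
proof (induction rule: chain.induct)
  case (chain_end c)
  have "c \<in> w'" "c + M \<in> w'" using chain_end.hyps(1,2) chain_end.prems(2) by blast+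
  then show ?case by (rule chain.chain_end) (use chain_end.prems(1) in simp)
next
  case (chain_step c d)
  have "c \<in> w'" "c + M \<in> w'" "Suc c \<in> w'" using chain_step.hyps(1-3) chain_step.prems(2) by blast+
  then show ?case by (rule chain.chain_step) (fact chain_step.hyps(4), rule chain_step.IH[OF chain_step.prems])
qed

text \<open>The bar joining a rectangle to its predecessor is the bar that blocks its
  window.\<close>

lemma chain_not_free:
  "chain w c d \<Longrightarrow> word w \<Longrightarrow> d \<noteq> c \<Longrightarrow> \<not> free w d"
proof (induction rule: chain.induct)
  case (chain_step c d)
  show ?case
  proof (cases "d = nxt c")
    case True
    have "1 \<le> c" using wordD[OF chain_step.prems(1) chain_step.hyps(1)] by blast
    note n = nxt[OF chain_step.hyps(4) this]
    show ?thesis using n(8,9) chain_step.hyps(3) True unfolding free_def by simp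
  qed (use chain_step in blast)
qed blast

text \<open>By induction, cutting the first rectangle off. The tail could be touched at
  \<open>nxt c + M - 1\<close>, but this is \<open>Suc c\<close>, which is barred; so only the two
  outer ends of the chain remain exposed.\<close>

lemma chain_comp:
  assumes "chain w c d" "free w c" "word w"
  shows "comp w (c, lt c) \<in> closed w \<and> (\<forall>(l, x) \<in> comp w (c, lt c). lt c \<le> x) \<and>
    (\<forall>p\<ge>1. p \<notin> w \<longrightarrow> touches n p (comp w (c, lt c)) \<longrightarrow>
      2 \<le> lt c \<and> p = c + M - 1 \<or> lt d < M \<and> p = Suc d)"
  using assms
proof (induction c arbitrary: w rule: less_induct)
  case (less c)
  have cw: "c \<in> w" using chain_last[OF less.prems(1)] by blast
  have c1: "1 \<le> c" "c \<le> N" using wordD[OF less.prems(3) cw] by auto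
  have touch: "2 \<le> lt c \<and> p = c + M - 1" if "p \<ge> 1" "p \<notin> w" "touches n p (rect c)" "c + M \<in> w"
      "\<not> (lt c < M \<and> p = Suc c)" for p
    using touches_rect[OF that(3) c1(1) that(1)] that cw by blast
  from less.prems(1) show ?case
  proof (cases rule: chain.cases)
    case chain_end
    then have c: "circ w c" using less.prems(2) unfolding circ_def by blast
    note r = comp_rect[OF c less.prems(3)]
    have "\<forall>(l, x) \<in> rect c. lt c \<le> x" by (auto simp: rect_def)
    moreover have "2 \<le> lt c \<and> p = c + M - 1 \<or> lt d < M \<and> p = Suc d"
      if "p \<ge> 1" "p \<notin> w" "touches n p (rect c)" for p
      using touch[OF that chain_end(3)] chain_end(1) by blast
    ultimately show ?thesis using rect_closed[OF c less.prems(3)] unfolding r by blast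
  next
    case chain_step
    note n = nxt[OF chain_step(4) c1(1)]
    \<comment> \<open>Without the joining bar the first rectangle is a circle of its own, and the
      tail becomes free, as the induction hypothesis demands.\<close>
    define R where "R = w - {Suc c}"
    have wR: "w = insert (Suc c) R" using chain_step(3) R_def by blast
    have RW: "word R" using less.prems(3) R_def by blast
    have "free R c" using less.prems(2) unfolding R_def free_def by auto
    moreover have "c + M \<in> R" using chain_step(2) n(6) R_def by simp
    ultimately have cR: "circ R c" unfolding circ_def R_def by blast
    have cl: "clasp R c w (Suc c, Suc (Suc (lt c)))"
      unfolding clasp_def using cR RW less.prems(3) wR n(7) by blast
    have chR: "chain R (nxt c) d"
      using chain_cong[OF chain_step(5)] diag_nxt_same_at(1)[OF chain_step(4) c1(1)] R_def by blast
    have "nxt c \<in> R" using chain_last[OF chR] by blast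
    then have fR: "free R (nxt c)" using n(8) R_def unfolding free_def by simp
    note IH = less.IH[OF n(3) chR fR RW]
    have "(Suc c, lt (nxt c)) \<in> comp R (nxt c, lt (nxt c))"
      using low_strand_comp[OF fR n(2), of "Suc c"] n(1,3,6) circD(3)[OF cR RW] by simp
    then have X: "comp R (Suc c, Suc (Suc (lt c))) = comp R (nxt c, lt (nxt c))"
      using comp_eqI n(4) by simp
    have e: "comp w (c, lt c) = rect c \<union> comp R (nxt c, lt (nxt c))"
      using comp_clasp(1)[OF cl, of "(c, lt c)"] X by simp
    have e': "comp w (Suc c, Suc (Suc (lt c))) = rect c \<union> comp R (nxt c, lt (nxt c))"
      using comp_clasp(1)[OF cl UnI2[OF comp_refl]] X by simp
    have "comp w (c, lt c) \<in> closed w"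
      using clasp_closed[OF cl clasp_base(2,1)[OF cl]] IH unfolding X e e' by blast
    moreover have "\<forall>(l, x) \<in> comp w (c, lt c). lt c \<le> x"
      using IH n(4) unfolding e by (auto simp: rect_def)
    moreover have "2 \<le> lt c \<and> p = c + M - 1 \<or> lt d < M \<and> p = Suc d"
      if p: "p \<ge> 1" "p \<notin> w" "touches n p (comp w (c, lt c))" for p
    proof -
      from p(3) consider "touches n p (rect c)" | "touches n p (comp R (nxt c, lt (nxt c)))"
        unfolding e touches_iff by blast
      then show ?thesis
      proof cases
        case 1
        then show ?thesis using touch[OF p(1,2)] chain_step(2,3) p(2) by blast
      next
        case 2
        have "p \<notin> R" using p(2) wR by blast
        then have "p = nxt c + M - 1 \<or> lt d < M \<and> p = Suc d" using IH p(1) 2 by blast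
        then show ?thesis using n(8) p(2) chain_step(3) by auto
      qed
    qed
    ultimately show ?thesis by blast
  qed
qed

section \<open>Components of the differential\<close>

definition edge_at :: "nat \<Rightarrow> enhanced_state \<Rightarrow> enhanced_state \<Rightarrow> bool" where
  "edge_at p S T \<longleftrightarrow> S \<in> ES \<and> T \<in> ES \<and> p \<notin> fst S \<and> fst T = insert p (fst S) \<and>
     (\<forall>C \<in> closed (fst S) \<union> closed (fst T). \<not> touches n p C \<longrightarrow> snd S C = snd T C) \<and>
     crossing_cobordism n k p S T \<noteq> None"

lemma edge_exists:
  assumes "differential n k S T \<noteq> 0"
  obtains p where "edge_at p S T"
proof -
  obtain s \<epsilon> t \<delta> where ST: "S = (s, \<epsilon>)" "T = (t, \<delta>)" by (metis surj_pair)
  have 1: "(s, \<epsilon>) \<in> ES \<and> (t, \<delta>) \<in> ES \<and> (\<exists>p. p \<notin> s \<and> t = insert p s)"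
    using assms unfolding ST differential.simps by (metis (no_types, lifting))
  then obtain p where p: "p \<notin> s" "t = insert p s" by blast
  have e: "the_elem (t - s) = p" using p by (simp add: insert_Diff_if)
  have "edge_at p S T"
    using assms 1 p unfolding ST differential.simps Let_def e edge_at_def
    by (auto split: if_splits option.splits)
  then show thesis by (rule that)
qed

lemma edge_D:
  assumes "edge_at p S T"
  shows "S \<in> ES" "T \<in> ES" "word (fst S)" "word (fst T)" "p \<notin> fst S" "fst T = insert p (fst S)" "1 \<le> p" "p \<le> N"
proof -
  show *: "S \<in> ES" "T \<in> ES" "p \<notin> fst S" "fst T = insert p (fst S)"
    using assms unfolding edge_at_def by blast+
  show "word (fst S)" "word (fst T)" by (rule ES_word[OF *(1)], rule ES_word[OF *(2)])
  then show "1 \<le> p" "p \<le> N" using *(4) by auto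
qed

lemma edge_mk:
  assumes "edge_at p S T" "u \<in> points n k" "\<not> touches n p (comp (fst S) u)"
  shows "mk T u = mk S u"
proof -
  note E = edge_D[OF assms(1)]
  have c: "comp (fst T) u = comp (fst S) u"
    unfolding E(6) by (rule comp_insert_untouched[OF E(5) assms(3)])
  show ?thesis
  proof (cases "comp (fst S) u \<in> closed (fst S)")
    case True
    then show ?thesis using assms c unfolding edge_at_def mk_def by auto
  next
    case False
    then have "comp (fst T) u \<notin> closed (fst T)" using closed_comp_iff[OF assms(2), of "fst S"] closed_comp_iff[OF assms(2), of "fst T"] c by simp
    then show ?thesis using False mk_None[OF E(1) assms(2)] mk_None[OF E(2) assms(2)] by simp
  qed
qed

lemma crossing_unfold:
  "crossing_cobordism n k p S T =
     (let A = comp (fst S) (p - 1, lt p); B = comp (fst S) (p - 1, Suc (lt p));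
        L = comp (fst T) (p - 1, lt p); R = comp (fst T) (p, lt p)
      in if A \<noteq> B then merge_cobordism (snd S A) (snd S B) (snd T L) L
         else split_cobordism (snd S A) (snd T L) (snd T R) L R)"
  using crossing_cobordism.simps[of n k p "fst S" "snd S" "fst T" "snd T"] by (simp only: prod.collapse Let_def)

lemma corner_right: "(a + M - 1, lt a) \<in> rect a" "(a + M - 1, Suc (lt a)) \<in> rect a"
proof -
  have "a \<le> a + M - 1" "a + M - 1 < a + M" using M_pos(1) by linarith+
  then show "(a + M - 1, lt a) \<in> rect a" "(a + M - 1, Suc (lt a)) \<in> rect a"
    by (simp_all only: rect_def mem_Sigma_iff atLeastLessThan_iff insert_iff simp_thms)
qed

section \<open>Edges that toggle a bar of a window\<close>

lemma split_Minus:
  assumes "split_cobordism x (Some Minus) y D E \<noteq> None"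
  shows "y = x"
proof (cases x)
  case None
  then show ?thesis
    using assms by (cases y; cases "the y") (simp_all add: split_cobordism_def)
next
  case (Some x')
  then show ?thesis
    using assms by (cases x'; cases y; cases "the y") (simp_all add: split_cobordism_def)
qed

text \<open>\<open>Plus\<close> is the unit of the merge. Dually, in \<open>split_Minus\<close> a
  piece marked \<open>Minus\<close> leaves the old mark to the other piece.\<close>

lemma merge_Plus:
  assumes "merge_cobordism (Some Plus) (Some x) y D \<noteq> None"
  shows "y = Some x"
  using assms by (cases x) (simp_all add: merge_cobordism_def split: if_splits)

text \<open>Splitting off the rectangle with mark \<open>Minus\<close> passes the mark of the joined
  component on to the rest, and everything else is untouched. So the target is determined by
  \<open>S\<close>.\<close>

lemma own_A:
  assumes p: "pairA a S T" and e: "edge_at (a + M) S T'" and m: "mk T' (a, lt a) = Some Minus"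
  shows "T' = T"
proof -
  note P = pairA_D[OF p] and E = edge_D[OF e]
  have tt: "fst T' = fst T" using P(7) E(6) by simp
  let ?u = "(a + M, lt a)"
  note cl = pairA_clasp[OF p]
  let ?X = "comp (fst T) ?u"
  have l: "lt (a + M) = lt a" using letter_period P(9) by simp
  have ru: "(a + M - 1, lt a) \<in> rect a" "(a + M - 1, Suc (lt a)) \<in> rect a" by (rule corner_right)+
  have cs: "comp (fst S) (a + M - 1, lt a) = rect a \<union> ?X" "comp (fst S) (a + M - 1, Suc (lt a)) = rect a \<union> ?X"
    by (rule comp_clasp(1)[OF cl UnI1[OF ru(1)]], rule comp_clasp(1)[OF cl UnI1[OF ru(2)]])
  have L: "comp (fst T) (a + M - 1, lt a) = rect a" by (rule comp_rect_mem[OF P(3,4) ru(1)])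
  have mr: "snd T' (rect a) = Some Minus" using m comp_rect[OF P(3,4)] tt unfolding mk_def by simp
  have "crossing_cobordism n k (a + M) S T' \<noteq> None" using e unfolding edge_at_def by blast
  then have cc: "split_cobordism (snd S (rect a \<union> ?X)) (Some Minus) (snd T' ?X) (rect a) ?X \<noteq> None"
    unfolding crossing_unfold Let_def l tt cs L mr by simp
  have eq: "snd T' ?X = snd S (rect a \<union> ?X)" by (rule split_Minus[OF cc])
  have ag: "agree_off a T' S" unfolding agree_off_def
  proof (intro ballI impI)
    fix v assume v: "v \<in> points n k" "v \<notin> rect a"
    show "mk T' v = mk S v"
    proof (cases "v \<in> ?X")
      case True
      then show ?thesis using comp_clasp(1)[OF cl, of v] comp_eqI[OF True] eq tt unfolding mk_def by simp
    next
      case False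
      have nm: "x \<notin> comp (fst S) v" if "x \<in> rect a \<union> ?X" for x
      proof
        assume "x \<in> comp (fst S) v"
        then have "v \<in> comp (fst S) x" by (rule comp_sym)
        then have "v \<in> rect a \<union> ?X" unfolding comp_clasp(1)[OF cl that] .
        then show False using False v by blast
      qed
      have "(a + M, Suc (lt a)) \<in> ?X"
        using comp_right[of "a + M" "fst T"] P(7,9,10) l by simp
      from nm[OF UnI1[OF ru(1)]] nm[OF UnI1[OF ru(2)]] nm[OF UnI2[OF comp_refl]] nm[OF UnI2[OF this]]
      have "\<not> touches n (a + M) (comp (fst S) v)" unfolding touches_iff l by (simp only: simp_thms)
      then show ?thesis by (rule edge_mk[OF e v(1)])
    qed
  qed
  show ?thesis
    by (rule fine_unique[OF cl E(2) tt P(2) refl _ ag]) (use p mr in \<open>simp_all add: pairA_def\<close>)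
qed

text \<open>The circle of a G2 source is \<open>Plus\<close>, so merging it leaves the mark of the
  other component as it is; if that is an arc, the result is an arc.\<close>

lemma own_B:
  assumes p: "pairB a S T" and e: "edge_at (Suc a) S T'"
  shows "T' = T"
proof -
  note P = pairB_D[OF p] and E = edge_D[OF e]
  have tt: "fst T' = fst T" using P(6) E(6) by simp
  let ?u = "(Suc a, Suc (Suc (lt a)))"
  note cl = pairB_clasp[OF p]
  let ?X = "comp (fst S) ?u"
  have l: "lt (Suc a) = Suc (lt a)" using letter_Suc P(8,10) by simp
  have M1: "1 < M" using P(8) letter_pos(1)[of a] by linarith
  have ru: "(a, Suc (lt a)) \<in> rect a" "(Suc a, Suc (lt a)) \<in> rect a" using M1 by (simp_all add: rect_def)
  have A: "comp (fst S) (a, Suc (lt a)) = rect a" by (rule comp_rect_mem[OF P(3,5) ru(1)])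
  have "((a, Suc (Suc (lt a))), ?u) \<in> G (fst S)"
    by (rule G_straight) (use P(8,16) E(8) l in auto)
  from comp_edge'[OF this] have B: "comp (fst S) (a, Suc (Suc (lt a))) = ?X" "(a, Suc (Suc (lt a))) \<in> ?X"
    by (simp_all add: comp_eqI)
  have L: "comp (fst T') (a, Suc (lt a)) = rect a \<union> ?X" using comp_clasp(1)[OF cl UnI1[OF ru(1)]] tt by simp
  have ne: "rect a \<noteq> ?X" using clasp_base(1)[OF cl] comp_refl by metis
  have mr: "snd S (rect a) = Some Plus" using p unfolding pairB_def by blast
  have "crossing_cobordism n k (Suc a) S T' \<noteq> None" using e unfolding edge_at_def by blast
  then have cc: "merge_cobordism (Some Plus) (snd S ?X) (snd T' (rect a \<union> ?X)) (rect a \<union> ?X) \<noteq> None"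
    unfolding crossing_unfold Let_def l diff_Suc_1 A B L mr using ne by simp
  have eq: "snd T' (rect a \<union> ?X) = snd S ?X"
  proof (cases "snd S ?X")
    case None
    then have "mk S ?u = None" by (simp add: mk_def)
    then have "?X \<notin> closed (fst S)" using mk_None[OF P(1) clasp_base(2)[OF cl]] by blast
    then have "comp (fst T') ?u \<notin> closed (fst T')" using clasp_closed[OF cl clasp_base(2,1)[OF cl]] tt by simp
    then have "mk T' ?u = None" using mk_None[OF E(2) clasp_base(2)[OF cl]] by blast
    moreover have "comp (fst T') ?u = rect a \<union> ?X" using comp_clasp(1)[OF cl, of ?u] tt by simp
    ultimately show ?thesis using None by (simp add: mk_def)
  next
    case (Some y)
    then show ?thesis using merge_Plus cc by simp
  qed
  have ag: "agree_off a S T'" unfolding agree_off_def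
  proof (intro ballI impI)
    fix v assume v: "v \<in> points n k" "v \<notin> rect a"
    show "mk S v = mk T' v"
    proof (cases "v \<in> ?X")
      case True
      then show ?thesis using comp_clasp(1)[OF cl, of v] comp_eqI[OF True] eq tt unfolding mk_def by simp
    next
      case False
      have nm: "x \<notin> comp (fst S) v" if x: "x \<in> rect a \<union> ?X" for x
      proof
        assume "x \<in> comp (fst S) v"
        then have "v \<in> comp (fst S) x" by (rule comp_sym)
        moreover have "comp (fst S) x = rect a \<or> comp (fst S) x = ?X"
          using x comp_rect_mem[OF P(3,5), of x] comp_eqI[of x "fst S" ?u] by blast
        ultimately have "v \<in> rect a \<union> ?X" by blast
        then show False using False v by blast
      qed
      from nm[OF UnI1[OF ru(1)]] nm[OF UnI1[OF ru(2)]] nm[OF UnI2[OF comp_refl]] nm[OF UnI2[OF B(2)]]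
      have "\<not> touches n (Suc a) (comp (fst S) v)"
        unfolding touches_iff l diff_Suc_1 by (simp only: simp_thms)
      then show ?thesis using edge_mk[OF e v(1)] by simp
    qed
  qed
  have agT: "agree_off a S T" using p unfolding pairB_def by blast
  show ?thesis by (rule coarse_unique[OF cl E(2) tt P(2) refl ag agT])
qed

text \<open>The upper strand of the circle at \<open>b\<close> and the strand arriving from
  \<open>nxt b\<close> are the ones joined by the new bar.\<close>

lemma edge_merge:
  assumes e: "edge_at (Suc b) S T" and h: "has_nxt b" and b: "b \<in> fst S"
    and P: "mk S (b, lt b) = Some Plus" and y: "mk S (nxt b, lt (nxt b)) = Some y"
    and ne: "comp (fst S) (b, lt b) \<noteq> comp (fst S) (nxt b, lt (nxt b))"
  shows "mk T (b, lt b) = Some y"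
proof -
  note E = edge_D[OF e]
  have b1: "1 \<le> b" "b \<le> N" using wordD[OF E(3) b] by auto
  note n = nxt[OF h b1(1)]
  have l: "lt (Suc b) = Suc (lt b)" using letter_Suc b1 n(7) by simp
  have A: "comp w (b, Suc (lt b)) = comp w (b, lt b)" if "b \<in> w" for w
    by (rule comp_eqI[OF comp_right[OF b1 that]])
  have B: "comp (fst S) (b, Suc (Suc (lt b))) = comp (fst S) (nxt b, lt (nxt b))"
    using comp_eqI[OF nxt_strand[OF h b1]] by simp
  have bT: "b \<in> fst T" using E(6) b by blast
  have "crossing_cobordism n k (Suc b) S T \<noteq> None" using e unfolding edge_at_def by blast
  then have "merge_cobordism (Some Plus) (Some y) (mk T (b, lt b)) (comp (fst T) (b, lt b)) \<noteq> None"
    unfolding crossing_unfold Let_def l diff_Suc_1 A[OF b] A[OF bT] B using ne P y unfolding mk_def by simp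
  then show ?thesis by (rule merge_Plus)
qed

text \<open>Without a change of a bar that is read, only a mark at a chain ending in the letter
  \<open>M\<close> could change. By \<open>chain_comp\<close> such a circle of a free window is
  exposed only at \<open>b + M - 1\<close>, so it is untouched.\<close>

lemma phi_edge:
  assumes e: "edge_at p S T" and d: "phi S b \<noteq> phi T b"
  shows "2 \<le> lt b \<and> p = b + M - 1 \<or> (2 \<le> lt b \<longrightarrow> b + M - 1 \<notin> fst S) \<and>
    (\<exists>d. pchain (fst S) b d \<and> (p = d \<or> p = d + M \<or> lt d < M \<and> p = Suc d))"
proof (rule ccontr)
  assume no: "\<not> ?thesis"
  note E = edge_D[OF e]
  have x: "b + M - 1 \<in> fst S \<longleftrightarrow> b + M - 1 \<in> fst T" if "2 \<le> lt b"
  proof -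
    have "p \<noteq> b + M - 1" using no that by blast
    then show ?thesis unfolding E(6) by auto
  qed
  show False
  proof (cases "2 \<le> lt b \<and> b + M - 1 \<in> fst S")
    case True
    then show False using d x unfolding phi_def free_def by blast
  next
    case f: False
    have pc: "same_at (fst S) (fst T) d" if "pchain (fst S) b d" for d
      using no f that E(6) unfolding same_at_def by auto
    then have bb: "b \<in> fst S \<longleftrightarrow> b \<in> fst T" using pchain_refl unfolding same_at_def by blast
    have "psi S b \<longleftrightarrow> psi T b" if fr: "free (fst S) b"
    proof (rule psi_cong_pchain[OF _ _ pc])
      show bS: "b \<in> fst S" using fr unfolding free_def by blast
      then show "1 \<le> b" using wordD[OF E(3)] by blast
      fix d assume c: "chain (fst S) b d" and ld: "lt d = M"
      have "\<not> touches n p (comp (fst S) (b, lt b))"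
        using chain_comp[OF c fr E(3)] E(5,7) no ld by auto
      moreover have "comp (fst S) (b, lt b) = comp (fst S) (d, lt d)"
        using comp_eqI[OF chain_conn[OF c E(3)]] by simp
      moreover have "(d, lt d) \<in> points n k" using corner_point[OF _ E(3)] chain_last[OF c] by blast
      ultimately show "mk S (d, lt d) = Some Plus \<longleftrightarrow> mk T (d, lt d) = Some Plus"
        using edge_mk[OF e] by simp
    qed
    then show False using d x bb unfolding phi_def free_def by blast
  qed
qed

lemma psi_pchain:
  assumes "pchain (fst S) b c" "c \<in> fst S" "fst S \<subseteq> fst T" "psi S c \<longleftrightarrow> psi T c"
  shows "b \<in> fst S \<and> (psi S b \<longleftrightarrow> psi T b)"
  using assms
proof (induction rule: pchain.induct)
  case (pchain_step b c)
  have l: "lt b < M" using pchain_step.hyps(4) unfolding has_nxt_def by linarith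
  have IH: "nxt b \<in> fst S" "psi S (nxt b) \<longleftrightarrow> psi T (nxt b)" using pchain_step by blast+
  have "psi S b \<longleftrightarrow> psi T b"
    using psi_11[of b S] psi_11[of b T] pchain_step.hyps(2,3) pchain_step.prems(2) l IH by blast
  then show ?case using pchain_step.hyps(1) by blast
qed blast

lemma pchain_last:
  "pchain w b d \<Longrightarrow> d = b \<or> (\<exists>e. pchain w b e \<and> e \<in> w \<and> e + M \<in> w \<and> Suc e \<in> w \<and> has_nxt e \<and> nxt e = d)"
proof (induction rule: pchain.induct)
  case (pchain_step b d)
  from pchain_step.IH show ?case
  proof
    assume "d = nxt b"
    then show ?thesis using pchain_step.hyps pchain_refl by blast
  next
    assume "\<exists>e. pchain w (nxt b) e \<and> e \<in> w \<and> e + M \<in> w \<and> Suc e \<in> w \<and> has_nxt e \<and> nxt e = d"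
    then show ?thesis using pchain.pchain_step[OF pchain_step.hyps(1-4)] by blast
  qed
qed blast

lemma corner_off_rect:
  assumes "pair a S T" "c \<in> fst S" "c \<noteq> a"
  shows "(c, lt c) \<notin> rect a"
proof -
  consider "pairA a S T" | "pairB a S T" using assms(1) unfolding pair_def by blast
  then show ?thesis
  proof cases
    case 1
    then show ?thesis using corner_in_rect_iff[of "fst T" a c] pairA_D(3,4,7)[OF 1] assms by blast
  next
    case 2
    then show ?thesis using corner_in_rect_iff[of "fst S" a c] pairB_D(3,5)[OF 2] assms by blast
  qed
qed

end

section \<open>Cycles\<close>

text \<open>
  A cycle is unrolled to a periodic sequence of isomorphisms. From \<open>S i\<close> one passes to \<open>S (Suc i)\<close> by
  adding the bar \<open>added i\<close> and dropping the bar \<open>pivot (Suc i)\<close>. As every bar that is dropped has to be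
  added again, a position that never is a pivot keeps its resolution throughout the cycle.
\<close>

locale braid_cycle = braid +
  fixes \<alpha> :: "nat \<Rightarrow> ge_iso" and m :: nat
  assumes m_pos: "0 < m" and periodic: "\<alpha> (i + m) = \<alpha> i"
    and step: "(\<alpha> i, \<alpha> (Suc i)) \<in> GE_graph n k"
begin

abbreviation "S i \<equiv> fst (\<alpha> i)"
abbreviation "T i \<equiv> snd (\<alpha> i)"
abbreviation "s i \<equiv> fst (S i)"
abbreviation "t i \<equiv> fst (T i)"

lemma periodic_mult: "\<alpha> (i + m * j) = \<alpha> i"
proof (induction j)
  case (Suc j)
  have "i + m * Suc j = (i + m * j) + m" by simp
  show ?case unfolding \<open>i + m * Suc j = (i + m * j) + m\<close> periodic by (rule Suc.IH)
qed simp

lemma cycle_invariant: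
  assumes "\<And>i. Q (\<alpha> i) \<Longrightarrow> Q (\<alpha> (Suc i))" "Q (\<alpha> i)"
  shows "Q (\<alpha> j)"
proof -
  have *: "Q (\<alpha> (i + l))" for l by (induction l) (use assms in auto)
  \<comment> \<open>A later index that represents the same isomorphism as \<open>j\<close>.\<close>
  have "i \<le> j + m * i" using m_pos by (cases m) auto
  then have "Q (\<alpha> (j + m * i))" using *[of "j + m * i - i"] by simp
  then show ?thesis by (simp add: periodic_mult)
qed

lemma cycle_invariant_back:
  assumes "\<And>i. Q (\<alpha> (Suc i)) \<Longrightarrow> Q (\<alpha> i)" "Q (\<alpha> i)"
  shows "Q (\<alpha> j)"
  using cycle_invariant[of "\<lambda>x. \<not> Q x" j i] assms by blast

lemma pred_exists: obtains j where "\<alpha> (Suc j) = \<alpha> i"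
proof -
  have "Suc (i + m - 1) = i + m" using m_pos by simp
  then show thesis using that[of "i + m - 1"] periodic by metis
qed

section \<open>Windows, dropped bars and added bars along a cycle\<close>

definition window :: "ge_iso \<Rightarrow> nat" where
  "window x = (SOME a. pair a (fst x) (snd x) \<and> (\<forall>b<a. \<not> phi (fst x) b) \<and> phi (fst x) a \<and>
     (\<forall>b<a. \<not> phi (snd x) b) \<and> phi (snd x) a)"

abbreviation "win i \<equiv> window (\<alpha> i)"

lemma window:
  shows "pair (win i) (S i) (T i)" "b < win i \<Longrightarrow> \<not> phi (S i) b" "phi (S i) (win i)"
    "b < win i \<Longrightarrow> \<not> phi (T i) b" "phi (T i) (win i)"
proof -
  have "(S i, T i) \<in> \<G>" using step[of i] by (simp add: GE_graph_def)
  then obtain a where "pair a (S i) (T i) \<and> (\<forall>b<a. \<not> phi (S i) b) \<and> phi (S i) a \<and>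
     (\<forall>b<a. \<not> phi (T i) b) \<and> phi (T i) a" using distinguished_phi by metis
  then have "pair (win i) (S i) (T i) \<and> (\<forall>b<win i. \<not> phi (S i) b) \<and> phi (S i) (win i) \<and>
     (\<forall>b<win i. \<not> phi (T i) b) \<and> phi (T i) (win i)" unfolding window_def by (rule someI)
  then show "pair (win i) (S i) (T i)" "b < win i \<Longrightarrow> \<not> phi (S i) b" "phi (S i) (win i)"
    "b < win i \<Longrightarrow> \<not> phi (T i) b" "phi (T i) (win i)" by blast+
qed

lemma window_le: "phi (S i) b \<Longrightarrow> win i \<le> b"
  using window(2)[where i = i and b = b] not_le by blast

definition typeA :: "nat \<Rightarrow> bool" where
  "typeA i \<longleftrightarrow> pairA (win i) (S i) (T i)"

lemma not_typeA: "\<not> typeA i \<Longrightarrow> pairB (win i) (S i) (T i)"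
  using window(1)[of i] unfolding typeA_def pair_def by blast

definition pivot :: "nat \<Rightarrow> nat" where
  "pivot i = (if typeA i then win i + M else Suc (win i))"

definition added :: "nat \<Rightarrow> nat" where
  "added i = (SOME p. edge_at p (S i) (T (Suc i)))"

lemma edge: "edge_at (added i) (S i) (T (Suc i))"
proof -
  have "differential n k (S i) (T (Suc i)) \<noteq> 0" using step[of i] by (simp add: GE_graph_def)
  then obtain p where "edge_at p (S i) (T (Suc i))" by (rule edge_exists)
  then show ?thesis unfolding added_def by (rule someI)
qed

lemma words: "word (s i)" "word (t i)"
  using pair_D(3,4)[OF window(1)] by blast+

lemma window_pos: "1 \<le> win i" "win i + M \<le> N" "free (s i) (win i)" "win i \<in> s i"
  using pair_D(5-8)[OF window(1)] by blast+

lemma t_pivot: "t i = insert (pivot i) (s i)" "pivot i \<notin> s i"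
proof -
  have "t i = insert (pivot i) (s i) \<and> pivot i \<notin> s i"
  proof (cases "typeA i")
    case True
    then show ?thesis using pairA_D(7,13)[of "win i" "S i" "T i"] unfolding typeA_def pivot_def by simp
  next
    case False
    then show ?thesis using pairB_D(6,16)[OF not_typeA] unfolding pivot_def by simp
  qed
  then show "t i = insert (pivot i) (s i)" "pivot i \<notin> s i" by blast+
qed

lemma t_added: "t (Suc i) = insert (added i) (s i)" "added i \<notin> s i" "1 \<le> added i"
  using edge_D[OF edge] by blast+

lemma s_Suc: "s (Suc i) = insert (added i) (s i) - {pivot (Suc i)}"
proof -
  have "s (Suc i) = t (Suc i) - {pivot (Suc i)}"
    unfolding t_pivot(1)[of "Suc i"] by (rule Diff_insert_absorb[OF t_pivot(2), symmetric])
  then show ?thesis unfolding t_added(1)[of i] .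
qed

lemma never_dropped:
  assumes "\<And>i. pivot i \<noteq> P"
  shows "P \<in> s i \<longleftrightarrow> P \<in> s j" "added i \<noteq> P" "P \<in> t i \<longleftrightarrow> P \<in> s j"
proof -
  have inc: "P \<in> s (Suc i)" if "P \<in> s i \<or> added i = P" for i
    using that assms[of "Suc i"] unfolding s_Suc[of i] by auto
  have *: "P \<in> s j" if "P \<in> s i" for i j
  proof (rule cycle_invariant[of "\<lambda>x. P \<in> fst (fst x)" i j])
    show "P \<in> s (Suc l)" if "P \<in> s l" for l using inc[of l] that by simp
  qed (rule that)
  then show 1: "P \<in> s i \<longleftrightarrow> P \<in> s j" for i j by blast
  show "added i \<noteq> P" using inc[of i] 1[of "Suc i" i] t_added(2)[of i] by auto
  show "P \<in> t i \<longleftrightarrow> P \<in> s j" using assms[of i] 1[of i j] unfolding t_pivot(1)[of i] by auto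
qed

lemma target_not_repeated: "T (Suc i) = T i \<Longrightarrow> win (Suc i) = win i \<Longrightarrow> False"
proof -
  assume T: "T (Suc i) = T i" and w: "win (Suc i) = win i"
  have ne: "\<alpha> i \<noteq> \<alpha> (Suc i)" using step[of i] by (simp add: GE_graph_def)
  have AB: False if "pairA a R U" "pairB a R' U" for a R R' U
  proof -
    have "Suc a \<in> fst U" "lt a < M" using pairB_D(6,8)[OF that(2)] by auto
    then show False using circD(7)[OF pairA_D(3,4)[OF that(1)]] by blast
  qed
  have "S i = S (Suc i)"
    using window(1)[of i] window(1)[of "Suc i"] AB pairA_unique pairB_unique
    unfolding T w pair_def by blast
  then show False using ne T by (simp add: prod_eq_iff)
qed

lemma same_target_window: "T (Suc i) = T i \<Longrightarrow> win (Suc i) = win i"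
  using window(4,5) by (metis nat_neq_iff)

text \<open>The window is the first one at which \<open>phi\<close> holds for the target, so equal
  targets share it. The bars then fix the type, hence the source, but adjacent vertices of the graph
  are different.\<close>

lemma target_differs: "T (Suc i) \<noteq> T i"
  using same_target_window target_not_repeated by blast

lemma added_untouched:
  assumes "circ (t (Suc i)) c" "c \<in> s i" "c + M \<in> s i"
  shows "\<not> touches n (added i) (rect c)"
proof
  assume "touches n (added i) (rect c)"
  note C = circD[OF assms(1) words(2)]
  from touches_rect[OF \<open>touches n (added i) (rect c)\<close> C(1) t_added(3)]
  consider "added i = c" | "added i = c + M" | "lt c < M" "added i = Suc c" | "2 \<le> lt c" "added i = c + M - 1"
    by blast
  then show False
  proof cases
    case 1
    then show False using t_added(2)[of i] assms(2) by simp
  next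
    case 2
    then show False using t_added(2)[of i] assms(3) by simp
  next
    case 3
    then show False using C(7) t_added(1)[of i] by simp
  next
    case 4
    then show False using C(8) t_added(1)[of i] by simp
  qed
qed

text \<open>For equal types the edge would toggle the bar of the window itself and repeat the
  target. G1 followed by G2 would add two bars at once; G2 followed by G1 would turn an untouched
  \<open>Plus\<close> circle into \<open>Minus\<close>.\<close>

lemma window_Suc: "win (Suc i) \<noteq> win i"
proof
  assume w: "win (Suc i) = win i"
  note E = edge_D[OF edge[of i]]
  show False
  proof (cases "typeA i")
    case A: True
    then have A': "pairA (win i) (S i) (T i)" by (simp add: typeA_def)
    note P = pairA_D[OF A']
    show False
    proof (cases "typeA (Suc i)")
      case True
      then have "pairA (win i) (S (Suc i)) (T (Suc i))" using w by (simp add: typeA_def)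
      note P' = pairA_D[OF this]
      have "added i = win i + M" using P'(7) P(13) t_added(1)[of i] by (metis insertE insertI1)
      then show False using own_A[OF A'] edge[of i] P'(8) target_differs[of i] by metis
    next
      case False
      then have "pairB (win i) (S (Suc i)) (T (Suc i))" using not_typeA[of "Suc i"] w by simp
      note P' = pairB_D[OF this]
      have "1 < M" using P'(8) letter_pos(1)[of "win i"] by linarith
      moreover have "win i + M = added i" "Suc (win i) = added i"
        using P'(6,15) P(13) P(14)[OF P'(8)] t_added(1)[of i] by (metis insertE insertI1 insertI2)+
      ultimately show False by linarith
    qed
  next
    case B: False
    note B' = not_typeA[OF B]
    note P = pairB_D[OF B']
    show False
    proof (cases "typeA (Suc i)")
      case True
      then have "pairA (win i) (S (Suc i)) (T (Suc i))" using w by (simp add: typeA_def)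
      note P' = pairA_D[OF this]
      have "\<not> touches n (added i) (rect (win i))"
        by (rule added_untouched[OF P'(3) P(14,15)])
      then have "mk (T (Suc i)) (win i, lt (win i)) = mk (S i) (win i, lt (win i))"
        using edge_mk[OF edge[of i] corner_point[OF P(14,5)]] comp_rect[OF P(3,5)] by simp
      then show False using P(9) P'(8) by simp
    next
      case False
      then have "pairB (win i) (S (Suc i)) (T (Suc i))" using not_typeA[of "Suc i"] w by simp
      note P' = pairB_D[OF this]
      have "added i = Suc (win i)" using P'(6) P(16) t_added(1)[of i] by (metis insertE insertI1)
      then show False using own_B[OF B'] edge[of i] target_differs[of i] by metis
    qed
  qed
qed

text \<open>At the smaller of the two windows \<open>phi\<close> holds at one end of the edge and
  fails at the other, because each window is the first one for its state.\<close>

lemma step_phi: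
  obtains b where "b = win i \<or> b = win (Suc i)" "b \<le> win i" "phi (S i) b \<noteq> phi (T (Suc i)) b"
    "b = win (Suc i) \<Longrightarrow> \<not> phi (S i) b"
proof (cases "win (Suc i) < win i")
  case True
  then show thesis using that[of "win (Suc i)"] window(2)[OF True] window(5)[of "Suc i"] by simp
next
  case False
  then have "win i < win (Suc i)" using window_Suc[of i] by simp
  then show thesis using that[of "win i"] window(3)[of i] window(4)[of "win i" "Suc i"] by auto
qed

lemma added_le: "added i \<le> win i + M"
proof -
  obtain b where b: "b = win i \<or> b = win (Suc i)" "b \<le> win i" "phi (S i) b \<noteq> phi (T (Suc i)) b"
    by (rule step_phi)
  have b1: "1 \<le> b" using b(1) window_pos(1) by auto
  have "added i \<le> b + M"
  proof -
    consider "added i = b + M - 1" | d where "pchain (s i) b d"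
        "added i = d \<or> added i = d + M \<or> lt d < M \<and> added i = Suc d"
      using phi_edge[OF edge b(3)] by blast
    then show ?thesis
    proof cases
      case 2
      have "d \<le> b" using diag_pos[OF pchain_diag[OF 2(1)] b1] by auto
      then show ?thesis using 2(2) M_pos(1) by linarith
    qed simp
  qed
  then show ?thesis using b(2) by simp
qed

section \<open>Windows that are isolated from the rest of a cycle\<close>

text \<open>The blocking bar at \<open>c + M - 1\<close> may be dropped from outside the window, but
  only when \<open>phi\<close> fails at \<open>c\<close>: along a diagonal it is the bar that the
  preceding window drops by G2.\<close>

definition isolated :: "nat \<Rightarrow> bool" where
  "isolated c \<longleftrightarrow> (\<forall>i. c \<in> s i) \<and> (\<forall>i. pivot i = c + M \<longrightarrow> win i = c \<and> typeA i) \<and>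
     (lt c < M \<longrightarrow> (\<forall>i. pivot i = Suc c \<longrightarrow> win i = c \<and> \<not> typeA i)) \<and>
     (2 \<le> lt c \<longrightarrow> (\<forall>i. pivot i = c + M - 1 \<longrightarrow> \<not> phi (S i) c))"

lemma isolated_pos: "isolated c \<Longrightarrow> 1 \<le> c"
  using wordD[OF words(1)] unfolding isolated_def by blast

text \<open>
  Backwards in time, a circle marked \<open>Minus\<close> in an isolated window persists: a state that contains it
  is matched there or earlier, so it cannot be undone without repeating the target.
\<close>

lemma isolated_typeA_back:
  assumes c: "isolated c" and ci: "circ (t (Suc i)) c" and m: "mk (T (Suc i)) (c, lt c) = Some Minus"
  shows "circ (t i) c \<and> mk (T i) (c, lt c) = Some Minus \<and> c + M \<in> s i"
proof -
  note I = c[unfolded isolated_def]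
  have c1: "1 \<le> c" by (rule isolated_pos[OF c])
  have cs: "c \<in> s i" for i using I by blast
  note C = circD[OF ci words(2)]
  have x: "c + M - 1 \<notin> s i" if "2 \<le> lt c" using C(8)[OF that] t_added(1)[of i] by blast
  have z: "Suc c \<notin> s i" if "lt c < M" using C(7)[OF that] t_added(1)[of i] by blast
  have fr: "free (s i) c" using cs x unfolding free_def by blast
  have pt: "(c, lt c) \<in> points n k" by (rule corner_point[OF cs words(1)])
  \<comment> \<open>Adding this bar would force \<open>win i = c\<close>: \<open>phi\<close> holds
    there before the edge, and no bar beyond \<open>win i + M\<close> can be added. The edge then
    repeats the target.\<close>
  have ay: "added i \<noteq> c + M"
  proof
    assume a: "added i = c + M"
    then have y: "c + M \<notin> s i" using t_added(2)[of i] by simp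
    then have "psi (S i) c" using psi_0 z by blast
    then have "phi (S i) c" using fr C(3) unfolding phi_def by blast
    then have "win i \<le> c" by (rule window_le)
    moreover have "c \<le> win i" using added_le[of i] a by simp
    ultimately have w: "win i = c" by simp
    have "typeA i"
    proof (rule ccontr)
      assume "\<not> typeA i"
      then show False using pairB_D(15)[OF not_typeA] w y by blast
    qed
    then have "T (Suc i) = T i" using own_A[of c "S i" "T i"] edge[of i] a w m unfolding typeA_def by simp
    then show False using target_differs by blast
  qed
  then have y: "c + M \<in> s i" using C(5) t_added(1)[of i] by (metis insertE)
  have cS: "circ (s i) c" using fr y z unfolding circ_def by blast
  have "\<not> touches n (added i) (rect c)"
    by (rule added_untouched[OF ci cs y])
  then have mS: "mk (S i) (c, lt c) = Some Minus"
    using edge_mk[OF edge[of i] pt] comp_rect[OF cS words(1)] m by simp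
  have ph: "phi (S i) c" by (rule phi_circ_Minus[OF cS words(1) mS])
  have nw: "win i \<noteq> c"
  proof
    assume w: "win i = c"
    show False
    proof (cases "typeA i")
      case True
      then show False using pairA_D(13)[of c "S i" "T i"] w y unfolding typeA_def by simp
    next
      case False
      then show False using pairB_D(9)[OF not_typeA[OF False]] w mS by simp
    qed
  qed
  have "Suc c \<notin> t i" if "lt c < M"
  proof -
    have "pivot i \<noteq> Suc c" using I nw that by blast
    then show ?thesis using z[OF that] unfolding t_pivot(1)[of i] by simp
  qed
  moreover have "c + M - 1 \<notin> t i" if "2 \<le> lt c"
  proof -
    have "pivot i \<noteq> c + M - 1" using I ph that by blast
    then show ?thesis using x[OF that] unfolding t_pivot(1)[of i] by simp
  qed
  ultimately have "circ (t i) c" using cs[of i] y t_pivot(1)[of i] unfolding circ_def free_def by blast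
  moreover have "mk (T i) (c, lt c) = Some Minus"
    using pair_mk[OF window(1) pt corner_off_rect[OF window(1) cs]] nw mS by metis
  ultimately show ?thesis using y by blast
qed

text \<open>Carried backwards all the way round the cycle, the \<open>Minus\<close> circle reappears
  in the next target, which forces the bar at \<open>c + M\<close> into the very source that lacks
  it.\<close>

lemma isolated_not_typeA:
  assumes c: "isolated c" and w: "win i = c"
  shows "\<not> typeA i"
proof
  assume A: "typeA i"
  then have P: "pairA c (S i) (T i)" using w by (simp add: typeA_def)
  let ?Q = "\<lambda>x. circ (fst (snd x)) c \<and> mk (snd x) (c, lt c) = Some Minus"
  have "?Q (\<alpha> (Suc i))"
  proof (rule cycle_invariant_back[of ?Q i "Suc i"])
    show "?Q (\<alpha> l)" if "?Q (\<alpha> (Suc l))" for l using isolated_typeA_back[OF c] that by blast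
    show "?Q (\<alpha> i)" using pairA_D(3,8)[OF P] by blast
  qed
  then have "c + M \<in> s i" using isolated_typeA_back[OF c] by blast
  then show False using pairA_D(13)[OF P] by blast
qed

lemma isolated_const: "isolated c \<Longrightarrow> pivot i \<noteq> c + M"
  using isolated_not_typeA unfolding isolated_def by blast

end

section \<open>The window of minimal height and smallest letter\<close>

locale braid_cycle_min = braid_cycle +
  fixes i\<^sub>0 :: nat
  assumes height_min: "height (window (\<alpha> i\<^sub>0)) \<le> height (window (\<alpha> i))"
    and letter_min: "height (window (\<alpha> i)) = height (window (\<alpha> i\<^sub>0)) \<Longrightarrow> lt (window (\<alpha> i\<^sub>0)) \<le> lt (window (\<alpha> i))"
begin

abbreviation "a\<^sub>0 \<equiv> win i\<^sub>0"
abbreviation "H\<^sub>0 \<equiv> height a\<^sub>0"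

lemma pivot_height:
  "typeA i \<Longrightarrow> height (pivot i) = height (win i) + 2"
  "\<not> typeA i \<Longrightarrow> height (pivot i) = height (win i) + 1"
  using height_period[OF window_pos(1)] height_Suc[OF window_pos(1)] pairB_D(8)[OF not_typeA]
  by (simp_all add: pivot_def)

lemma pivot_low: "height p \<le> H\<^sub>0 \<Longrightarrow> pivot i \<noteq> p"
  using pivot_height[of i] height_min[of i] by (cases "typeA i") auto

lemma pivot_level:
  assumes "height p = H\<^sub>0 + 1" "pivot i = p"
  shows "\<not> typeA i" "height (win i) = H\<^sub>0" "p = Suc (win i)"
proof -
  show 1: "\<not> typeA i" using assms pivot_height(1)[of i] height_min[of i] by auto
  show "height (win i) = H\<^sub>0" using assms pivot_height(2)[OF 1] by simp
  show "p = Suc (win i)" using assms(2) 1 by (simp add: pivot_def)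
qed

text \<open>The position is 1 above the minimum, so it is dropped only by G2 in a window of minimal
  height with letter \<open>lt a\<^sub>0 - 2\<close>, against the choice of the smallest
  letter.\<close>

lemma base_x: "2 \<le> lt a\<^sub>0 \<Longrightarrow> pivot i \<noteq> a\<^sub>0 + M - 1"
proof
  assume l: "2 \<le> lt a\<^sub>0" and p: "pivot i = a\<^sub>0 + M - 1"
  note b = letter_before[OF window_pos(1) l]
  have 1: "\<not> typeA i" "height (win i) = H\<^sub>0" "a\<^sub>0 + M - 1 = Suc (win i)"
    using pivot_level[OF b(2) p] by blast+
  have "lt (Suc (win i)) = Suc (lt (win i))"
    using letter_Suc[OF window_pos(1)] pairB_D(8)[OF not_typeA[OF 1(1)]] by simp
  then have "lt (win i) < lt a\<^sub>0" using b(1) 1(3) l by simp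
  then show False using letter_min[OF 1(2)] by simp
qed

lemma base_x_notin: "2 \<le> lt a\<^sub>0 \<Longrightarrow> a\<^sub>0 + M - 1 \<notin> s i"
  using never_dropped(1)[OF base_x, of i i\<^sub>0] window_pos(3)[of i\<^sub>0] unfolding free_def by blast

lemma base_isolated: "isolated a\<^sub>0"
proof -
  have "a\<^sub>0 \<in> s i" for i
    using never_dropped(1)[of a\<^sub>0 i i\<^sub>0] pivot_low window_pos(4)[of i\<^sub>0] by blast
  moreover have "win i = a\<^sub>0 \<and> typeA i" if p: "pivot i = a\<^sub>0 + M" for i
  proof (cases "typeA i")
    case True
    then show ?thesis using p by (simp add: pivot_def)
  next
    case False
    note P = pairB_D[OF not_typeA[OF False]]
    \<comment> \<open>A G2 drop of this bar comes from the window at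
      \<open>a\<^sub>0 + M - 1\<close>, a position that is never barred.\<close>
    have e: "Suc (win i) = a\<^sub>0 + M" using p False by (simp add: pivot_def)
    then have "Suc (lt (win i)) = lt a\<^sub>0"
      using letter_Suc[OF P(10)] P(8) letter_period[OF window_pos(1), of i\<^sub>0] by simp
    then have "2 \<le> lt a\<^sub>0" using letter_pos(1)[of "win i"] by linarith
    moreover have "win i = a\<^sub>0 + M - 1" using e by simp
    ultimately show ?thesis using base_x_notin window_pos(4)[of i] by simp
  qed
  moreover have "win i = a\<^sub>0 \<and> \<not> typeA i" if "lt a\<^sub>0 < M" "pivot i = Suc a\<^sub>0" for i
  proof -
    have "height (Suc a\<^sub>0) = H\<^sub>0 + 1" using height_Suc[OF window_pos(1) that(1)] by simp
    from pivot_level(1,3)[OF this that(2)] show ?thesis by simp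
  qed
  ultimately show ?thesis using base_x unfolding isolated_def by blast
qed

text \<open>
  In a good window the bar at \<open>Suc c\<close> is dropped by G2 isomorphisms. The chain of good windows cannot
  be extended forever, as the letters increase, and it cannot stop either: see \<open>no_cycle\<close>.
\<close>

definition good :: "nat \<Rightarrow> bool" where
  "good c \<longleftrightarrow> height c = H\<^sub>0 \<and> isolated c \<and> lt c < M \<and> (\<forall>i. c + M \<in> s i) \<and> (\<exists>i. win i = c)"

inductive good_chain :: "nat \<Rightarrow> bool" where
  base: "good_chain a\<^sub>0"
| extend: "good_chain c \<Longrightarrow> has_nxt c \<Longrightarrow> good (nxt c) \<Longrightarrow> good_chain (nxt c)"

lemma goodI:
  assumes "height c = H\<^sub>0" "isolated c" "win i = c"
  shows "good c"
proof -
  note P = pairB_D[OF not_typeA[OF isolated_not_typeA[OF assms(2,3)]]]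
  have "c + M \<in> s j" for j
    using never_dropped(1)[OF isolated_const[OF assms(2)], of j i] P(15) assms(3) by simp
  then show ?thesis using assms P(8) unfolding good_def by blast
qed

lemma good_chain_good: "good_chain c \<Longrightarrow> good c"
  by (induction rule: good_chain.induct) (use goodI[OF refl base_isolated refl] in blast)+

lemma goodD:
  assumes "good c"
  shows "height c = H\<^sub>0" "isolated c" "lt c < M" "c + M \<in> s i" "c \<in> s i" "1 \<le> c" "height (Suc c) = H\<^sub>0 + 1"
    "lt (Suc c) = Suc (lt c)" "pivot i = Suc c \<Longrightarrow> win i = c \<and> \<not> typeA i" "win i = c \<Longrightarrow> \<not> typeA i"
    "win i = c \<Longrightarrow> pivot i = Suc c"
proof -
  show 1: "height c = H\<^sub>0" "isolated c" "lt c < M" "c + M \<in> s i" "c \<in> s i"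
    using assms unfolding good_def isolated_def by blast+
  show 2: "1 \<le> c" by (rule isolated_pos[OF 1(2)])
  show "height (Suc c) = H\<^sub>0 + 1" using height_Suc[OF 2 1(3)] 1(1) by simp
  show "lt (Suc c) = Suc (lt c)" using letter_Suc[OF 2] 1(3) by simp
  show "win i = c \<and> \<not> typeA i" if "pivot i = Suc c" using 1(2,3) that unfolding isolated_def by blast
  show 3: "\<not> typeA i" if "win i = c" by (rule isolated_not_typeA[OF 1(2) that])
  show "pivot i = Suc c" if "win i = c" using 3[OF that] that by (simp add: pivot_def)
qed

text \<open>Going back along the sequence while the joining bars are present ends at
  \<open>a\<^sub>0\<close> or at a missing bar. The window reached is free, so a chain through
  \<open>c\<close> becomes part of a chain that is a circle.\<close>

lemma chain_start:
  assumes "good_chain c"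
  shows "\<exists>e. good_chain e \<and> lt e \<le> lt c \<and> free (s i) e \<and> (\<forall>d. chain (s i) c d \<longrightarrow> chain (s i) e d) \<and>
    (e = a\<^sub>0 \<or> (\<exists>e'. good_chain e' \<and> has_nxt e' \<and> e = nxt e'))"
  using assms
proof (induction rule: good_chain.induct)
  case base
  have "free (s i) a\<^sub>0"
    using goodD(5)[OF good_chain_good[OF good_chain.base]] base_x_notin unfolding free_def by blast
  then show ?case using good_chain.base by blast
next
  case (extend c)
  note g = goodD[OF good_chain_good[OF extend.hyps(1)]]
  note n = nxt[OF extend.hyps(2) g(6)]
  show ?case
  proof (cases "Suc c \<in> s i")
    case True
    obtain e where e: "good_chain e" "lt e \<le> lt c" "free (s i) e" "\<forall>d. chain (s i) c d \<longrightarrow> chain (s i) e d"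
      "e = a\<^sub>0 \<or> (\<exists>e'. good_chain e' \<and> has_nxt e' \<and> e = nxt e')" using extend.IH by blast
    have "chain (s i) e d" if "chain (s i) (nxt c) d" for d
      using e(4) chain_step[OF g(5) g(4) True extend.hyps(2) that] by blast
    moreover have "lt e \<le> lt (nxt c)" using e(2) n(4) by simp
    ultimately show ?thesis using e(1,3,5) by blast
  next
    case False
    have "free (s i) (nxt c)" using goodD(5)[OF extend.hyps(3)] n(8) False unfolding free_def by simp
    then show ?thesis using good_chain.extend[OF extend.hyps(1-3)] extend.hyps(1,2) by blast
  qed
qed

lemma unpivoted_mk:
  assumes "c \<in> s i" "win i \<noteq> c"
  shows "mk (S i) (c, lt c) = mk (T i) (c, lt c)"
  using pair_mk[OF window(1) corner_point[OF assms(1) words(1)] corner_off_rect[OF window(1) assms(1)]] assms(2)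
  by blast

text \<open>Each G2 isomorphism in the window starts from a \<open>Plus\<close> circle. While
  \<open>Suc c\<close> is missing, this circle can be touched only at the joining bar of its first
  rectangle. The merge there is with a circle of smaller letter, which is \<open>Plus\<close> by
  induction, so the mark persists.\<close>

lemma good_chain_mark:
  assumes "good_chain c" "Suc c \<notin> s i"
  shows "mk (S i) (c, lt c) = Some Plus"
  using assms
proof (induction "lt c" arbitrary: c i rule: less_induct)
  case less
  have gc: "good c" by (rule good_chain_good[OF less.prems(1)])
  note g = goodD[OF gc]
  let ?Q = "\<lambda>x. Suc c \<notin> fst (fst x) \<longrightarrow> mk (fst x) (c, lt c) = Some Plus"
  obtain i\<^sub>1 where i1: "win i\<^sub>1 = c" using gc unfolding good_def by blast
  have wP: "mk (S l) (c, lt c) = Some Plus" if "win l = c" for l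
    using pairB_D(9)[OF not_typeA[OF g(10)[OF that]]] that by simp
  have "?Q (\<alpha> i)"
  proof (rule cycle_invariant[of ?Q i\<^sub>1 i])
    show "?Q (\<alpha> i\<^sub>1)" using wP[OF i1] by blast
    fix l assume Q: "?Q (\<alpha> l)"
    show "?Q (\<alpha> (Suc l))"
    proof
      assume zS: "Suc c \<notin> s (Suc l)"
      show "mk (S (Suc l)) (c, lt c) = Some Plus"
      proof (cases "pivot (Suc l) = Suc c")
        case True
        then show ?thesis using wP g(9) by blast
      next
        case np: False
        have zT: "Suc c \<notin> t (Suc l)" using zS np unfolding t_pivot(1)[of "Suc l"] by simp
        then have z: "Suc c \<notin> s l" "added l \<noteq> Suc c" unfolding t_added(1)[of l] by auto
        have Pl: "mk (S l) (c, lt c) = Some Plus" using Q z(1) by blast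
        have pt: "(c, lt c) \<in> points n k" by (rule corner_point[OF g(5) words(1)])
        have "chain (s l) c c" by (rule chain_end) (use g(4,5) z(1) in auto)
        then obtain e where e: "good_chain e" "lt e \<le> lt c" "free (s l) e" "chain (s l) e c"
            "e = a\<^sub>0 \<or> (\<exists>e'. good_chain e' \<and> has_nxt e' \<and> e = nxt e')"
          using chain_start[OF less.prems(1), of l] by blast
        have ce: "comp (s l) (c, lt c) = comp (s l) (e, lt e)"
          by (rule comp_eqI[OF chain_conn[OF e(4) words(1)]])
        note cc = chain_comp[OF e(4,3) words(1)]
        have "mk (T (Suc l)) (c, lt c) = Some Plus"
        proof (cases "touches n (added l) (comp (s l) (e, lt e))")
          case False
          then show ?thesis using edge_mk[OF edge pt] ce Pl by simp
        next
          case True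
          then have x: "2 \<le> lt e" "added l = e + M - 1" using cc t_added(2,3)[of l] z(2) by blast+
          have "e \<noteq> a\<^sub>0" using never_dropped(2)[OF base_x, of l] x by blast
          then obtain e' where e': "good_chain e'" "has_nxt e'" "e = nxt e'" using e(5) by blast
          note g' = goodD[OF good_chain_good[OF e'(1)]]
          note n = nxt[OF e'(2) g'(6)]
          have a: "added l = Suc e'" using x(2) n(8) e'(3) by simp
          have ze': "Suc e' \<notin> s l" using t_added(2)[of l] a by simp
          have lt': "lt e' < lt c" using n(4) e(2) e'(3) by simp
          have P': "mk (S l) (e', lt e') = Some Plus" by (rule less.hyps[OF lt' e'(1) ze'])
          have Pe: "mk (S l) (nxt e', lt (nxt e')) = Some Plus" using Pl ce e'(3) unfolding mk_def by simp
          \<comment> \<open>The circle starting at \<open>e\<close> uses no strand below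
            \<open>lt e\<close>, so it misses the corner at \<open>e'\<close>.\<close>
          have ne: "comp (s l) (e', lt e') \<noteq> comp (s l) (nxt e', lt (nxt e'))"
          proof
            assume "comp (s l) (e', lt e') = comp (s l) (nxt e', lt (nxt e'))"
            then have "(e', lt e') \<in> comp (s l) (e, lt e)" using comp_refl e'(3) by metis
            then have "lt e \<le> lt e'" using cc by blast
            then show False using n(4) e'(3) by simp
          qed
          have PT: "mk (T (Suc l)) (e', lt e') = Some Plus"
            using edge_merge[OF _ e'(2) g'(5) P' Pe ne] edge[of l] a by simp
          have te: "t (Suc l) = insert (Suc e') (s l)" using t_added(1)[of l] a by simp
          have "chain (t (Suc l)) (nxt e') c"
            using chain_cong[OF e(4)] diag_nxt_same_at(2)[OF e'(2) g'(6)] e'(3) unfolding te by blast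
          then have "chain (t (Suc l)) e' c"
            by (intro chain_step[OF _ _ _ e'(2)]) (use g'(4,5) te in auto)
          then have "comp (t (Suc l)) (c, lt c) = comp (t (Suc l)) (e', lt e')"
            by (rule comp_eqI[OF chain_conn[OF _ words(2)]])
          then show ?thesis using PT unfolding mk_def by simp
        qed
        moreover have "win (Suc l) \<noteq> c" using g(11) np by blast
        ultimately show ?thesis using unpivoted_mk[OF g(5)] by simp
      qed
    qed
  qed
  then show ?case using less.prems(2) by blast
qed

text \<open>A window starting at \<open>Suc c\<close> is blocked by the permanent bar at
  \<open>c + M\<close>. Being reached from a predecessor on its diagonal means being reached from
  \<open>c + M - 1\<close>, which is never barred for \<open>a\<^sub>0\<close> and otherwise is the
  same situation one step earlier in the good sequence.\<close>

lemma good_chain_blocked: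
  assumes "good_chain c" "pchain (s i) b (Suc c)" "2 \<le> lt b \<longrightarrow> b + M - 1 \<notin> s i"
  shows False
  using assms
proof (induction rule: good_chain.induct)
  case base
  note g = goodD[OF good_chain_good[OF good_chain.base]]
  from pchain_last[OF base(1)] show False
  proof
    assume "Suc a\<^sub>0 = b"
    then show False using base(2) g(4,8) letter_pos(1)[of a\<^sub>0] by auto
  next
    assume "\<exists>e. pchain (s i) b e \<and> e \<in> s i \<and> e + M \<in> s i \<and> Suc e \<in> s i \<and> has_nxt e \<and> nxt e = Suc a\<^sub>0"
    then obtain e where e: "e \<in> s i" "has_nxt e" "nxt e = Suc a\<^sub>0" by blast
    note n = nxt[OF e(2)]
    have e1: "1 \<le> e" using wordD[OF words(1) e(1)] by blast
    have "e = a\<^sub>0 + M - 1" "lt a\<^sub>0 = Suc (lt e)" using n(1,4)[OF e1] e(3) g(8) by simp_all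
    then show False using base_x_notin[of i] e(1) letter_pos(1)[of e] by simp
  qed
next
  case (extend c)
  note gc = goodD[OF good_chain_good[OF extend.hyps(1)]]
  note m = nxt[OF extend.hyps(2) gc(6)]
  note g = goodD[OF extend.hyps(3)]
  from pchain_last[OF extend.prems(1)] show False
  proof
    assume "Suc (nxt c) = b"
    then show False using extend.prems(2) g(4,8) letter_pos(1)[of "nxt c"] by auto
  next
    assume "\<exists>e. pchain (s i) b e \<and> e \<in> s i \<and> e + M \<in> s i \<and> Suc e \<in> s i \<and> has_nxt e \<and> nxt e = Suc (nxt c)"
    then obtain e where e: "pchain (s i) b e" "e \<in> s i" "has_nxt e" "nxt e = Suc (nxt c)" by blast
    note n = nxt[OF e(3)]
    have e1: "1 \<le> e" using wordD[OF words(1) e(2)] by blast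
    have "e = Suc c" using n(1)[OF e1] e(4) m(1) by simp
    then show False using extend.IH e(1) extend.prems(2) by blast
  qed
qed

text \<open>The edge changes \<open>phi\<close> at a matched window. Either the new bar blocks that
  window, which is then \<open>nxt c\<close>, or it is read there through \<open>c\<close>; in the
  second case \<open>psi\<close> at \<open>c\<close> turns false, which by the recursion needs
  \<open>psi\<close> at \<open>nxt c\<close>.\<close>

lemma added_above_good_chain:
  assumes gc: "good_chain c" and a: "added i = Suc c"
  shows "has_nxt c \<and> nxt c \<in> s i \<and> (psi (S i) (nxt c) \<or> psi (T (Suc i)) (nxt c))"
proof -
  note g = goodD[OF good_chain_good[OF gc]]
  have z: "Suc c \<notin> s i" "t (Suc i) = insert (Suc c) (s i)" using t_added[of i] a by simp_all
  obtain b where b: "b = win i \<or> b = win (Suc i)" "phi (S i) b \<noteq> phi (T (Suc i)) b" by (rule step_phi)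
  have b1: "1 \<le> b" "H\<^sub>0 \<le> height b" using b(1) window_pos(1) height_min by auto
  show ?thesis
  proof (cases "2 \<le> lt b \<and> Suc c = b + M - 1")
    case True
    then have e: "b + M = c + 2" using M_pos(1) by linarith
    have l: "lt c + 2 \<le> M"
    proof (rule ccontr)
      assume "\<not> ?thesis"
      then have "lt (Suc c) = M" using g(3,8) by linarith
      then have "lt (Suc (Suc c)) = 1" using letter_Suc[of "Suc c"] by simp
      then have "lt b = 1" using letter_period[OF b1(1)] e by simp
      then show False using True by simp
    qed
    have h: "has_nxt c" using l e b1(1) unfolding has_nxt_def by simp
    have bn: "b = nxt c" using e unfolding nxt_def by simp
    have "\<not> phi (T (Suc i)) b" using True z(2) unfolding phi_def free_def by auto
    then have "phi (S i) b" using b(2) by blast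
    then show ?thesis using h bn unfolding phi_def free_def by blast
  next
    case nx: False
    obtain d where d: "pchain (s i) b d" "2 \<le> lt b \<longrightarrow> b + M - 1 \<notin> s i"
        "Suc c = d \<or> Suc c = d + M \<or> lt d < M \<and> Suc c = Suc d"
      using phi_edge[OF edge b(2)] nx unfolding a by blast
    have "Suc c \<noteq> d" using good_chain_blocked[OF gc] d(1,2) by blast
    \<comment> \<open>The end of a window is 2 above it, but \<open>Suc c\<close> is only 1 above
      the minimal height.\<close>
    moreover have "Suc c \<noteq> d + M"
    proof
      assume e: "Suc c = d + M"
      have "1 \<le> d" "height d = height b" using diag_pos[OF pchain_diag[OF d(1)] b1(1)] by blast+
      then have "height (Suc c) = height b + 2" using height_period e by simp
      then show False using g(7) b1(2) by simp
    qed
    ultimately have dc: "d = c" using d(3) by blast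
    show ?thesis
    proof (rule ccontr)
      assume no: "\<not> ?thesis"
      have "psi (S i) c" by (rule psi_10[OF z(1) g(3)])
      moreover have "nxt c \<in> s i" if "has_nxt c" "nxt c \<in> t (Suc i)"
        using that nxt(3)[OF that(1) g(6)] z(2) by auto
      then have "psi (T (Suc i)) c" using no z(2) g(3) g(4)[of i] psi_11[of c "T (Suc i)"] by auto
      ultimately have "b \<in> s i \<and> (psi (S i) b \<longleftrightarrow> psi (T (Suc i)) b)"
        using psi_pchain[of "S i" b c "T (Suc i)"] d(1) dc g(5) z(2) by blast
      moreover have "free (s i) b \<longleftrightarrow> free (t (Suc i)) b"
        using calculation d(2) nx unfolding free_def z(2) by auto
      ultimately show False using b(2) unfolding phi_def by blast
    qed
  qed
qed

text \<open>The isomorphism is chosen at \<open>c\<close>, so the earlier window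
  \<open>nxt c\<close>, unblocked in the source, must have failed.\<close>

lemma dropped_above_good_chain:
  assumes gc: "good_chain c" and p: "pivot i = Suc c" and h: "has_nxt c"
  shows "\<not> phi (S i) (nxt c)" "nxt c \<in> s i \<Longrightarrow> \<not> psi (S i) (nxt c)"
proof -
  note g = goodD[OF good_chain_good[OF gc]]
  note n = nxt[OF h g(6)]
  have w: "win i = c" using g(9) p by blast
  show ph: "\<not> phi (S i) (nxt c)" using window(2) n(3) w by simp
  have "nxt c + M \<le> N" using window_pos(2)[of i] w n(1,6) by linarith
  moreover have "Suc c \<notin> s i" using t_pivot(2)[of i] p by simp
  ultimately show "\<not> psi (S i) (nxt c)" if "nxt c \<in> s i"
    using ph that n(8) unfolding phi_def free_def by simp
qed

text \<open>If \<open>Suc d\<close> is permanently barred, \<open>nxt d\<close> is permanently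
  blocked and never a window, so its bars are frozen too and the recursion follows a fixed path. It
  ends in a constant or in a mark at the letter \<open>M\<close>; \<open>v\<close> keeps track of
  the negations passed on the way.\<close>

lemma frozen_psi:
  assumes "1 \<le> d" "height d = H\<^sub>0" "\<And>i. d \<in> s i" "\<And>i. pivot i \<noteq> d + M" "\<And>i. lt d < M \<Longrightarrow> pivot i \<noteq> Suc d"
  shows "(\<exists>v. \<forall>i. psi (S i) d = v \<and> psi (T i) d = v) \<or>
    (\<exists>f v. lt f = M \<and> (\<forall>i. chain (s i) d f) \<and>
      (\<forall>i. (psi (S i) d \<longleftrightarrow> v = (mk (S i) (f, lt f) = Some Plus)) \<and>
        (psi (T i) d \<longleftrightarrow> v = (mk (T i) (f, lt f) = Some Plus))))"
  using assms
proof (induction d rule: less_induct)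
  case (less d)
  have y: "d + M \<in> s i \<longleftrightarrow> d + M \<in> s 0" "d + M \<in> t i \<longleftrightarrow> d + M \<in> s 0" for i
    using never_dropped(1,3)[OF less.prems(4)] by blast+
  have z: "Suc d \<in> s i \<longleftrightarrow> Suc d \<in> s 0" "Suc d \<in> t i \<longleftrightarrow> Suc d \<in> s 0" if "lt d < M" for i
    using never_dropped(1,3)[OF less.prems(5)[OF that]] by blast+
  have l: "lt d < M \<or> lt d = M" using letter_le[of d] by linarith
  consider "d + M \<notin> s 0" | "d + M \<in> s 0" "lt d = M" | "lt d < M" "Suc d \<notin> s 0"
    | "d + M \<in> s 0" "lt d < M" "Suc d \<in> s 0" using l by blast
  then show ?case
  proof cases
    case 1
    have "psi (S i) d = (lt d < M \<longrightarrow> Suc d \<notin> s 0)" "psi (T i) d = (lt d < M \<longrightarrow> Suc d \<notin> s 0)" for i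
      using psi_0[of d "S i"] psi_0[of d "T i"] y[of i] z[of i] 1 by blast+
    then have "\<forall>i. psi (S i) d = (lt d < M \<longrightarrow> Suc d \<notin> s 0) \<and> psi (T i) d = (lt d < M \<longrightarrow> Suc d \<notin> s 0)"
      by simp
    then show ?thesis by (intro disjI1 exI)
  next
    case 2
    have "chain (s i) d d" for i by (rule chain_end) (use less.prems(3) y(1) 2 in auto)
    moreover have "psi (S i) d \<longleftrightarrow> False = (mk (S i) (d, lt d) = Some Plus)"
      "psi (T i) d \<longleftrightarrow> False = (mk (T i) (d, lt d) = Some Plus)" for i
      using psi_last[of d "S i"] psi_last[of d "T i"] y[of i] 2 by blast+
    ultimately show ?thesis using 2(2) by (intro disjI2 exI[of _ d] exI[of _ False]) simp
  next
    case 3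
    have "psi (S i) d = True" "psi (T i) d = True" for i
      using psi_10[of d "S i"] psi_10[of d "T i"] z[OF 3(1), of i] 3 by blast+
    then show ?thesis by (intro disjI1 exI[of _ True]) simp
  next
    case 4
    have p11: "psi (S i) d \<longleftrightarrow> \<not> (has_nxt d \<and> nxt d \<in> s i \<and> psi (S i) (nxt d))"
      "psi (T i) d \<longleftrightarrow> \<not> (has_nxt d \<and> nxt d \<in> t i \<and> psi (T i) (nxt d))" for i
      using psi_11[of d "S i"] psi_11[of d "T i"] y[of i] z[OF 4(2), of i] 4 by blast+
    show ?thesis
    proof (cases "has_nxt d")
      case False
      then show ?thesis using p11 by (intro disjI1 exI[of _ True]) simp
    next
      case h: True
      note n = nxt[OF h less.prems(1)]
      have low: "pivot i \<noteq> nxt d" for i using pivot_low n(5) less.prems(2) by simp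
      have e: "nxt d \<in> s i \<longleftrightarrow> nxt d \<in> s 0" "nxt d \<in> t i \<longleftrightarrow> nxt d \<in> s 0" for i
        using never_dropped(1,3)[OF low] by blast+
      show ?thesis
      proof (cases "nxt d \<in> s 0")
        case False
        then have "psi (S i) d = True" "psi (T i) d = True" for i using p11[of i] e[of i] by blast+
        then show ?thesis by (intro disjI1 exI[of _ True]) simp
      next
        case True
        have nf: "win i \<noteq> nxt d" for i
        proof
          assume "win i = nxt d"
          then have "free (s i) (nxt d)" using window_pos(3)[of i] by simp
          then show False using n(8,9) z(1)[OF 4(2), of i] 4(3) unfolding free_def by simp
        qed
        have py: "pivot i \<noteq> nxt d + M" for i
        proof
          assume p: "pivot i = nxt d + M"
          show False
          proof (cases "typeA i")
            case True
            then show False using p nf[of i] by (simp add: pivot_def)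
          next
            case False
            then have w: "win i = Suc d" using p n(1) by (simp add: pivot_def)
            have "lt (Suc d) = Suc (lt d)" using letter_Suc[OF less.prems(1)] 4(2) by simp
            then have "2 \<le> lt (Suc d)" using letter_pos(1)[of d] by linarith
            then have "d + M \<notin> s i" using window_pos(3)[of i] w unfolding free_def by simp
            then show False using y(1)[of i] 4(1) by blast
          qed
        qed
        have pz: "pivot i \<noteq> Suc (nxt d)" if l: "lt (nxt d) < M" for i
        proof
          assume p: "pivot i = Suc (nxt d)"
          have "height (Suc (nxt d)) = H\<^sub>0 + 1" using height_Suc[OF n(2) l] n(5) less.prems(2) by simp
          from pivot_level(3)[OF this p] show False using nf[of i] by simp
        qed
        have es: "nxt d \<in> s i" "nxt d \<in> t i" for i using e[of i] True by blast+
        have p': "psi (S i) d \<longleftrightarrow> \<not> psi (S i) (nxt d)" "psi (T i) d \<longleftrightarrow> \<not> psi (T i) (nxt d)" for i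
          using p11[of i] h es[of i] by blast+
        have "height (nxt d) = H\<^sub>0" using n(5) less.prems(2) by simp
        from less.IH[OF n(3,2) this es(1) py pz] show ?thesis
        proof
          assume "\<exists>v. \<forall>i. psi (S i) (nxt d) = v \<and> psi (T i) (nxt d) = v"
          then obtain v where "\<forall>i. psi (S i) (nxt d) = v \<and> psi (T i) (nxt d) = v" by blast
          then show ?thesis using p' by (intro disjI1 exI[of _ "\<not> v"]) simp
        next
          assume "\<exists>f v. lt f = M \<and> (\<forall>i. chain (s i) (nxt d) f) \<and>
            (\<forall>i. (psi (S i) (nxt d) \<longleftrightarrow> v = (mk (S i) (f, lt f) = Some Plus)) \<and>
              (psi (T i) (nxt d) \<longleftrightarrow> v = (mk (T i) (f, lt f) = Some Plus)))"
          then obtain f v where f: "lt f = M" "\<And>i. chain (s i) (nxt d) f"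
            "\<And>i. psi (S i) (nxt d) \<longleftrightarrow> v = (mk (S i) (f, lt f) = Some Plus)"
            "\<And>i. psi (T i) (nxt d) \<longleftrightarrow> v = (mk (T i) (f, lt f) = Some Plus)" by blast
          have "chain (s i) d f" for i
            by (rule chain_step[OF less.prems(3) _ _ h f(2)]) (use y(1)[of i] z(1)[OF 4(2), of i] 4 in auto)
          moreover have "psi (S i) d \<longleftrightarrow> (\<not> v) = (mk (S i) (f, lt f) = Some Plus)"
            "psi (T i) d \<longleftrightarrow> (\<not> v) = (mk (T i) (f, lt f) = Some Plus)" for i
            using p'[of i] f(3,4)[of i] by blast+
          ultimately show ?thesis using f(1) by (intro disjI2 exI[of _ f] exI[of _ "\<not> v"]) simp
        qed
      qed
    qed
  qed
qed

text \<open>At the last good window, \<open>psi\<close> in the next one fails when the joining bar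
  is dropped and holds just before or after it is added. The bars there are frozen, so a mark would
  have to change in between.\<close>

lemma no_cycle: False
proof -
  obtain c\<^sub>0 where c0: "good_chain c\<^sub>0" and max: "\<And>c. good_chain c \<Longrightarrow> lt c \<le> lt c\<^sub>0"
    using ex_has_greatest_nat[of good_chain a\<^sub>0 lt "Suc M"] good_chain.base letter_le by (metis le_imp_less_Suc)
  have gc0: "good c\<^sub>0" by (rule good_chain_good[OF c0])
  note g = goodD[OF gc0]
  obtain i\<^sub>1 where i1: "win i\<^sub>1 = c\<^sub>0" using gc0 unfolding good_def by blast
  have p1: "pivot i\<^sub>1 = Suc c\<^sub>0" by (rule g(11)[OF i1])
  have z1: "Suc c\<^sub>0 \<notin> s i\<^sub>1" using t_pivot(2)[of i\<^sub>1] p1 by simp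
  have "\<exists>i. added i = Suc c\<^sub>0"
  proof (rule ccontr)
    assume no: "\<not> ?thesis"
    obtain j where j: "\<alpha> (Suc j) = \<alpha> i\<^sub>1" by (rule pred_exists)
    have "Suc c\<^sub>0 \<in> t (Suc j)" using t_pivot(1)[of i\<^sub>1] p1 j by simp
    then have "Suc c\<^sub>0 \<in> s j" using no unfolding t_added(1)[of j] by auto
    then have "Suc c\<^sub>0 \<in> s i\<^sub>1"
    proof (rule cycle_invariant_back[of "\<lambda>x. Suc c\<^sub>0 \<in> fst (fst x)", rotated])
      fix l assume "Suc c\<^sub>0 \<in> s (Suc l)"
      then have "Suc c\<^sub>0 \<in> t (Suc l)" unfolding t_pivot(1)[of "Suc l"] by simp
      then show "Suc c\<^sub>0 \<in> s l" using no unfolding t_added(1)[of l] by auto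
    qed
    then show False using z1 by blast
  qed
  then obtain i\<^sub>2 where i2: "added i\<^sub>2 = Suc c\<^sub>0" by blast
  note A = added_above_good_chain[OF c0]
  have h: "has_nxt c\<^sub>0" using A[OF i2] by blast
  note n = nxt[OF h g(6)]
  define c where "c = nxt c\<^sub>0"
  have hc: "height c = H\<^sub>0" "1 \<le> c" "lt c = lt c\<^sub>0 + 2" "c + M - 1 = Suc c\<^sub>0"
    using n g(1) by (simp_all add: c_def)
  have low: "pivot i \<noteq> c" for i using pivot_low hc(1) by simp
  have cs: "c \<in> s i" for i using never_dropped(1)[OF low, of i i\<^sub>2] A[OF i2] c_def by blast
  have D: "\<not> phi (S i) c" "\<not> psi (S i) c" if "pivot i = Suc c\<^sub>0" for i
    using dropped_above_good_chain[OF c0 that h] cs[of i] unfolding c_def by blast+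
  have lvl: "win i = c \<and> \<not> typeA i" if l: "lt c < M" and p: "pivot i = Suc c" for i
  proof -
    have "height (Suc c) = H\<^sub>0 + 1" using height_Suc[OF hc(2) l] hc(1) by simp
    from pivot_level(1,3)[OF this p] show ?thesis by simp
  qed
  have "win i = c \<and> typeA i" if p: "pivot i = c + M" for i
  proof (cases "typeA i")
    case True
    then show ?thesis using p by (simp add: pivot_def)
  next
    case False
    then have w: "win i = Suc c\<^sub>0" using p n(1) by (simp add: pivot_def c_def)
    have "2 \<le> lt (Suc c\<^sub>0)" using g(8) letter_pos(1)[of c\<^sub>0] by linarith
    then have "c\<^sub>0 + M \<notin> s i" using window_pos(3)[of i] w unfolding free_def by simp
    then show ?thesis using g(4)[of i] by blast
  qed
  then have iso: "isolated c" using cs lvl D(1) hc(4) unfolding isolated_def by simp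
  have py: "pivot i \<noteq> c + M" for i by (rule isolated_const[OF iso])
  \<comment> \<open>Such a drop would make \<open>nxt c\<^sub>0\<close> good, against the maximality
    of the letter of \<open>c\<^sub>0\<close>.\<close>
  have pz: "pivot i \<noteq> Suc c" if l: "lt c < M" for i
  proof
    assume "pivot i = Suc c"
    then have "good c" using goodI[OF hc(1) iso] lvl[OF l] by blast
    then have "good_chain c" using good_chain.extend[OF c0 h] unfolding c_def by blast
    then show False using max[of c] hc(3) by simp
  qed
  have psi1: "\<not> psi (S i\<^sub>1) c" by (rule D(2)[OF p1])
  have psi2: "psi (S i) c \<or> psi (T (Suc i)) c" if "added i = Suc c\<^sub>0" for i
    using A[OF that] unfolding c_def by blast
  from frozen_psi[OF hc(2,1) cs py pz] show False
  proof
    assume "\<exists>v. \<forall>i. psi (S i) c = v \<and> psi (T i) c = v"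
    then show False using psi1 psi2[OF i2] by blast
  next
    assume "\<exists>f v. lt f = M \<and> (\<forall>i. chain (s i) c f) \<and>
      (\<forall>i. (psi (S i) c \<longleftrightarrow> v = (mk (S i) (f, lt f) = Some Plus)) \<and>
        (psi (T i) c \<longleftrightarrow> v = (mk (T i) (f, lt f) = Some Plus)))"
    then obtain f v where f: "lt f = M" and ch: "\<And>i. chain (s i) c f"
      and pS: "\<And>i. psi (S i) c \<longleftrightarrow> v = (mk (S i) (f, lt f) = Some Plus)"
      and pT: "\<And>i. psi (T i) c \<longleftrightarrow> v = (mk (T i) (f, lt f) = Some Plus)" by blast
    have fs: "f \<in> s i" for i using chain_last[OF ch] by blast
    have ptf: "(f, lt f) \<in> points n k" by (rule corner_point[OF fs words(1)])
    \<comment> \<open>The second conjunct says that \<open>psi\<close> fails at \<open>c\<close>. It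
      is phrased by the mark so that it can be followed along edges.\<close>
    let ?Q = "\<lambda>x. Suc c\<^sub>0 \<notin> fst (fst x) \<and> v \<noteq> (mk (fst x) (f, lt f) = Some Plus)"
    have step: "added i \<noteq> Suc c\<^sub>0 \<and> ?Q (\<alpha> (Suc i))" if Q: "?Q (\<alpha> i)" for i
    proof -
      have fr: "free (s i) c" using cs[of i] Q hc(4) unfolding free_def by simp
      note cc = chain_comp[OF ch fr words(1)]
      have ce: "comp (s i) (f, lt f) = comp (s i) (c, lt c)" by (rule comp_eqI[OF chain_conn[OF ch words(1)]])
      \<comment> \<open>The bar would merge the circle of \<open>c\<close> with that of
        \<open>c\<^sub>0\<close>, which is marked \<open>Plus\<close>. The mark at \<open>f\<close>
        stays the same, so \<open>psi\<close> fails on both sides of the edge.\<close>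
      have na: "added i \<noteq> Suc c\<^sub>0"
      proof
        assume a: "added i = Suc c\<^sub>0"
        have nS: "\<not> psi (S i) c" using pS[of i] Q by blast
        have P0: "mk (S i) (c\<^sub>0, lt c\<^sub>0) = Some Plus" by (rule good_chain_mark[OF c0]) (use Q in blast)
        have "mk (S i) (c, lt c) \<noteq> None"
          using mk_None[OF pair_D(1)[OF window(1)] corner_point[OF cs words(1)]] cc by blast
        then obtain x where x: "mk (S i) (c, lt c) = Some x" by blast
        have ne: "comp (s i) (c\<^sub>0, lt c\<^sub>0) \<noteq> comp (s i) (nxt c\<^sub>0, lt (nxt c\<^sub>0))"
        proof
          assume "comp (s i) (c\<^sub>0, lt c\<^sub>0) = comp (s i) (nxt c\<^sub>0, lt (nxt c\<^sub>0))"
          then have "(c\<^sub>0, lt c\<^sub>0) \<in> comp (s i) (c, lt c)" using comp_refl c_def by metis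
          then have "lt c \<le> lt c\<^sub>0" using cc by blast
          then show False using hc(3) by simp
        qed
        have T0: "mk (T (Suc i)) (c\<^sub>0, lt c\<^sub>0) = Some x"
          using edge_merge[OF _ h g(5) P0 _ ne] x edge[of i] a unfolding c_def by simp
        have te: "t (Suc i) = insert (Suc c\<^sub>0) (s i)" using t_added(1)[of i] a by simp
        have "chain (t (Suc i)) (nxt c\<^sub>0) f"
          using chain_mono[OF ch f, of i "t (Suc i)"] te unfolding c_def by blast
        then have "chain (t (Suc i)) c\<^sub>0 f"
          by (intro chain_step[OF _ _ _ h]) (use g(4,5) te in auto)
        then have "comp (t (Suc i)) (f, lt f) = comp (t (Suc i)) (c\<^sub>0, lt c\<^sub>0)"
          by (rule comp_eqI[OF chain_conn[OF _ words(2)]])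
        then have "mk (T (Suc i)) (f, lt f) = mk (S i) (f, lt f)" using T0 x ce unfolding mk_def by simp
        then have "\<not> psi (T (Suc i)) c" using pT[of "Suc i"] Q by simp
        then show False using psi2[OF a] nS by blast
      qed
      have "\<not> touches n (added i) (comp (s i) (f, lt f))"
        using cc t_added(2,3)[of i] na hc(4) f unfolding ce by auto
      then have mT: "mk (T (Suc i)) (f, lt f) = mk (S i) (f, lt f)" by (rule edge_mk[OF edge ptf])
      have "Suc c\<^sub>0 \<notin> t (Suc i)" using Q na unfolding t_added(1)[of i] by simp
      then have zS: "Suc c\<^sub>0 \<notin> s (Suc i)" unfolding t_pivot(1)[of "Suc i"] by simp
      \<comment> \<open>For \<open>f = c\<close> an isolated window would need G2, impossible for
        the letter \<open>M\<close>; any other end of the chain is blocked.\<close>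
      have "win (Suc i) \<noteq> f"
      proof
        assume w: "win (Suc i) = f"
        show False
        proof (cases "f = c")
          case True
          then show False
            using isolated_not_typeA[OF iso] w pairB_D(8)[OF not_typeA[of "Suc i"]] f by simp
        next
          case False
          then show False using chain_not_free[OF ch words(1) False, of "Suc i"] window_pos(3)[of "Suc i"] w by simp
        qed
      qed
      then have "mk (S (Suc i)) (f, lt f) = mk (S i) (f, lt f)" using unpivoted_mk[OF fs] mT by simp
      then show ?thesis using na zS Q by simp
    qed
    have "?Q (\<alpha> i\<^sub>1)" using z1 psi1 pS[of i\<^sub>1] by blast
    then have "?Q (\<alpha> i\<^sub>2)" by (rule cycle_invariant[of ?Q, rotated]) (use step in blast)
    then show False using step[of i\<^sub>2] i2 by blast
  qed
qed

end

section \<open>Unrolling a directed cycle of the graph\<close>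

context braid
begin

lemma acyclic_GE_graph: "acyclic (GE_graph n k)"
proof (rule acyclicI, rule allI, rule notI)
  fix x assume "(x, x) \<in> (GE_graph n k)\<^sup>+"
  then obtain m where m: "0 < m" "(x, x) \<in> GE_graph n k ^^ m" by (auto simp: trancl_power)
  then obtain f where f: "f 0 = x" "f m = x" "\<forall>i<m. (f i, f (Suc i)) \<in> GE_graph n k"
    unfolding relpow_fun_conv by blast
  define \<alpha> where "\<alpha> i = f (i mod m)" for i
  have "(\<alpha> i, \<alpha> (Suc i)) \<in> GE_graph n k" for i
  proof (cases "Suc (i mod m) = m")
    case True
    then have "\<alpha> (Suc i) = f (Suc (i mod m))" using f(1,2) by (simp add: \<alpha>_def mod_Suc)
    then show ?thesis using f(3) m(1) by (simp add: \<alpha>_def)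
  next
    case False
    then show ?thesis using f(3) m(1) by (simp add: \<alpha>_def mod_Suc)
  qed
  then interpret braid_cycle n M k \<alpha> m by unfold_locales (use m(1) in \<open>auto simp: \<alpha>_def\<close>)
  obtain i where i: "\<And>j. height (win i) \<le> height (win j)"
    using ex_has_least_nat[of "\<lambda>_. True" 0 "\<lambda>i. height (win i)"] by blast
  obtain i\<^sub>0 where i0: "height (win i\<^sub>0) = height (win i)"
      "\<And>j. height (win j) = height (win i) \<Longrightarrow> lt (win i\<^sub>0) \<le> lt (win j)"
    \<comment> \<open>The letter is minimized only among the windows of minimal height.\<close>
    using ex_has_least_nat[of "\<lambda>j. height (win j) = height (win i)" i "\<lambda>j. lt (win j)"] by blast
  interpret braid_cycle_min n M k \<alpha> m i\<^sub>0 by unfold_locales (use i i0 in auto)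
  show False by (rule no_cycle)
qed

end

theorem theorem3p23:
  fixes n k :: nat
  assumes "n \<ge> 2" and "k \<ge> 1"
  shows "acyclic (GE_graph n k)"
proof -
  interpret braid n "n - 1" k
    by unfold_locales (use assms in auto)
  show ?thesis by (rule acyclic_GE_graph)
qed

end
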